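(* Let $f:\mathbb R\to\mathbb R$ be an even (measurable) function for which there exist fixed $\epsilon>0$ and $A>0$ with $|f(x)|<A(1+|x|)^{-(1+\epsilon)}$ for all $x\in\mathbb R$. For any integer $m\ge2$, if $\operatorname{supp}\widehat f\subseteq[-2/m,2/m]$, then $$\lim_{N\to\infty}\mathbb E\left\{\left(Z_f-\widehat f(0)\right)^m\right\}=\begin{cases}0,&\text{if } m \text{ is odd},\\[1mm] \dfrac{(2k)!}{2^k\,k!}\,\sigma^m,&\text{if } m=2k,\ k\ge1\text{ an integer},\end{cases}$$ where $\sigma\ge0$ and $\sigma^2=\int_{-\infty}^\infty\min(|u|,1)\,\widehat f(u)^2\,du$.
   Context: The Fourier transform is $\widehat f(u)=\int_{-\infty}^\infty f(x)e^{-2\pi i xu}\,dx$. For a positive integer $N$ define the $2\pi$-periodic function $$F_N(\theta)=\sum_{j=-\infty}^\infty f\left(\tfrac N{2\pi}(\theta+2\pi j)\right),$$ and for an $N\times N$ unitary matrix $U$ with eigenvalues $e^{i\theta_1},\dots,e^{i\theta_N}$ (with multiplicity) define $Z_f(U)=\sum_{j=1}^N F_N(\theta_j)$. $\mathbb E$ denotes expectation over $U$ in the unitary group $U(N)$ with respect to Haar probability measure. *)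

theory Defs
  imports
    "HOL-Probability.Probability"
    "Jordan_Normal_Form.Char_Poly"
    "Jordan_Normal_Form.Schur_Decomposition"
begin

definition fourier :: "(real \<Rightarrow> real) \<Rightarrow> real \<Rightarrow> complex" where
  "fourier f u =
     (LINT x|lebesgue. complex_of_real (f x) * exp (- 2 * complex_of_real pi * \<i> * of_real x * of_real u))"

definition periodized :: "(real \<Rightarrow> real) \<Rightarrow> nat \<Rightarrow> real \<Rightarrow> real" where
  "periodized f N \<theta> = (\<Sum>\<^sub>\<infinity>j::int. f (real N / (2 * pi) * (\<theta> + 2 * pi * of_int j)))"

text \<open>
  The eigenvalues with multiplicity are the roots of the characteristic polynomial. For unitary
  matrices they have modulus 1, so each root is \<open>cis (Arg z)\<close>; since \<^term>\<open>periodized f N\<close> is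
  \<open>2\<pi>\<close>-periodic, the choice of the argument is immaterial.
\<close>
definition linear_statistic :: "(real \<Rightarrow> real) \<Rightarrow> nat \<Rightarrow> complex mat \<Rightarrow> real" where
  "linear_statistic f N U = (\<Sum>z\<in>#proots (char_poly U). periodized f N (Arg z))"

definition unitary_group :: "nat \<Rightarrow> complex mat set" where
  "unitary_group N = {U \<in> carrier_mat N N. mat_adjoint U * U = 1\<^sub>m N}"

text \<open>
  The Borel sigma-algebra of \<open>U(N)\<close> as a subspace of \<open>\<complex>\<close>-valued \<open>N \<times> N\<close> arrays: it is
  pulled back from the finite product of the Borel sigma-algebras along the entry map.
\<close>
definition unitary_borel :: "nat \<Rightarrow> complex mat measure" where
  "unitary_borel N =
     vimage_algebra (unitary_group N)
       (\<lambda>U. \<lambda>ij\<in>{..<N} \<times> {..<N}. U $$ ij)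
       (\<Pi>\<^sub>M ij\<in>{..<N} \<times> {..<N}. (borel :: complex measure))"

text \<open>Left translation invariance characterises this probability measure uniquely.\<close>
definition haar_prob :: "nat \<Rightarrow> complex mat measure \<Rightarrow> bool" where
  "haar_prob N M \<longleftrightarrow>
     prob_space M \<and> sets M = sets (unitary_borel N) \<and>
     (\<forall>V\<in>unitary_group N. distr M M (\<lambda>U. V * U) = M)"

end

theory Submission
  imports Defs
begin

text \<open>
  Poisson summation turns the linear statistic into a trigonometric polynomial in the power traces
  \<open>p k = tr (U ^ k)\<close>: almost surely \<open>Z f - fhat 0\<close> is the sum of \<open>fhat (k / N) / N * p k\<close> over
  \<open>0 < \<bar>k\<bar> \<le> 2 N / m\<close>. (The eigenvalues avoid any fixed null set of the circle almost surely, because the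
  mean eigenvalue measure is rotation invariant.) Its \<open>m\<close>-th moment only involves \<open>E (p k1 \<dots> p km)\<close>
  with \<open>\<bar>k1\<bar> + \<dots> + \<bar>km\<bar> \<le> 2 N\<close>, and in this range these expectations are exactly those of independent
  complex Gaussians. To see this, differentiate the invariance of the Haar measure: this gives linear
  (loop) equations between the joint moments, which the Gaussian moments satisfy too, and which in
  the range above are diagonally dominant and hence have at most one solution. Thus the \<open>m\<close>-th moment
  is exactly Gaussian, with variance the Riemann sum \<open>(\<Sum>k. \<bar>k / N\<bar> * fhat (k / N)^2) / N\<close>, which tends
  to \<open>\<sigma>^2\<close>.
\<close>

section \<open>Gaussian moments and the loop equation\<close>

text \<open>Where the bound 2N comes from: scalar rotations kill every moment whose indices do not
  sum to 0, so in a surviving one the positive and the negative indices have the same total d, and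
  |k1| + ... + |km| = 2d. Call d the level. For a positive index n the loop equation writes N times
  a moment of level d through n - 1 splittings of n, of weight 1 each, and through fusions of n with
  the other positive indices, whose weights add up to d - n. Fusions with negative indices lower the
  level. The total weight d - 1 at the same level is below N exactly when d <= N.

  A second obstacle is measurability. The function f is only Lebesgue measurable while F_N is
  defined pointwise, and no measurable choice of eigenvalues is available at the outset. Hence f is
  replaced by a Borel function with the same decay, only symmetric sums over the spectrum are
  integrated, and the final moment is an integral over the completion of Haar measure. Convergence
  of Fourier series never enters: F_N has finitely many nonzero coefficients, so uniqueness of
  Fourier coefficients identifies it almost everywhere.\<close>

text \<open>
  The joint moment of the power traces \<open>p k\<close> in the Gaussian range: the \<open>p k\<close> with \<open>k > 0\<close> behave like
  independent complex Gaussians of variance \<open>k\<close>, and \<open>p (- k)\<close> is the conjugate of \<open>p k\<close>.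
\<close>
definition paired_moment :: "int multiset \<Rightarrow> complex" where
  "paired_moment M = (if \<forall>k. count M k = count M (- k)
     then \<Prod>k\<in>{k \<in> set_mset M. 0 < k}. of_int k ^ count M k * fact (count M k) else 0)"

text \<open>An index of count 0 contributes the factor 1, so two multisets that differ by one pair
  can be compared over a common index set.\<close>

lemma paired_moment_pos_superset:
  assumes "finite S" "{k \<in> set_mset M. 0 < k} \<subseteq> S" "S \<subseteq> {0<..}" "\<And>k. count M k = count M (- k)"
  shows "paired_moment M = (\<Prod>k\<in>S. of_int k ^ count M k * fact (count M k))"
proof -
  have "\<forall>k\<in>S - {k \<in> set_mset M. 0 < k}. of_int k ^ count M k * fact (count M k) = (1 :: complex)"
  proof
    fix k assume "k \<in> S - {k \<in> set_mset M. 0 < k}"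
    then have "count M k = 0" using assms(3) by (auto simp: not_in_iff)
    then show "of_int k ^ count M k * fact (count M k) = (1 :: complex)" by simp
  qed
  then have "(\<Prod>k\<in>{k \<in> set_mset M. 0 < k}. of_int k ^ count M k * fact (count M k) :: complex)
      = (\<Prod>k\<in>S. of_int k ^ count M k * fact (count M k))"
    using assms(1,2) by (intro prod.mono_neutral_left)
  moreover have "\<forall>k. count M k = count M (- k)" using assms(4) by blast
  ultimately show ?thesis unfolding paired_moment_def by presburger
qed

text \<open>Only the factor at |n| changes: its exponent and its factorial go from c to c + 1, which
  gives the ratio |n| * (c + 1). Adding a pair does not affect balance, so otherwise both sides are
  0.\<close>

lemma paired_moment_cancel_pair:
  assumes "n \<noteq> 0"
  shows "paired_moment (add_mset n (add_mset (- n) M))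
    = of_int \<bar>n\<bar> * of_nat (Suc (count M (- n))) * paired_moment M"
proof (cases "\<forall>k. count M k = count M (- k)")
  case False
  then obtain k where k: "count M k \<noteq> count M (- k)" by blast
  have "count (add_mset n (add_mset (- n) M)) k \<noteq> count (add_mset n (add_mset (- n) M)) (- k)"
    using k assms by auto
  then have "\<not> (\<forall>k. count (add_mset n (add_mset (- n) M)) k = count (add_mset n (add_mset (- n) M)) (- k))"
    by blast
  then show ?thesis using False unfolding paired_moment_def by auto
next
  case True
  define M' where "M' = add_mset n (add_mset (- n) M)"
  define p where "p = \<bar>n\<bar>"
  define T where "T = {k \<in> set_mset M. 0 < k} - {p}"
  have p: "p > 0" "p \<noteq> - p" "p = n \<or> p = - n" using assms by (auto simp: p_def)
  have T: "finite T" "p \<notin> T" by (auto simp: T_def)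
  have pn: "count M p = count M (- n)" using p True by metis
  have cp: "count M' p = Suc (count M p)"
    using p(3) assms by (auto simp: M'_def)
  have cT: "count M' k = count M k" if "k \<in> T" for k
    using that p by (auto simp: M'_def T_def)
  have bal: "count M' k = count M' (- k)" for k using True assms by (auto simp: M'_def)
  have "paired_moment M' = (\<Prod>k\<in>insert p T. of_int k ^ count M' k * fact (count M' k))"
    using p bal by (intro paired_moment_pos_superset) (auto simp: T_def M'_def)
  also have "\<dots> = of_int p ^ Suc (count M p) * fact (Suc (count M p))
      * (\<Prod>k\<in>T. of_int k ^ count M k * fact (count M k))"
    using T cT by (simp add: cp(1) cong: prod.cong)
  also have "\<dots> = of_int p * of_nat (Suc (count M p))
     * (\<Prod>k\<in>insert p T. of_int k ^ count M k * fact (count M k))"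
    using T by (simp add: algebra_simps)
  also have "(\<Prod>k\<in>insert p T. of_int k ^ count M k * fact (count M k)) = paired_moment M"
    using p True by (intro paired_moment_pos_superset[symmetric]) (auto simp: T_def)
  finally have "paired_moment M' = of_int p * of_nat (Suc (count M (- n))) * paired_moment M"
    by (simp only: pn)
  then show ?thesis by (simp only: M'_def p_def)
qed

text \<open>Gaussian integration by parts, or Wick's rule: E (p n * F) = |n| * E (dF / d p (-n)).
  The derivative of the monomial M in p (-n) is the count of -n times the monomial with one such
  factor removed.\<close>

lemma paired_moment_add:
  assumes "n \<noteq> 0"
  shows "paired_moment (add_mset n M)
    = of_int \<bar>n\<bar> * of_nat (count M (- n)) * paired_moment (M - {#- n#})"
proof (cases "- n \<in># M")
  case True
  then obtain M' where "M = add_mset (- n) M'" by (metis insert_DiffM)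
  then show ?thesis using paired_moment_cancel_pair[OF assms, of M'] by simp
next
  case False
  have "count (add_mset n M) n \<noteq> count (add_mset n M) (- n)"
    using False assms by (simp add: not_in_iff)
  then have "\<not> (\<forall>k. count (add_mset n M) k = count (add_mset n M) (- k))" by blast
  then have "paired_moment (add_mset n M) = 0" unfolding paired_moment_def by simp
  then show ?thesis using False by (simp add: not_in_iff)
qed

text \<open>A balanced multiset is fixed by negation, so its sum equals its own negative.\<close>

lemma paired_moment_unbalanced:
  assumes "\<Sum>\<^sub># M \<noteq> 0"
  shows "paired_moment M = 0"
proof (rule ccontr)
  assume "paired_moment M \<noteq> 0"
  then have "count M k = count M (- k)" for k by (metis paired_moment_def)
  moreover have "count (image_mset uminus M) k = count M (- k)" for k :: int
    by (induction M) auto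
  ultimately have "image_mset uminus M = M" by (intro multiset_eqI) metis
  moreover have "\<Sum>\<^sub># (image_mset uminus M) = - \<Sum>\<^sub># M" by (induction M) auto
  ultimately show False using assms by simp
qed

lemma sum_mset_eq_sum_count:
  fixes f :: "'a \<Rightarrow> complex"
  assumes "finite S" "set_mset M \<subseteq> S"
  shows "(\<Sum>a\<in>#M. f a) = (\<Sum>a\<in>S. of_nat (count M a) * f a)"
  using assms(2)
proof (induction M)
  case (add x M)
  have "(\<Sum>a\<in>S. of_nat (count (add_mset x M) a) * f a)
     = (\<Sum>a\<in>S. of_nat (count M a) * f a + (if a = x then f a else 0))"
    by (intro sum.cong) (auto simp: algebra_simps)
  also have "\<dots> = (\<Sum>a\<in>S. of_nat (count M a) * f a) + f x"
    using assms(1) add.prems by (simp add: sum.distrib)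
  finally show ?case using add by simp
qed simp

text \<open>
  An index \<open>0\<close> stands for the trace of the identity, that is, for the factor \<open>N\<close>.
\<close>
definition zero_ext :: "nat \<Rightarrow> int multiset \<Rightarrow> complex" where
  "zero_ext N M = of_nat N ^ count M 0 * paired_moment M"

lemma paired_moment_add_0: "paired_moment (add_mset 0 M) = paired_moment M"
proof -
  have "{k. (k = 0 \<or> k \<in># M) \<and> 0 < k} = {k. k \<in># M \<and> (0::int) < k}" by auto
  moreover have "(\<forall>k. count (add_mset 0 M) k = count (add_mset 0 M) (- k))
     \<longleftrightarrow> (\<forall>k. count M k = count M (- k))" by (metis count_add_mset neg_equal_0_iff_equal)
  ultimately show ?thesis unfolding paired_moment_def
    by (auto intro!: prod.cong)
qed

lemma zero_ext_add_0: "zero_ext N (add_mset 0 M) = of_nat N * zero_ext N M"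
  by (simp add: zero_ext_def paired_moment_add_0)

lemma zero_ext_nonzero: "0 \<notin># M \<Longrightarrow> zero_ext N M = paired_moment M"
  by (simp add: zero_ext_def not_in_iff)

text \<open>
  By the recursion \<open>paired_moment_add\<close> the terms with \<open>- n < a < 0\<close> of the second sum cancel the first sum,
  and the others cancel in pairs under the involution \<open>a \<mapsto> - n - a\<close>.
\<close>
lemma paired_moment_loop_sum:
  assumes n: "n > 0" and M: "0 \<notin># M"
  shows "(\<Sum>k=1..n-1. paired_moment (add_mset k (add_mset (n - k) M)))
     + (\<Sum>a\<in>#M. of_int a * (if a = - n then 0 else paired_moment (add_mset (n + a) (M - {#a#})))) = 0"
proof -
  \<comment> \<open>The number of ways to remove first a and then b from M, times the moment of the
    rest; it is symmetric because the order of removal is irrelevant.\<close>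
  define w where "w a b = of_nat (count M a) * of_nat (count (M - {#a#}) b)
     * paired_moment (M - {#a#} - {#b#})" for a b
  define B where "B a = of_int a * of_int \<bar>n + a\<bar> * w a (- n - a)" for a
  have w_sym: "w a b = w b a" for a b
    by (cases "a = b") (auto simp: w_def algebra_simps diff_right_commute)
  obtain R where R: "R > 0" "\<And>a. a \<in># M \<Longrightarrow> \<bar>a\<bar> \<le> R"
  proof
    show "Max (insert 1 (abs ` set_mset M)) > 0" by (rule less_le_trans[of _ 1]) auto
    show "\<bar>a\<bar> \<le> Max (insert 1 (abs ` set_mset M))" if "a \<in># M" for a using that by auto
  qed
  \<comment> \<open>A range that contains all entries of M and is mapped to itself by a -> - n -
    a.\<close>
  define S where "S = {- n - R..R}"
  have S: "finite S" "set_mset M \<subseteq> S" using R(2) n by (auto simp: S_def abs_le_iff) force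
  have "(\<Sum>a\<in>#M. of_int a * (if a = - n then 0 else paired_moment (add_mset (n + a) (M - {#a#}))))
     = (\<Sum>a\<in>S. of_nat (count M a) * (of_int a * (if a = - n then 0 else
         paired_moment (add_mset (n + a) (M - {#a#})))))"
    by (rule sum_mset_eq_sum_count[OF S])
  also have "\<dots> = (\<Sum>a\<in>S. B a)"
  proof (intro sum.cong refl)
    fix a
    show "of_nat (count M a) * (of_int a * (if a = - n then 0 else
         paired_moment (add_mset (n + a) (M - {#a#})))) = B a"
    proof (cases "a = - n")
      case False
      then have "n + a \<noteq> 0" by simp
      moreover have "- (n + a) = - n - a" by simp
      ultimately show ?thesis using False by (simp add: B_def w_def paired_moment_add)
    qed (simp add: B_def)
  qed
  also have "\<dots> = (\<Sum>a\<in>{-n<..<0}. B a) + (\<Sum>a\<in>S - {-n<..<0}. B a)"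
    using R(1) n by (subst sum.subset_diff[of "{-n<..<0}" S]) (auto simp: S_def)
  also have "(\<Sum>a\<in>S - {-n<..<0}. B a) = 0"
  proof -
    have "(\<Sum>a\<in>S - {-n<..<0}. B a) = (\<Sum>a\<in>S - {-n<..<0}. B (- n - a))"
      by (rule sum.reindex_bij_witness[of _ "\<lambda>a. - n - a" "\<lambda>a. - n - a"]) (auto simp: S_def)
    also have "\<dots> = (\<Sum>a\<in>S - {-n<..<0}. - B a)"
    proof (intro sum.cong refl)
      \<comment> \<open>Here a and n + a do not have opposite signs, so a * |n + a| = |a| * (n + a),
        and the involution turns this into its negative.\<close>
      fix a assume "a \<in> S - {-n<..<0}"
      then consider "a \<le> - n" | "a \<ge> 0" by force
      then show "B (- n - a) = - B a"
      proof cases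
        case 1
        then show ?thesis using n w_sym[of a "- n - a"] by (simp add: B_def algebra_simps)
      next
        case 2
        then show ?thesis using n w_sym[of a "- n - a"] by (simp add: B_def algebra_simps)
      qed
    qed
    finally show ?thesis by (simp add: sum_negf)
  qed
  also have "(\<Sum>a\<in>{-n<..<0}. B a) = (\<Sum>k=1..n-1. B (- k))"
    by (rule sum.reindex_bij_witness[of _ "\<lambda>a. - a" "\<lambda>a. - a"]) auto
  moreover have "paired_moment (add_mset k (add_mset (n - k) M)) = - B (- k)" if "k \<in> {1..n-1}" for k
  proof -
    have k: "0 < k" "k < n" using that by auto
    have "paired_moment (add_mset k (add_mset (n - k) M))
       = of_int k * of_nat (count M (- k)) * paired_moment (add_mset (n - k) M - {#- k#})"
      using k by (simp add: paired_moment_add)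
    \<comment> \<open>The index k cannot contract with its partner n - k, since their sum is n and
      not 0.\<close>
    also have "add_mset (n - k) M - {#- k#} = add_mset (n - k) (M - {#- k#})"
      using k n by (simp add: add_mset_remove_trivial_eq diff_add_mset_swap)
    also have "paired_moment \<dots> = of_int (n - k) * of_nat (count (M - {#- k#}) (k - n))
        * paired_moment (M - {#- k#} - {#k - n#})"
      using k by (simp add: paired_moment_add)
    finally show ?thesis using k by (simp add: B_def w_def algebra_simps)
  qed
  ultimately show ?thesis by (simp add: sum_negf)
qed


section \<open>Uniqueness for the loop equations\<close>

definition pos_sum :: "int multiset \<Rightarrow> int" where
  "pos_sum M = (\<Sum>a\<in>#M. max a 0)"

definition neg_sum :: "int multiset \<Rightarrow> int" where
  "neg_sum M = (\<Sum>a\<in>#M. max (- a) 0)"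

lemma pos_sum_add [simp]: "pos_sum (add_mset a M) = max a 0 + pos_sum M"
  and neg_sum_add [simp]: "neg_sum (add_mset a M) = max (- a) 0 + neg_sum M"
  and pos_sum_union [simp]: "pos_sum (M + M') = pos_sum M + pos_sum M'"
  and neg_sum_union [simp]: "neg_sum (M + M') = neg_sum M + neg_sum M'"
  and pos_sum_empty [simp]: "pos_sum {#} = 0"
  and neg_sum_empty [simp]: "neg_sum {#} = 0"
  by (simp_all add: pos_sum_def neg_sum_def)

lemma pos_sum_nonneg: "pos_sum M \<ge> 0"
  by (induction M) auto

lemma neg_sum_nonneg: "neg_sum M \<ge> 0"
  by (induction M) auto

lemma sum_mset_eq_pos_neg: "\<Sum>\<^sub># M = pos_sum M - neg_sum M"
  by (induction M) auto

text \<open>For a multiset with sum 0 the two parts agree, so a bound 2N on the sum of absolute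
  values becomes the bound N on the level \<open>pos_sum\<close>.\<close>

lemma sum_abs_mset_eq_pos_neg: "(\<Sum>a\<in>#M. \<bar>a\<bar>) = pos_sum M + neg_sum M"
  by (induction M) auto

text \<open>This makes the maximum in the uniqueness argument exist. Positive entries force both the
  size and every entry to be at most d, so finitely many lists represent all these
  multisets.\<close>

lemma finite_positive_mset_with_sum: "finite {L :: int multiset. (\<forall>a\<in>#L. 0 < a) \<and> \<Sum>\<^sub># L = d}"
proof -
  have "{L :: int multiset. (\<forall>a\<in>#L. 0 < a) \<and> \<Sum>\<^sub># L = d}
     \<subseteq> mset ` {xs. set xs \<subseteq> {0..d} \<and> length xs \<le> nat d}"
  proof
    fix L :: "int multiset" assume "L \<in> {L. (\<forall>a\<in>#L. 0 < a) \<and> \<Sum>\<^sub># L = d}"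
    then have L: "\<forall>a\<in>#L. 0 < a" "\<Sum>\<^sub># L = d" by auto
    obtain xs where xs: "mset xs = L" using ex_mset by blast
    from L(1) have size: "int (size L) \<le> \<Sum>\<^sub># L" by (induction L) auto
    have "a \<le> \<Sum>\<^sub># L" if "a \<in># L" for a
      using L(1) that
    proof (induction L)
      case (add b L)
      have "\<forall>a\<in>#L. 0 < a" using add.prems(1) by auto
      then have "0 \<le> \<Sum>\<^sub># L" by (induction L) auto
      with add show ?case by force
    qed simp
    then have "set xs \<subseteq> {0..d}" "length xs \<le> nat d"
      using L size xs by (force simp flip: xs)+
    with xs show "L \<in> mset ` {xs. set xs \<subseteq> {0..d} \<and> length xs \<le> nat d}" by blast
  qed
  moreover have "finite {xs. set xs \<subseteq> {0..d} \<and> length xs \<le> nat d}"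
    by (rule finite_lists_length_le) simp
  ultimately show ?thesis by (meson finite_imageI finite_subset)
qed

text \<open>
  Induction on \<open>d\<close>. With the negative indices fixed, the equation expresses \<open>N * D\<close> through at most \<open>d - 1\<close>
  values of \<open>D\<close> at the same level \<open>d\<close>; the remaining terms belong to a lower level. Since \<open>d - 1 < N\<close>,
  the maximum of \<open>\<bar>D\<bar>\<close> over the finitely many positive parts must be \<open>0\<close>.
\<close>
lemma loop_equation_homogeneous_unique:
  fixes D :: "int multiset \<Rightarrow> complex"
  assumes zero: "\<And>M. D (add_mset 0 M) = of_nat N * D M"
    and empty: "D {#} = 0"
    and unbal: "\<And>M. \<Sum>\<^sub># M \<noteq> 0 \<Longrightarrow> D M = 0"
    and loop: "\<And>n M. n > 0 \<Longrightarrow> 0 \<notin># M \<Longrightarrow> of_nat N * D (add_mset n M)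
       + (\<Sum>k=1..n-1. D (add_mset k (add_mset (n - k) M)))
       + (\<Sum>a\<in>#M. of_int a * D (add_mset (n + a) (M - {#a#}))) = 0"
  shows "0 \<notin># M \<Longrightarrow> pos_sum M = int d \<Longrightarrow> neg_sum M = int d \<Longrightarrow> d \<le> N \<Longrightarrow> D M = 0"
proof (induction d arbitrary: M rule: less_induct)
  case (less d)
  \<comment> \<open>The induction hypothesis is extended to all multisets of lower positive sum:
    unbalanced ones vanish by assumption, and each index 0, as created by fusing n with -n, only
    contributes a factor N.\<close>
  have IH: "D M' = 0" if "pos_sum M' < int d" for M' :: "int multiset"
  proof (cases "pos_sum M' = neg_sum M'")
    case False
    then show ?thesis by (intro unbal) (simp add: sum_mset_eq_pos_neg)
  next
    case True
    have "D M'' = 0" if "0 \<notin># M''" "pos_sum M'' < int d" "pos_sum M'' = neg_sum M''" for M''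
      using that less.prems(4) pos_sum_nonneg[of M'']
      by (intro less.IH[of "nat (pos_sum M'')"]) auto
    note nz = this
    have "D (replicate_mset c 0 + M'') = of_nat N ^ c * D M''" for c M''
      by (induction c) (auto simp: zero)
    moreover have "M' = replicate_mset (count M' 0) 0 + filter_mset (\<lambda>a. a \<noteq> 0) M'"
      by (rule multiset_eqI) auto
    moreover have "pos_sum (filter_mset (\<lambda>a. a \<noteq> 0) M') = pos_sum M'"
        "neg_sum (filter_mset (\<lambda>a. a \<noteq> 0) M') = neg_sum M'"
      by (induction M') auto
    moreover have "D (filter_mset (\<lambda>a. a \<noteq> 0) M') = 0"
      using True that calculation(3,4) by (intro nz) auto
    ultimately show ?thesis by (metis mult_zero_right)
  qed
  show ?case
  proof (cases "d = 0")
    case True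
    have "M = {#}"
    proof (rule ccontr)
      assume "M \<noteq> {#}"
      then obtain a where "a \<in># M" by blast
      moreover from this have "a \<noteq> 0" using less.prems(1) by auto
      moreover obtain M' where "M = add_mset a M'" using \<open>a \<in># M\<close> by (metis insert_DiffM)
      ultimately show False
        using less.prems(2,3) True pos_sum_nonneg[of M'] neg_sum_nonneg[of M']
        unfolding \<open>M = add_mset a M'\<close> pos_sum_add neg_sum_add by linarith
    qed
    then show ?thesis by (simp add: empty)
  next
    case False
    define V where "V = filter_mset (\<lambda>a. a < 0) M"
    define \<Lambda> where "\<Lambda> = {L :: int multiset. (\<forall>a\<in>#L. 0 < a) \<and> \<Sum>\<^sub># L = int d}"
    define K where "K = Max ((\<lambda>L. norm (D (L + V))) ` \<Lambda>)"
    have pos_L: "pos_sum L = \<Sum>\<^sub># L" if "\<forall>a\<in>#L. 0 < a" for L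
      using that by (induction L) auto
    have fin: "finite \<Lambda>" unfolding \<Lambda>_def by (rule finite_positive_mset_with_sum)
    have "pos_sum (filter_mset (\<lambda>a. a < 0) Q) = 0" for Q
      by (induction Q) auto
    then have V: "pos_sum V = 0" "\<And>a. a \<in># V \<Longrightarrow> a < 0"
      by (auto simp: V_def)
    have MV: "filter_mset (\<lambda>a. 0 < a) M \<in> \<Lambda>" "M = filter_mset (\<lambda>a. 0 < a) M + V"
    proof -
      have "\<Sum>\<^sub># (filter_mset (\<lambda>a. 0 < a) Q) = pos_sum Q" for Q by (induction Q) auto
      then show "filter_mset (\<lambda>a. 0 < a) M \<in> \<Lambda>" using less.prems(2) by (auto simp: \<Lambda>_def)
      show "M = filter_mset (\<lambda>a. 0 < a) M + V" using less.prems(1) unfolding V_def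
        by (intro multiset_eqI) (auto simp: not_in_iff linorder_neq_iff)
    qed
    have K: "norm (D (L + V)) \<le> K" if "L \<in> \<Lambda>" for L
      using that fin by (auto simp: K_def)
    \<comment> \<open>The n - 1 splittings have weight 1 each, and the fusions with the entries of
      L' have weights adding up to d - n.\<close>
    have bound: "of_nat N * norm (D (L + V)) \<le> (real d - 1) * K" if L: "L \<in> \<Lambda>" for L
    proof -
      have "L \<noteq> {#}" using L False by (auto simp: \<Lambda>_def)
      then obtain n where n: "n \<in># L" by blast
      then obtain L' where L': "L = add_mset n L'" by (metis insert_DiffM)
      have pos: "n > 0" "\<forall>a\<in>#L'. 0 < a" "n + \<Sum>\<^sub># L' = int d"
        using L by (auto simp: \<Lambda>_def L')
      \<comment> \<open>Fusing n with a negative entry strictly lowers the positive sum.\<close>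
      have vanish: "D (add_mset (n + a) (L' + V - {#a#})) = 0" if a: "a \<in># V" for a
      proof -
        obtain V' where V': "V = add_mset a V'" using a by (metis insert_DiffM)
        have "a < 0" "pos_sum V' = 0" using V(1) V(2)[OF a] by (auto simp: V')
        then show ?thesis using pos by (intro IH) (auto simp: V' pos_L)
      qed
      have split: "(\<Sum>a\<in>#L' + V. of_int a * D (add_mset (n + a) (L' + V - {#a#})))
         = (\<Sum>a\<in>#L'. of_int a * D (add_mset (n + a) (L' - {#a#} + V)))"
      proof -
        have "(\<Sum>a\<in>#V. of_int a * D (add_mset (n + a) (L' + V - {#a#}))) = 0"
          using vanish by (intro sum_mset.neutral) auto
        moreover have "(\<Sum>a\<in>#L'. of_int a * D (add_mset (n + a) (L' + V - {#a#})))
           = (\<Sum>a\<in>#L'. of_int a * D (add_mset (n + a) (L' - {#a#} + V)))"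
          by (intro arg_cong[of _ _ sum_mset] image_mset_cong) simp
        ultimately show ?thesis by simp
      qed
      have LV: "L + V = add_mset n (L' + V)" by (simp add: L')
      have nz: "0 \<notin># L' + V" using pos(2) V(2) by force
      have "of_nat N * D (L + V) = - ((\<Sum>k=1..n-1. D (add_mset k (add_mset (n - k) (L' + V))))
         + (\<Sum>a\<in>#L'. of_int a * D (add_mset (n + a) (L' - {#a#} + V))))"
        using loop[OF pos(1) nz] unfolding split LV by (simp only: eq_neg_iff_add_eq_0 add.assoc)
      then have "norm (of_nat N * D (L + V)) = norm (- ((\<Sum>k=1..n-1. D (add_mset k (add_mset (n - k) (L' + V))))
         + (\<Sum>a\<in>#L'. of_int a * D (add_mset (n + a) (L' - {#a#} + V)))))"
        by (rule arg_cong)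
      then have "real N * norm (D (L + V)) = norm ((\<Sum>k=1..n-1. D (add_mset k (add_mset (n - k) (L' + V))))
         + (\<Sum>a\<in>#L'. of_int a * D (add_mset (n + a) (L' - {#a#} + V))))"
        by (simp only: norm_minus_cancel norm_mult norm_of_nat)
      also have "\<dots> \<le> norm (\<Sum>k=1..n-1. D (add_mset k (add_mset (n - k) (L' + V))))
         + norm (\<Sum>a\<in>#L'. of_int a * D (add_mset (n + a) (L' - {#a#} + V)))"
        by (rule norm_triangle_ineq)
      also have "norm (\<Sum>k=1..n-1. D (add_mset k (add_mset (n - k) (L' + V)))) \<le> (\<Sum>k=1..n-1. K)"
      proof (rule sum_norm_le)
        fix k assume "k \<in> {1..n-1}"
        then have "add_mset k (add_mset (n - k) L') \<in> \<Lambda>" using pos by (auto simp: \<Lambda>_def)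
        from K[OF this] show "norm (D (add_mset k (add_mset (n - k) (L' + V)))) \<le> K" by simp
      qed
      also have "norm (\<Sum>a\<in>#L'. of_int a * D (add_mset (n + a) (L' - {#a#} + V)))
         \<le> (\<Sum>a\<in>#L'. of_int a * K)"
      proof -
        have "norm (of_int a * D (add_mset (n + a) (L' - {#a#} + V))) \<le> of_int a * K" if a: "a \<in># L'" for a
        proof -
          obtain L'' where L'': "L' = add_mset a L''" using a by (metis insert_DiffM)
          have "add_mset (n + a) L'' \<in> \<Lambda>" using pos by (auto simp: \<Lambda>_def L'')
          from K[OF this] show ?thesis using pos(2) a by (auto simp: norm_mult L'' intro!: mult_mono)
        qed
        \<comment> \<open>Only the range of summation shrinks in this induction; the summand keeps
          the full multiset L'.\<close>
        then have "norm (\<Sum>a\<in>#Q. of_int a * D (add_mset (n + a) (L' - {#a#} + V))) \<le> (\<Sum>a\<in>#Q. of_int a * K)"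
          if "Q \<subseteq># L'" for Q
          using that
        proof (induction Q)
          case (add b Q)
          then have "b \<in># L'" "Q \<subseteq># L'"
            by (auto dest: mset_subset_eqD subset_mset.order_trans[OF mset_subset_eq_add_right[of Q "{#b#}"]]
                simp: mset_subset_eq_insertD subset_mset.less_imp_le)
          with add show ?case by (auto intro!: norm_triangle_le add_mono)
        qed simp
        from this[of L'] show ?thesis by simp
      qed
      also have "(\<Sum>k=1..n-1. K) = (of_int n - 1) * K" using pos by simp
      also have "(\<Sum>a\<in>#L'. of_int a * K) = of_int (\<Sum>\<^sub># L') * K"
        by (induction L') (auto simp: algebra_simps)
      also have "(of_int n - 1) * K + of_int (\<Sum>\<^sub># L') * K = (of_int (n + \<Sum>\<^sub># L') - 1) * K"
        by (simp add: algebra_simps)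
      finally show ?thesis by (simp add: pos(3))
    qed
    obtain L where L: "L \<in> \<Lambda>" "K = norm (D (L + V))"
    proof -
      have "K \<in> (\<lambda>L. norm (D (L + V))) ` \<Lambda>"
        unfolding K_def using fin MV(1) by (intro Max_in) auto
      then show ?thesis using that by auto
    qed
    \<comment> \<open>Combined with N * K <= (d - 1) * K this forces K <= 0. Here d <= N
      enters.\<close>
    have "real d * K \<le> real N * K" using less.prems(4) L(2) by (intro mult_right_mono) auto
    then have "K \<le> 0" using bound[OF L(1), folded L(2)] left_diff_distrib[of "real d" 1 K] by linarith
    then have "norm (D M) = 0" using K[OF MV(1), folded MV(2)] norm_ge_zero[of "D M"] by linarith
    then show ?thesis by simp
  qed
qed

lemma sum_mset_subtract:
  fixes f g :: "'a \<Rightarrow> 'b :: ab_group_add"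
  shows "(\<Sum>a\<in>#M. f a - g a) = (\<Sum>a\<in>#M. f a) - (\<Sum>a\<in>#M. g a)"
  by (induction M) auto

text \<open>\<open>zero_ext\<close> solves the loop equations for indices of any size, so the
  difference D solves the homogeneous problem; the bound 2N is needed for uniqueness alone.\<close>

theorem loop_equation_unique:
  fixes x :: "int multiset \<Rightarrow> complex"
  assumes zero: "\<And>M. x (add_mset 0 M) = of_nat N * x M"
    and empty: "x {#} = 1"
    and unbal: "\<And>M. \<Sum>\<^sub># M \<noteq> 0 \<Longrightarrow> x M = 0"
    and loop: "\<And>n M. n > 0 \<Longrightarrow> 0 \<notin># M \<Longrightarrow> of_nat N * x (add_mset n M)
       + (\<Sum>k=1..n-1. x (add_mset k (add_mset (n - k) M)))
       + (\<Sum>a\<in>#M. of_int a * x (add_mset (n + a) (M - {#a#}))) = 0"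
    and M: "0 \<notin># M" "(\<Sum>a\<in>#M. \<bar>a\<bar>) \<le> 2 * int N"
  shows "x M = paired_moment M"
proof (cases "\<Sum>\<^sub># M = 0")
  case False
  then show ?thesis by (simp add: unbal paired_moment_unbalanced)
next
  case True
  define D where "D M = x M - zero_ext N M" for M
  have zeroD: "D (add_mset 0 M) = of_nat N * D M" for M
    by (simp add: D_def zero zero_ext_add_0 algebra_simps)
  have loopD: "of_nat N * D (add_mset n M)
       + (\<Sum>k=1..n-1. D (add_mset k (add_mset (n - k) M)))
       + (\<Sum>a\<in>#M. of_int a * D (add_mset (n + a) (M - {#a#}))) = 0" if n: "n > 0" and M: "0 \<notin># M" for n M
  proof -
    have "(\<Sum>a\<in>#M. of_int a * zero_ext N (add_mset (n + a) (M - {#a#})))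
      = (\<Sum>a\<in>#M. (if a = - n then - of_int n * (of_nat N * paired_moment (M - {#- n#})) else 0)
         + of_int a * (if a = - n then 0 else paired_moment (add_mset (n + a) (M - {#a#}))))"
      using M by (intro arg_cong[of _ _ sum_mset] image_mset_cong)
        (auto simp: zero_ext_add_0 dest: in_diffD intro!: zero_ext_nonzero)
    \<comment> \<open>By Wick's rule the terms with a = -n, which carry the factor N of an index 0,
      add up to minus the leading term of the equation.\<close>
    also have "\<dots> = - of_nat N * paired_moment (add_mset n M)
       + (\<Sum>a\<in>#M. of_int a * (if a = - n then 0 else paired_moment (add_mset (n + a) (M - {#a#}))))"
      using n by (simp add: sum_mset.distrib sum_mset_delta paired_moment_add)
    finally have *: "(\<Sum>a\<in>#M. of_int a * zero_ext N (add_mset (n + a) (M - {#a#})))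
      = - of_nat N * paired_moment (add_mset n M)
       + (\<Sum>a\<in>#M. of_int a * (if a = - n then 0 else paired_moment (add_mset (n + a) (M - {#a#}))))" .
    have "of_nat N * zero_ext N (add_mset n M)
       + (\<Sum>k=1..n-1. zero_ext N (add_mset k (add_mset (n - k) M)))
       + (\<Sum>a\<in>#M. of_int a * zero_ext N (add_mset (n + a) (M - {#a#}))) = 0"
      unfolding * using paired_moment_loop_sum[OF n M] n M by (simp add: zero_ext_nonzero)
    moreover have "of_nat N * D (add_mset n M)
       + (\<Sum>k=1..n-1. D (add_mset k (add_mset (n - k) M)))
       + (\<Sum>a\<in>#M. of_int a * D (add_mset (n + a) (M - {#a#})))
     = (of_nat N * x (add_mset n M)
       + (\<Sum>k=1..n-1. x (add_mset k (add_mset (n - k) M)))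
       + (\<Sum>a\<in>#M. of_int a * x (add_mset (n + a) (M - {#a#}))))
      - (of_nat N * zero_ext N (add_mset n M)
       + (\<Sum>k=1..n-1. zero_ext N (add_mset k (add_mset (n - k) M)))
       + (\<Sum>a\<in>#M. of_int a * zero_ext N (add_mset (n + a) (M - {#a#}))))"
      unfolding D_def right_diff_distrib sum_subtractf sum_mset_subtract by (simp only: diff_diff_eq diff_add_eq add_diff_eq add_ac)
    ultimately show ?thesis using loop[OF n M] by simp
  qed
  have "D M = 0"
  proof (rule loop_equation_homogeneous_unique[where N = N and d = "nat (pos_sum M)"])
    show "D {#} = 0" by (simp add: D_def empty zero_ext_def paired_moment_def)
    show "D M = 0" if "\<Sum>\<^sub># M \<noteq> 0" for M
      using that by (simp add: D_def unbal zero_ext_def paired_moment_unbalanced)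
    show "pos_sum M = int (nat (pos_sum M))" "neg_sum M = int (nat (pos_sum M))" "nat (pos_sum M) \<le> N"
      using pos_sum_nonneg[of M] M(2) True sum_mset_eq_pos_neg[of M] sum_abs_mset_eq_pos_neg[of M]
      by linarith+
  qed (fact zeroD loopD M(1))+
  then show ?thesis using M(1) by (simp add: D_def zero_ext_nonzero)
qed

text \<open>
  The moment of \<open>(\<Sum>k\<in>I. a k * p k) ^ j\<close> times the monomial \<open>Q\<close>, expanded by linearity from the moments \<open>x\<close>
  of monomials.
\<close>
fun iterated_moment :: "(int multiset \<Rightarrow> complex) \<Rightarrow> int set \<Rightarrow> (int \<Rightarrow> complex) \<Rightarrow> nat \<Rightarrow> int multiset \<Rightarrow> complex" where
  "iterated_moment x I a 0 Q = x Q"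
| "iterated_moment x I a (Suc j) Q = (\<Sum>k\<in>I. a k * iterated_moment x I a j (add_mset k Q))"

text \<open>Expanding j factors raises the sum of absolute values by at most j * B, so only
  monomials inside the range of agreement are ever evaluated.\<close>

lemma iterated_moment_cong:
  assumes "\<And>M. 0 \<notin># M \<Longrightarrow> (\<Sum>b\<in>#M. \<bar>b\<bar>) \<le> R \<Longrightarrow> x M = y M"
    and "\<And>k. k \<in> I \<Longrightarrow> k \<noteq> 0 \<and> \<bar>k\<bar> \<le> B"
  shows "0 \<notin># Q \<Longrightarrow> (\<Sum>b\<in>#Q. \<bar>b\<bar>) + int j * B \<le> R \<Longrightarrow>
    iterated_moment x I a j Q = iterated_moment y I a j Q"
proof (induction j arbitrary: Q)
  case 0
  then show ?case using assms(1) by simp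
next
  case (Suc j)
  have "iterated_moment x I a j (add_mset k Q) = iterated_moment y I a j (add_mset k Q)" if "k \<in> I" for k
    using assms(2)[OF that] Suc.prems by (intro Suc.IH) (auto simp: algebra_simps)
  then show ?case by simp
qed

text \<open>Integration by parts for the j-th power of the linear form times Q: the derivative in p
  (-n) hits either Q or one of the j equal factors, each of which contributes the coefficient a
  (-n).\<close>

lemma iterated_paired_moment_add:
  assumes I: "finite I" "\<And>k. k \<in> I \<Longrightarrow> - k \<in> I" and n: "n \<in> I" "n \<noteq> 0"
    and L_def: "L = iterated_moment paired_moment I a"
  shows "L j (add_mset n Q) = of_int \<bar>n\<bar> * of_nat (count Q (- n)) * L j (Q - {#- n#})
    + of_nat j * of_int \<bar>n\<bar> * a (- n) * L (j - 1) Q"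
proof (induction j arbitrary: Q)
  case 0
  show ?case using n by (simp add: L_def paired_moment_add)
next
  case (Suc j)
  have step: "L (Suc j) Q = (\<Sum>k\<in>I. a k * L j (add_mset k Q))" for j Q by (simp add: L_def)
  have *: "of_nat (count (add_mset k Q) (- n)) * L j (add_mset k Q - {#- n#})
     = of_nat (count Q (- n)) * L j (add_mset k (Q - {#- n#})) + (if k = - n then L j Q else 0)" for k
  proof (cases "- n \<in># Q")
    case True
    then obtain Q' where "Q = add_mset (- n) Q'" by (metis insert_DiffM)
    then show ?thesis by (auto simp: algebra_simps add_mset_commute)
  next
    case False
    then show ?thesis by (auto simp: not_in_iff)
  qed
  have "L (Suc j) (add_mset n Q) = (\<Sum>k\<in>I. a k * L j (add_mset n (add_mset k Q)))"
    by (simp add: step add_mset_commute)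
  also have "\<dots> = (\<Sum>k\<in>I. of_int \<bar>n\<bar> * of_nat (count Q (- n)) * (a k * L j (add_mset k (Q - {#- n#})))
     + (if k = - n then of_int \<bar>n\<bar> * a k * L j Q else 0)
     + of_nat j * of_int \<bar>n\<bar> * a (- n) * (a k * L (j - 1) (add_mset k Q)))"
  proof (intro sum.cong refl)
    fix k
    have "a k * L j (add_mset n (add_mset k Q)) = of_int \<bar>n\<bar> * a k *
      (of_nat (count (add_mset k Q) (- n)) * L j (add_mset k Q - {#- n#}))
      + of_nat j * of_int \<bar>n\<bar> * a (- n) * (a k * L (j - 1) (add_mset k Q))"
      unfolding Suc.IH[of "add_mset k Q"] by (simp only: algebra_simps)
    then show "a k * L j (add_mset n (add_mset k Q))
      = of_int \<bar>n\<bar> * of_nat (count Q (- n)) * (a k * L j (add_mset k (Q - {#- n#})))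
     + (if k = - n then of_int \<bar>n\<bar> * a k * L j Q else 0)
     + of_nat j * of_int \<bar>n\<bar> * a (- n) * (a k * L (j - 1) (add_mset k Q))"
      unfolding * by (cases "k = - n") (simp_all add: algebra_simps)
  qed
  also have "\<dots> = of_int \<bar>n\<bar> * of_nat (count Q (- n)) * L (Suc j) (Q - {#- n#})
     + of_int \<bar>n\<bar> * a (- n) * L j Q
     + of_nat j * of_int \<bar>n\<bar> * a (- n) * (\<Sum>k\<in>I. a k * L (j - 1) (add_mset k Q))"
    using I n by (simp add: sum.distrib step sum_distrib_left)
  \<comment> \<open>At j = 0 the truncated difference j - 1 does no harm, because the factor j
    vanishes.\<close>
  also have "of_nat j * of_int \<bar>n\<bar> * a (- n) * (\<Sum>k\<in>I. a k * L (j - 1) (add_mset k Q))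
     = of_nat j * of_int \<bar>n\<bar> * a (- n) * L j Q"
    by (cases j) (simp_all add: step)
  finally show ?case by (simp add: algebra_simps)
qed

text \<open>The moment recursion of a centred Gaussian, E X^(j+1) = j * s * E X^(j-1), whose
  variance s is the sum of |k| * a k * a (-k).\<close>

lemma iterated_paired_moment_step:
  assumes "finite I" "\<And>k. k \<in> I \<Longrightarrow> k \<noteq> 0 \<and> - k \<in> I"
  shows "iterated_moment paired_moment I a (Suc j) {#}
    = of_nat j * (\<Sum>k\<in>I. of_int \<bar>k\<bar> * a k * a (- k)) * iterated_moment paired_moment I a (j - 1) {#}"
  using assms
  by (simp add: iterated_paired_moment_add sum_distrib_left sum_distrib_right mult_ac)

lemma iterated_paired_moment_gaussian:
  assumes "finite I" "\<And>k. k \<in> I \<Longrightarrow> k \<noteq> 0 \<and> - k \<in> I"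
  shows "iterated_moment paired_moment I a (2 * k) {#}
      = fact (2 * k) / (2 ^ k * fact k) * (\<Sum>k\<in>I. of_int \<bar>k\<bar> * a k * a (- k)) ^ k"
    and "iterated_moment paired_moment I a (2 * k + 1) {#} = 0"
proof -
  note step = iterated_paired_moment_step[OF assms, of a]
  show "iterated_moment paired_moment I a (2 * k) {#}
      = fact (2 * k) / (2 ^ k * fact k) * (\<Sum>k\<in>I. of_int \<bar>k\<bar> * a k * a (- k)) ^ k"
  proof (induction k)
    case 0
    then show ?case by (simp add: paired_moment_def)
  next
    case (Suc k)
    have "fact (2 * Suc k) / (2 ^ Suc k * fact (Suc k))
       = of_nat (2 * k + 1) * (fact (2 * k) / (2 ^ k * fact k) :: complex)"
    proof -
      have "2 + complex_of_nat k * 2 = of_nat (2 * Suc k)" by simp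
      also have "\<dots> \<noteq> 0" by (simp only: of_nat_eq_0_iff) simp
      finally show ?thesis by (simp add: divide_simps) (simp add: algebra_simps)
    qed
    then show ?case using Suc.IH step[of "2 * k + 1"] by (simp del: iterated_moment.simps add: mult_ac)
  qed
  show "iterated_moment paired_moment I a (2 * k + 1) {#} = 0"
    by (induction k) (use step[of 0] step[of "2 * (Suc _)"] in \<open>simp_all del: iterated_moment.simps\<close>)
qed

section \<open>Power traces of unitary matrices\<close>

lemma mat_adjoint_carrier: "U \<in> carrier_mat N N \<Longrightarrow> mat_adjoint U \<in> carrier_mat N N"
  by (auto simp: mat_adjoint_def)

lemma mat_adjoint_index:
  fixes U :: "complex mat"
  assumes "U \<in> carrier_mat N N" "i < N" "j < N"
  shows "mat_adjoint U $$ (i, j) = cnj (U $$ (j, i))"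
  using assms by (auto simp: mat_adjoint_def mat_of_rows_def)

lemma mat_mult_index:
  assumes "A \<in> carrier_mat N N" "B \<in> carrier_mat N N" "i < N" "j < N"
  shows "(A * B) $$ (i, j) = (\<Sum>k<N. A $$ (i, k) * B $$ (k, j))"
  using assms by (auto simp: scalar_prod_def atLeast0LessThan)

lemma mat_adjoint_mult:
  fixes A B :: "complex mat"
  assumes "A \<in> carrier_mat N N" "B \<in> carrier_mat N N"
  shows "mat_adjoint (A * B) = mat_adjoint B * mat_adjoint A"
  using assms mat_adjoint_carrier[of A N] mat_adjoint_carrier[of B N] mat_adjoint_carrier[of "A * B" N]
  by (intro eq_matI)
    (auto simp: mat_adjoint_index[where N = N] mat_mult_index[where N = N] mult.commute simp del: index_mult_mat(1))

lemma unitary_group_carrier: "U \<in> unitary_group N \<Longrightarrow> U \<in> carrier_mat N N"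
  by (simp add: unitary_group_def)

lemma unitary_left_inverse: "U \<in> unitary_group N \<Longrightarrow> mat_adjoint U * U = 1\<^sub>m N"
  by (simp add: unitary_group_def)

lemma unitary_right_inverse: "U \<in> unitary_group N \<Longrightarrow> U * mat_adjoint U = 1\<^sub>m N"
  using mat_mult_left_right_inverse[of "mat_adjoint U" N U] mat_adjoint_carrier[of U N]
  by (auto simp: unitary_group_def)

lemma unitary_mult:
  assumes "U \<in> unitary_group N" "V \<in> unitary_group N"
  shows "U * V \<in> unitary_group N"
proof -
  have c: "U \<in> carrier_mat N N" "V \<in> carrier_mat N N" using assms by (auto dest: unitary_group_carrier)
  note ca = mat_adjoint_carrier[OF c(1)] mat_adjoint_carrier[OF c(2)]
  have "mat_adjoint (U * V) * (U * V) = mat_adjoint V * (mat_adjoint U * (U * V))"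
    using c ca by (simp add: mat_adjoint_mult[OF c] assoc_mult_mat[where n\<^sub>1 = N and n\<^sub>2 = N and n\<^sub>3 = N and n\<^sub>4 = N])
  also have "mat_adjoint U * (U * V) = (mat_adjoint U * U) * V"
    using c ca by (simp add: assoc_mult_mat[where n\<^sub>1 = N and n\<^sub>2 = N and n\<^sub>3 = N and n\<^sub>4 = N])
  finally show ?thesis using c assms by (simp add: unitary_group_def)
qed

lemma unitary_one: "1\<^sub>m N \<in> unitary_group N"
proof -
  have "mat_adjoint (1\<^sub>m N) = (1\<^sub>m N :: complex mat)"
    using mat_adjoint_carrier[of "1\<^sub>m N" N] by (intro eq_matI) (auto simp: mat_adjoint_index[where N = N])
  then show ?thesis by (simp add: unitary_group_def)
qed

lemma unitary_pow: "U \<in> unitary_group N \<Longrightarrow> U ^\<^sub>m k \<in> unitary_group N"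
proof (induction k)
  case 0
  then show ?case using unitary_one[of N] by (simp add: unitary_group_carrier[THEN carrier_matD(1)])
qed (simp add: unitary_mult)

lemma pow_mat_add:
  assumes "U \<in> carrier_mat N N"
  shows "U ^\<^sub>m (j + k) = U ^\<^sub>m j * U ^\<^sub>m k"
proof (induction k)
  case 0
  then show ?case using assms by simp
next
  case (Suc k)
  then show ?case using assms
    by (simp add: assoc_mult_mat[where n\<^sub>1 = N and n\<^sub>2 = N and n\<^sub>3 = N and n\<^sub>4 = N])
qed

text \<open>The columns are unit vectors. This bound underlies integrability and the uniformity in U
  of all expansions below.\<close>

lemma unitary_entry_bound:
  assumes U: "U \<in> unitary_group N" and i: "i < N" and j: "j < N"
  shows "norm (U $$ (i, j)) \<le> 1"
proof -
  note c = unitary_group_carrier[OF U]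
  have "(mat_adjoint U * U) $$ (j, j) = (\<Sum>k<N. cnj (U $$ (k, j)) * U $$ (k, j))"
    using c j mat_adjoint_carrier[OF c] by (subst mat_mult_index[where N = N]) (auto simp: mat_adjoint_index)
  then have "complex_of_real (\<Sum>k<N. (norm (U $$ (k, j)))\<^sup>2) = 1"
    using unitary_left_inverse[OF U] j by (simp add: complex_norm_square mult.commute del: of_real_power)
  then have "(\<Sum>k<N. (norm (U $$ (k, j)))\<^sup>2) = 1" by (metis of_real_eq_1_iff)
  moreover have "(norm (U $$ (i, j)))\<^sup>2 \<le> (\<Sum>k<N. (norm (U $$ (k, j)))\<^sup>2)"
    using i by (intro member_le_sum) auto
  ultimately show ?thesis by (simp add: power_le_one_iff abs_square_le_1)
qed

text \<open>For unitary U this is the (i, j) entry of the integer power U^m, because the inverse of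
  U is its adjoint. Written this way it is visibly a function of the entries of U.\<close>

definition unitary_power_entry :: "complex mat \<Rightarrow> int \<Rightarrow> nat \<Rightarrow> nat \<Rightarrow> complex" where
  "unitary_power_entry U m i j = (if 0 \<le> m then (U ^\<^sub>m nat m) $$ (i, j) else cnj ((U ^\<^sub>m nat (- m)) $$ (j, i)))"

definition power_trace :: "nat \<Rightarrow> int \<Rightarrow> complex mat \<Rightarrow> complex" where
  "power_trace N m U = (\<Sum>i<N. unitary_power_entry U m i i)"

lemma unitary_power_entry_adjoint:
  assumes U: "U \<in> unitary_group N" and "i < N" "j < N" "m \<le> 0"
  shows "unitary_power_entry U m i j = mat_adjoint (U ^\<^sub>m nat (- m)) $$ (i, j)"
proof (cases "m = 0")
  case True
  have "mat_adjoint (1\<^sub>m N) $$ (i, j) = cnj ((1\<^sub>m N) $$ (j, i))"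
    using assms by (intro mat_adjoint_index) auto
  then show ?thesis using assms True unitary_group_carrier[OF U]
    by (auto simp: unitary_power_entry_def)
next
  case False
  then show ?thesis
    using assms pow_carrier_mat[OF unitary_group_carrier[OF U]]
    by (simp add: unitary_power_entry_def mat_adjoint_index[where N = N])
qed

text \<open>The law U^n * U^m = U^(n+m). The case n >= 0 suffices, since the loop equation always
  has a genuine positive power on the left.\<close>

lemma sum_unitary_power_entry:
  assumes U: "U \<in> unitary_group N" and i: "i < N" and j: "j < N" and n: "0 \<le> n"
  shows "(\<Sum>k<N. unitary_power_entry U n i k * unitary_power_entry U m k j) = unitary_power_entry U (n + m) i j"
proof -
  note c = pow_carrier_mat[OF unitary_group_carrier[OF U]]
  note ca = mat_adjoint_carrier[OF c]
  note assoc = assoc_mult_mat[where n\<^sub>1 = N and n\<^sub>2 = N and n\<^sub>3 = N and n\<^sub>4 = N]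
  show ?thesis
  proof (cases "0 \<le> m")
    case True
    have "(\<Sum>k<N. unitary_power_entry U n i k * unitary_power_entry U m k j)
       = (U ^\<^sub>m nat n * U ^\<^sub>m nat m) $$ (i, j)"
      using True n i j c by (subst mat_mult_index[where N = N]) (auto simp: unitary_power_entry_def)
    also have "U ^\<^sub>m nat n * U ^\<^sub>m nat m = U ^\<^sub>m nat (n + m)"
      using True n by (simp add: nat_add_distrib pow_mat_add[OF unitary_group_carrier[OF U]])
    finally show ?thesis using True n by (simp add: unitary_power_entry_def)
  next
    case False
    have eq: "(\<Sum>k<N. unitary_power_entry U n i k * unitary_power_entry U m k j)
       = (U ^\<^sub>m nat n * mat_adjoint (U ^\<^sub>m nat (- m))) $$ (i, j)"
      using False n i j c ca unitary_power_entry_adjoint[OF U _ j, of _ m]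
      by (subst mat_mult_index[where N = N]) (auto simp: unitary_power_entry_def intro!: sum.cong)
    show ?thesis
    proof (cases "0 \<le> n + m")
      case True
      \<comment> \<open>The longer power is split so that the shorter one cancels against its
        adjoint.\<close>
      have "nat n = nat (n + m) + nat (- m)" using True False n by simp
      then have "U ^\<^sub>m nat n * mat_adjoint (U ^\<^sub>m nat (- m))
         = U ^\<^sub>m nat (n + m) * (U ^\<^sub>m nat (- m) * mat_adjoint (U ^\<^sub>m nat (- m)))"
        using pow_mat_add[OF unitary_group_carrier[OF U], of "nat (n + m)" "nat (- m)"] c ca by (simp add: assoc)
      also have "\<dots> = U ^\<^sub>m nat (n + m)"
        using unitary_right_inverse[OF unitary_pow[OF U]] right_mult_one_mat[OF c] by simp
      finally show ?thesis unfolding eq using True by (simp add: unitary_power_entry_def)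
    next
      case neg: False
      have "nat (- m) = nat (- (n + m)) + nat n" using neg False n by simp
      then have "U ^\<^sub>m nat n * mat_adjoint (U ^\<^sub>m nat (- m))
         = (U ^\<^sub>m nat n * mat_adjoint (U ^\<^sub>m nat n)) * mat_adjoint (U ^\<^sub>m nat (- (n + m)))"
        using pow_mat_add[OF unitary_group_carrier[OF U], of "nat (- (n + m))" "nat n"] c ca
        by (simp add: assoc mat_adjoint_mult[where N = N])
      also have "\<dots> = mat_adjoint (U ^\<^sub>m nat (- (n + m)))"
        using unitary_right_inverse[OF unitary_pow[OF U]] left_mult_one_mat[OF ca] by simp
      finally show ?thesis using neg unitary_power_entry_adjoint[OF U i j, of "n + m"] by (simp add: eq)
    qed
  qed
qed

lemma unitary_power_entry_bound:
  assumes "U \<in> unitary_group N" "i < N" "j < N"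
  shows "norm (unitary_power_entry U m i j) \<le> 1"
  using unitary_entry_bound[OF unitary_pow[OF assms(1)]] assms by (simp add: unitary_power_entry_def)

lemma power_trace_bound:
  assumes "U \<in> unitary_group N"
  shows "norm (power_trace N m U) \<le> real N"
proof -
  have "norm (power_trace N m U) \<le> (\<Sum>i<N. 1)" unfolding power_trace_def
    using unitary_power_entry_bound[OF assms] by (intro sum_norm_le) auto
  then show ?thesis by simp
qed

lemma power_trace_0: "U \<in> unitary_group N \<Longrightarrow> power_trace N 0 U = of_nat N"
  using unitary_group_carrier[of U N] by (simp add: power_trace_def unitary_power_entry_def)

lemma power_trace_uminus: "m \<noteq> 0 \<Longrightarrow> power_trace N (- m) U = cnj (power_trace N m U)"
  by (cases "m > 0") (auto simp: power_trace_def unitary_power_entry_def)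

section \<open>Measurability of the traces and invariance of the integral\<close>

lemma sets_unitary_borel_space: "space (unitary_borel N) = unitary_group N"
  by (simp add: unitary_borel_def)

lemma measurable_entry:
  assumes "i < N" "j < N"
  shows "(\<lambda>U. U $$ (i, j)) \<in> borel_measurable (unitary_borel N)"
proof -
  have "(\<lambda>U. \<lambda>ij\<in>{..<N} \<times> {..<N}. U $$ ij) \<in> measurable (unitary_borel N)
      (\<Pi>\<^sub>M ij\<in>{..<N} \<times> {..<N}. (borel :: complex measure))"
    unfolding unitary_borel_def by (rule measurable_vimage_algebra1) (auto simp: space_PiM)
  from measurable_compose[OF this measurable_component_singleton[of "(i, j)"]]
  show ?thesis using assms by simp
qed

lemma measurable_pow_entry:
  assumes "i < N" "j < N"
  shows "(\<lambda>U. (U ^\<^sub>m k) $$ (i, j)) \<in> borel_measurable (unitary_borel N)"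
  using assms
proof (induction k arbitrary: i j)
  case 0
  have "(\<lambda>U. (U ^\<^sub>m 0) $$ (i, j)) \<in> borel_measurable (unitary_borel N)
    \<longleftrightarrow> (\<lambda>U. if i = j then 1 else 0 :: complex) \<in> borel_measurable (unitary_borel N)"
    using 0 by (intro measurable_cong) (auto simp: sets_unitary_borel_space dest!: unitary_group_carrier)
  then show ?case by simp
next
  case (Suc k)
  have "(\<lambda>U. (U ^\<^sub>m Suc k) $$ (i, j)) \<in> borel_measurable (unitary_borel N)
    \<longleftrightarrow> (\<lambda>U. \<Sum>l<N. (U ^\<^sub>m k) $$ (i, l) * U $$ (l, j)) \<in> borel_measurable (unitary_borel N)"
  proof (intro measurable_cong)
    fix U assume "U \<in> space (unitary_borel N)"
    then have "U \<in> carrier_mat N N" by (simp add: sets_unitary_borel_space unitary_group_carrier)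
    then show "(U ^\<^sub>m Suc k) $$ (i, j) = (\<Sum>l<N. (U ^\<^sub>m k) $$ (i, l) * U $$ (l, j))"
      unfolding pow_mat.simps using Suc.prems by (intro mat_mult_index) auto
  qed
  moreover have "(\<lambda>U. \<Sum>l<N. (U ^\<^sub>m k) $$ (i, l) * U $$ (l, j)) \<in> borel_measurable (unitary_borel N)"
    using Suc by (intro borel_measurable_sum borel_measurable_times measurable_entry) auto
  ultimately show ?case by simp
qed

lemma measurable_unitary_power_entry:
  assumes "i < N" "j < N"
  shows "(\<lambda>U. unitary_power_entry U m i j) \<in> borel_measurable (unitary_borel N)"
  unfolding unitary_power_entry_def using measurable_pow_entry[OF assms] measurable_pow_entry[OF assms(2,1)]
  by (cases "0 \<le> m") (auto intro!: borel_measurable_continuous_on[of cnj] continuous_intros)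

lemma measurable_power_trace: "power_trace N m \<in> borel_measurable (unitary_borel N)"
  unfolding power_trace_def by (intro borel_measurable_sum measurable_unitary_power_entry) auto

text \<open>The sigma-algebra is pulled back along the entry map, so it is enough that the entries
  of V * U are linear in those of U.\<close>

lemma measurable_left_mult:
  assumes V: "V \<in> unitary_group N"
  shows "(\<lambda>U. V * U) \<in> measurable (unitary_borel N) (unitary_borel N)"
proof -
  have "(\<lambda>U. \<lambda>ij\<in>{..<N} \<times> {..<N}. (V * U) $$ ij) \<in> measurable (unitary_borel N)
      (\<Pi>\<^sub>M ij\<in>{..<N} \<times> {..<N}. (borel :: complex measure))"
  proof (rule measurable_restrict)
    fix ij assume "ij \<in> {..<N} \<times> {..<N}"
    then obtain i j where ij: "ij = (i, j)" "i < N" "j < N" by auto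
    have "(\<lambda>U. (V * U) $$ (i, j)) \<in> borel_measurable (unitary_borel N)
      \<longleftrightarrow> (\<lambda>U. \<Sum>k<N. V $$ (i, k) * U $$ (k, j)) \<in> borel_measurable (unitary_borel N)"
      using V ij by (intro measurable_cong mat_mult_index)
        (auto simp: sets_unitary_borel_space unitary_group_carrier)
    then show "(\<lambda>U. (V * U) $$ ij) \<in> borel_measurable (unitary_borel N)"
      unfolding ij(1) using ij by (auto intro!: borel_measurable_sum borel_measurable_times measurable_entry)
  qed
  then show ?thesis
    using unitary_mult[OF V] unfolding unitary_borel_def[of N]
    by (intro measurable_vimage_algebra2) (auto simp: sets_unitary_borel_space[unfolded unitary_borel_def])
qed

text \<open>All uses of translation invariance go through this form.\<close>

lemma haar_integral_left_mult:
  fixes g :: "complex mat \<Rightarrow> complex"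
  assumes M: "haar_prob N M" and V: "V \<in> unitary_group N" and g: "g \<in> borel_measurable (unitary_borel N)"
  shows "(LINT U|M. g (V * U)) = (LINT U|M. g U)"
proof -
  have s: "sets M = sets (unitary_borel N)" and d: "distr M M (\<lambda>U. V * U) = M"
    using M V by (auto simp: haar_prob_def)
  have "(LINT U|distr M M (\<lambda>U. V * U). g U) = (LINT U|M. g (V * U))"
    using measurable_left_mult[OF V] g s
    by (intro integral_distr) (auto simp: measurable_cong_sets[OF s s] measurable_cong_sets[OF s refl])
  then show ?thesis by (simp add: d)
qed


definition trace_monomial :: "nat \<Rightarrow> int multiset \<Rightarrow> complex mat \<Rightarrow> complex" where
  "trace_monomial N M U = (\<Prod>m\<in>#M. power_trace N m U)"

lemma trace_monomial_empty [simp]: "trace_monomial N {#} U = 1"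
  and trace_monomial_add [simp]: "trace_monomial N (add_mset m M) U = power_trace N m U * trace_monomial N M U"
  by (simp_all add: trace_monomial_def)

lemma measurable_trace_monomial: "trace_monomial N M \<in> borel_measurable (unitary_borel N)"
proof (induction M)
  case empty
  have "trace_monomial N {#} = (\<lambda>U. 1)" by auto
  then show ?case by simp
next
  case (add m M)
  have "trace_monomial N (add_mset m M) = (\<lambda>U. power_trace N m U * trace_monomial N M U)" by auto
  then show ?case using add measurable_power_trace by simp
qed

section \<open>The loop equation for Haar measure\<close>

text \<open>
  A first order expansion in \<open>t\<close> that is uniform over \<open>S\<close>; it replaces differentiation under the integral sign.
\<close>
definition first_order ::
  "'a set \<Rightarrow> (real \<Rightarrow> 'a \<Rightarrow> complex) \<Rightarrow> ('a \<Rightarrow> complex) \<Rightarrow> ('a \<Rightarrow> complex) \<Rightarrow> bool" where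
  "first_order S h h0 d \<longleftrightarrow> (\<exists>C\<ge>0. \<forall>t\<in>{0..1}. \<forall>U\<in>S.
     norm (h t U - h0 U - of_real t * d U) \<le> C * t\<^sup>2 \<and> norm (h0 U) \<le> C \<and> norm (d U) \<le> C)"

lemma first_order_const: "first_order S (\<lambda>t U. c) (\<lambda>U. c) (\<lambda>U. 0)"
  unfolding first_order_def by (intro exI[of _ "norm c"]) auto

lemma first_order_add:
  assumes "first_order S h h0 d" "first_order S k k0 e"
  shows "first_order S (\<lambda>t U. h t U + k t U) (\<lambda>U. h0 U + k0 U) (\<lambda>U. d U + e U)"
proof -
  from assms obtain C C' where C: "C \<ge> 0" "C' \<ge> 0"
    "\<And>t U. t \<in> {0..1} \<Longrightarrow> U \<in> S \<Longrightarrow>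
      norm (h t U - h0 U - of_real t * d U) \<le> C * t\<^sup>2 \<and> norm (h0 U) \<le> C \<and> norm (d U) \<le> C"
    "\<And>t U. t \<in> {0..1} \<Longrightarrow> U \<in> S \<Longrightarrow>
      norm (k t U - k0 U - of_real t * e U) \<le> C' * t\<^sup>2 \<and> norm (k0 U) \<le> C' \<and> norm (e U) \<le> C'"
    unfolding first_order_def by metis
  show ?thesis unfolding first_order_def
  proof (intro exI[of _ "C + C'"] conjI ballI)
    fix t U assume tU: "t \<in> {0..1::real}" "U \<in> S"
    have "norm (h t U + k t U - (h0 U + k0 U) - of_real t * (d U + e U))
      = norm ((h t U - h0 U - of_real t * d U) + (k t U - k0 U - of_real t * e U))"
      by (simp add: algebra_simps)
    also have "\<dots> \<le> C * t\<^sup>2 + C' * t\<^sup>2"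
      using C(3,4)[OF tU] by (intro norm_triangle_mono) auto
    finally show "norm (h t U + k t U - (h0 U + k0 U) - of_real t * (d U + e U)) \<le> (C + C') * t\<^sup>2"
      by (simp add: algebra_simps)
    show "norm (h0 U + k0 U) \<le> C + C'" "norm (d U + e U) \<le> C + C'"
      using C(3,4)[OF tU] by (auto intro: norm_triangle_mono)
  qed (use C in auto)
qed

lemma first_order_mult:
  assumes "first_order S h h0 d" "first_order S k k0 e"
  shows "first_order S (\<lambda>t U. h t U * k t U) (\<lambda>U. h0 U * k0 U) (\<lambda>U. d U * k0 U + h0 U * e U)"
proof -
  from assms obtain C C' where C: "C \<ge> 0" "C' \<ge> 0"
    "\<And>t U. t \<in> {0..1} \<Longrightarrow> U \<in> S \<Longrightarrow>
      norm (h t U - h0 U - of_real t * d U) \<le> C * t\<^sup>2 \<and> norm (h0 U) \<le> C \<and> norm (d U) \<le> C"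
    "\<And>t U. t \<in> {0..1} \<Longrightarrow> U \<in> S \<Longrightarrow>
      norm (k t U - k0 U - of_real t * e U) \<le> C' * t\<^sup>2 \<and> norm (k0 U) \<le> C' \<and> norm (e U) \<le> C'"
    unfolding first_order_def by metis
  show ?thesis unfolding first_order_def
  \<comment> \<open>Of the nine products in (h0 + t d + r) (k0 + t e + s), three form the claimed
    expansion. Each of the other six is at most C * C' * t^2, because t <= 1.\<close>
  proof (intro exI[of _ "6 * (C * C')"] conjI ballI)
    fix t U assume tU: "t \<in> {0..1::real}" "U \<in> S"
    note B = C(3)[OF tU] C(4)[OF tU]
    define r s where "r = h t U - h0 U - of_real t * d U" and "s = k t U - k0 U - of_real t * e U"
    have t: "0 \<le> t" "t \<le> 1" using tU by auto
    have t2a: "t\<^sup>2 \<le> 1" using t by (simp add: power_le_one)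
    have t2b: "t * t\<^sup>2 \<le> 1 * t\<^sup>2" using t by (intro mult_right_mono) auto
    have t2c: "t\<^sup>2 * t\<^sup>2 \<le> 1 * t\<^sup>2" using t2a by (intro mult_right_mono) auto
    have p: "norm (a * b) \<le> C * C' * t\<^sup>2" if "norm a \<le> C * x" "norm b \<le> C' * y" "0 \<le> x" "0 \<le> y" "x * y \<le> t\<^sup>2" for a b :: complex and x y
    proof -
      have "norm (a * b) \<le> (C * x) * (C' * y)"
        unfolding norm_mult using that C by (intro mult_mono) auto
      also have "\<dots> = C * C' * (x * y)" by simp
      also have "\<dots> \<le> C * C' * t\<^sup>2" using that C by (intro mult_left_mono) auto
      finally show ?thesis .
    qed
    have e: "h t U * k t U - h0 U * k0 U - of_real t * (d U * k0 U + h0 U * e U)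
       = (h0 U * s + (of_real t * d U) * (of_real t * e U) + (of_real t * d U) * s)
         + (r * k0 U + r * (of_real t * e U) + r * s)"
      unfolding r_def s_def by (simp add: algebra_simps)
    have rs: "norm r \<le> C * t\<^sup>2" "norm s \<le> C' * t\<^sup>2" using B by (auto simp: r_def s_def)
    have td: "norm (of_real t * d U) \<le> C * t" "norm (of_real t * e U) \<le> C' * t"
      using B t by (auto simp: norm_mult mult.commute[of t] intro!: mult_right_mono)
    have parts: "norm (h0 U * s) \<le> C * C' * t\<^sup>2"
        "norm ((of_real t * d U) * (of_real t * e U)) \<le> C * C' * t\<^sup>2"
        "norm ((of_real t * d U) * s) \<le> C * C' * t\<^sup>2"
        "norm (r * k0 U) \<le> C * C' * t\<^sup>2"
        "norm (r * (of_real t * e U)) \<le> C * C' * t\<^sup>2"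
        "norm (r * s) \<le> C * C' * t\<^sup>2"
      using p[of "h0 U" 1 s "t\<^sup>2"] p[of "of_real t * d U" t "of_real t * e U" t]
        p[of "of_real t * d U" t s "t\<^sup>2"] p[of r "t\<^sup>2" "k0 U" 1]
        p[of r "t\<^sup>2" "of_real t * e U" t] p[of r "t\<^sup>2" s "t\<^sup>2"] B rs td t t2b t2c
      by (simp_all add: power2_eq_square mult.commute mult.left_commute)
    have "norm (h t U * k t U - h0 U * k0 U - of_real t * (d U * k0 U + h0 U * e U))
      \<le> (C * C' * t\<^sup>2 + C * C' * t\<^sup>2 + C * C' * t\<^sup>2) + (C * C' * t\<^sup>2 + C * C' * t\<^sup>2 + C * C' * t\<^sup>2)"
      unfolding e
      by (intro norm_triangle_mono parts)
    then show "norm (h t U * k t U - h0 U * k0 U - of_real t * (d U * k0 U + h0 U * e U)) \<le> 6 * (C * C') * t\<^sup>2"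
      by (simp add: mult_ac)
    have q: "norm (a * b) \<le> C * C'" if "norm a \<le> C" "norm b \<le> C'" for a b :: complex
      unfolding norm_mult using that C by (intro mult_mono) auto
    have "norm (h0 U * k0 U) \<le> C * C'" using B by (intro q) auto
    also have "\<dots> \<le> 6 * (C * C')" using C by simp
    finally show "norm (h0 U * k0 U) \<le> 6 * (C * C')" .
    have "norm (d U * k0 U + h0 U * e U) \<le> C * C' + C * C'"
      using B by (intro norm_triangle_mono q) auto
    also have "\<dots> \<le> 6 * (C * C')" using C by simp
    finally show "norm (d U * k0 U + h0 U * e U) \<le> 6 * (C * C')" .
  qed (use C in auto)
qed

lemma first_order_sum:
  assumes "\<And>i. i \<in> I \<Longrightarrow> first_order S (h i) (h0 i) (d i)"
  shows "first_order S (\<lambda>t U. \<Sum>i\<in>I. h i t U) (\<lambda>U. \<Sum>i\<in>I. h0 i U) (\<lambda>U. \<Sum>i\<in>I. d i U)"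
  using assms
proof (induction I rule: infinite_finite_induct)
  case (insert i I)
  then show ?case by (simp add: first_order_add)
qed (use first_order_const[of S 0] in simp_all)

lemma first_order_cnj:
  assumes "first_order S h h0 d"
  shows "first_order S (\<lambda>t U. cnj (h t U)) (\<lambda>U. cnj (h0 U)) (\<lambda>U. cnj (d U))"
proof -
  have "norm (cnj a - cnj b - of_real t * cnj c) = norm (a - b - of_real t * c)" for a b c :: complex and t :: real
    using complex_mod_cnj[of "a - b - of_real t * c"] by simp
  then show ?thesis using assms unfolding first_order_def by simp
qed

lemma first_order_cong:
  assumes "first_order S h h0 d" "\<And>t U. U \<in> S \<Longrightarrow> h t U = h' t U" "\<And>U. U \<in> S \<Longrightarrow> h0 U = h0' U"
    "\<And>U. U \<in> S \<Longrightarrow> d U = d' U"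
  shows "first_order S h' h0' d'"
  using assms unfolding first_order_def by (metis (no_types, lifting))

lemma norm_iexp_linear_remainder: "norm (exp (\<i> * of_real t) - 1 - \<i> * of_real t) \<le> t\<^sup>2"
proof -
  have "norm (exp (\<i> * of_real t) - 1 - \<i> * of_real t) \<le> \<bar>t\<bar>\<^sup>2 / 2"
    using iexp_approx1[of t 1] by (simp add: numeral_2_eq_2 diff_diff_eq)
  also have "\<dots> \<le> t\<^sup>2" by simp
  finally show ?thesis .
qed

text \<open>The one-parameter group \<open>t \<mapsto> 1 + (exp (i t) - 1) P\<close> generated by an orthogonal projection \<open>P\<close>.\<close>
definition projection_rotation :: "nat \<Rightarrow> (nat \<Rightarrow> nat \<Rightarrow> complex) \<Rightarrow> real \<Rightarrow> complex mat" where
  "projection_rotation N P t =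
     mat N N (\<lambda>(i, j). (if i = j then 1 else 0) + (exp (\<i> * of_real t) - 1) * P i j)"

definition orthogonal_projection :: "nat \<Rightarrow> (nat \<Rightarrow> nat \<Rightarrow> complex) \<Rightarrow> bool" where
  "orthogonal_projection N P \<longleftrightarrow> (\<forall>i<N. \<forall>j<N. cnj (P i j) = P j i)
     \<and> (\<forall>i<N. \<forall>j<N. (\<Sum>k<N. P i k * P k j) = P i j)"

lemma projection_rotation_carrier: "projection_rotation N P t \<in> carrier_mat N N"
  by (simp add: projection_rotation_def)

text \<open>With w = exp (i t) - 1 the product (1 + w P)^* (1 + w P) is 1 + (cnj w + w + cnj w * w)
  P, and the bracket is |1 + w|^2 - 1 = 0.\<close>

lemma projection_rotation_unitary:
  assumes "orthogonal_projection N P"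
  shows "projection_rotation N P t \<in> unitary_group N"
proof -
  let ?V = "projection_rotation N P t"
  define w where "w = exp (\<i> * complex_of_real t) - 1"
  have w: "cnj w + w + cnj w * w = 0"
  proof -
    have "cnj (exp (\<i> * complex_of_real t)) * exp (\<i> * complex_of_real t) = 1"
      by (simp add: exp_cnj flip: exp_add)
    then show ?thesis by (simp add: w_def algebra_simps)
  qed
  have "mat_adjoint ?V * ?V = 1\<^sub>m N"
  proof (rule eq_matI)
    fix i j assume "i < dim_row (1\<^sub>m N :: complex mat)" "j < dim_col (1\<^sub>m N :: complex mat)"
    then have ij: "i < N" "j < N" by auto
    have "(mat_adjoint ?V * ?V) $$ (i, j) = (\<Sum>k<N. cnj (?V $$ (k, i)) * ?V $$ (k, j))"
      using ij projection_rotation_carrier[of N P t] mat_adjoint_carrier[OF projection_rotation_carrier[of N P t]]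
      by (subst mat_mult_index[where N = N]) (auto simp: mat_adjoint_index[where N = N])
    also have "\<dots> = (\<Sum>k<N. (if k = i then (if i = j then 1 else 0) else 0) + (if k = j then cnj w * P i j else 0)
       + (if k = i then w * P i j else 0) + cnj w * w * (P i k * P k j))"
      using ij assms by (intro sum.cong) (auto simp: projection_rotation_def orthogonal_projection_def w_def[symmetric] algebra_simps)
    finally have exp: "(mat_adjoint ?V * ?V) $$ (i, j) = (\<Sum>k<N. (if k = i then (if i = j then 1 else 0) else 0) + (if k = j then cnj w * P i j else 0)
       + (if k = i then w * P i j else 0) + cnj w * w * (P i k * P k j))" .
    have sq: "(\<Sum>k<N. cnj w * w * (P i k * P k j)) = cnj w * w * P i j"
      using ij assms by (simp add: orthogonal_projection_def flip: sum_distrib_left)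
    have "(\<Sum>k<N. (if k = i then (if i = j then 1 else 0) else 0) + (if k = j then cnj w * P i j else 0)
       + (if k = i then w * P i j else 0) + cnj w * w * (P i k * P k j)) = (if i = j then 1 else 0) + (cnj w + w + cnj w * w) * P i j"
      using ij by (simp add: sum.distrib sq distrib_right)
    with exp show "(mat_adjoint ?V * ?V) $$ (i, j) = 1\<^sub>m N $$ (i, j)" using ij w by simp
  qed (use projection_rotation_carrier[of N P t] mat_adjoint_carrier[OF projection_rotation_carrier[of N P t]] in auto)
  then show ?thesis by (simp add: unitary_group_def projection_rotation_carrier)
qed

text \<open>The remainder is exactly (exp (i t) - 1 - i t) times an entry of P U, which is bounded
  uniformly in U.\<close>

lemma first_order_entry:
  assumes ij: "i < N" "j < N"
  shows "first_order (unitary_group N) (\<lambda>t U. (projection_rotation N P t * U) $$ (i, j)) (\<lambda>U. U $$ (i, j))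
    (\<lambda>U. \<i> * (\<Sum>c<N. P i c * U $$ (c, j)))"
  unfolding first_order_def
proof (intro exI conjI ballI)
  define C where "C = 1 + (\<Sum>c<N. norm (P i c))"
  have s: "0 \<le> (\<Sum>c<N. norm (P i c))" by (intro sum_nonneg) auto
  show "0 \<le> C" using s by (simp add: C_def)
  fix t U assume tU: "t \<in> {0..1::real}" "U \<in> unitary_group N"
  have PU: "norm (\<Sum>c<N. P i c * U $$ (c, j)) \<le> C"
  proof -
    have "norm (\<Sum>c<N. P i c * U $$ (c, j)) \<le> (\<Sum>c<N. norm (P i c))"
      using unitary_entry_bound[OF tU(2) _ ij(2)] by (intro sum_norm_le) (auto simp: norm_mult mult_left_le)
    then show ?thesis by (simp add: C_def)
  qed
  have "(projection_rotation N P t * U) $$ (i, j)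
     = (\<Sum>k<N. (if k = i then U $$ (i, j) else 0) + (exp (\<i> * of_real t) - 1) * (P i k * U $$ (k, j)))"
    using ij projection_rotation_carrier[of N P t] unitary_group_carrier[OF tU(2)]
    by (subst mat_mult_index[where N = N]) (auto simp: projection_rotation_def algebra_simps intro!: sum.cong)
  also have "\<dots> = U $$ (i, j) + (exp (\<i> * of_real t) - 1) * (\<Sum>c<N. P i c * U $$ (c, j))"
    using ij by (simp add: sum.distrib sum_distrib_left)
  finally have "(projection_rotation N P t * U) $$ (i, j) - U $$ (i, j) - of_real t * (\<i> * (\<Sum>c<N. P i c * U $$ (c, j)))
     = (exp (\<i> * of_real t) - 1 - \<i> * of_real t) * (\<Sum>c<N. P i c * U $$ (c, j))"
    by (simp add: algebra_simps)
  also have "norm \<dots> \<le> t\<^sup>2 * C"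
    unfolding norm_mult using norm_iexp_linear_remainder PU by (intro mult_mono) auto
  finally show "norm ((projection_rotation N P t * U) $$ (i, j) - U $$ (i, j)
      - of_real t * (\<i> * (\<Sum>c<N. P i c * U $$ (c, j)))) \<le> C * t\<^sup>2" by (simp add: mult.commute)
  show "norm (U $$ (i, j)) \<le> C" using unitary_entry_bound[OF tU(2) ij] s by (simp add: C_def)
  show "norm (\<i> * (\<Sum>c<N. P i c * U $$ (c, j))) \<le> C" using PU by (simp add: norm_mult)
qed

text \<open>
  The derivative of the \<open>(a, b)\<close> entry of \<open>U ^ n\<close> along the matrix unit \<open>E c d\<close> is \<open>\<i>\<close> times this sum.
\<close>
definition pow_deriv :: "nat \<Rightarrow> nat \<Rightarrow> nat \<Rightarrow> nat \<Rightarrow> nat \<Rightarrow> complex mat \<Rightarrow> complex" where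
  "pow_deriv n a b c d U = (\<Sum>k<n. (U ^\<^sub>m k) $$ (a, c) * (U ^\<^sub>m (n - k)) $$ (d, b))"

lemma pow_mat_Suc_index:
  assumes "U \<in> carrier_mat N N" "a < N" "b < N"
  shows "(U ^\<^sub>m Suc n) $$ (a, b) = (\<Sum>l<N. (U ^\<^sub>m n) $$ (a, l) * U $$ (l, b))"
  unfolding pow_mat.simps using assms by (intro mat_mult_index) auto

text \<open>Leibniz rule for U^n * U. The variation multiplies U from the left, so in the last
  factor it produces E c d * U; hence the new term (U^n) (a, c) * U (d, b).\<close>

lemma pow_deriv_Suc:
  assumes U: "U \<in> carrier_mat N N" and "a < N" "b < N" "c < N" "d < N"
  shows "pow_deriv (Suc n) a b c d U = (\<Sum>l<N. pow_deriv n a l c d U * U $$ (l, b)) + (U ^\<^sub>m n) $$ (a, c) * U $$ (d, b)"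
proof -
  have "(U ^\<^sub>m (Suc n - k)) $$ (d, b) = (\<Sum>l<N. (U ^\<^sub>m (n - k)) $$ (d, l) * U $$ (l, b))" if "k < n" for k
    using that pow_mat_Suc_index[OF U, of d b "n - k"] assms by (simp add: Suc_diff_le del: pow_mat.simps)
  then have "(\<Sum>k<n. (U ^\<^sub>m k) $$ (a, c) * (U ^\<^sub>m (Suc n - k)) $$ (d, b))
      = (\<Sum>k<n. \<Sum>l<N. (U ^\<^sub>m k) $$ (a, c) * (U ^\<^sub>m (n - k)) $$ (d, l) * U $$ (l, b))"
    by (simp add: sum_distrib_left mult.assoc del: pow_mat.simps)
  also have "\<dots> = (\<Sum>l<N. pow_deriv n a l c d U * U $$ (l, b))"
    by (subst sum.swap) (simp add: pow_deriv_def sum_distrib_right)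
  finally show ?thesis using U by (simp add: pow_deriv_def left_mult_one_mat[OF U])
qed

lemma first_order_pow_entry:
  assumes P: "orthogonal_projection N P" and "a < N" "b < N"
  shows "first_order (unitary_group N) (\<lambda>t U. ((projection_rotation N P t * U) ^\<^sub>m n) $$ (a, b)) (\<lambda>U. (U ^\<^sub>m n) $$ (a, b))
    (\<lambda>U. \<i> * (\<Sum>c<N. \<Sum>d<N. P c d * pow_deriv n a b c d U))"
  using assms(2,3)
proof (induction n arbitrary: b)
  case 0
  show ?case
    by (rule first_order_cong[OF first_order_const[of _ "if a = b then 1 else 0"]])
      (use 0 in \<open>auto simp: pow_deriv_def projection_rotation_def dest!: unitary_group_carrier\<close>)
next
  case (Suc n)
  have "first_order (unitary_group N)
     (\<lambda>t U. \<Sum>l<N. ((projection_rotation N P t * U) ^\<^sub>m n) $$ (a, l) * (projection_rotation N P t * U) $$ (l, b))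
     (\<lambda>U. \<Sum>l<N. (U ^\<^sub>m n) $$ (a, l) * U $$ (l, b))
     (\<lambda>U. \<Sum>l<N. (\<i> * (\<Sum>c<N. \<Sum>d<N. P c d * pow_deriv n a l c d U)) * U $$ (l, b)
        + (U ^\<^sub>m n) $$ (a, l) * (\<i> * (\<Sum>d<N. P l d * U $$ (d, b))))"
    using Suc by (intro first_order_sum first_order_mult Suc.IH first_order_entry) auto
  then show ?case
  proof (rule first_order_cong)
    fix U and t :: real assume U: "U \<in> unitary_group N"
    note c = unitary_group_carrier[OF U]
    show "(\<Sum>l<N. ((projection_rotation N P t * U) ^\<^sub>m n) $$ (a, l) * (projection_rotation N P t * U) $$ (l, b))
       = ((projection_rotation N P t * U) ^\<^sub>m Suc n) $$ (a, b)"
      using Suc.prems unitary_mult[OF projection_rotation_unitary[OF P] U]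
      by (intro pow_mat_Suc_index[symmetric] unitary_group_carrier)
    show "(\<Sum>l<N. (U ^\<^sub>m n) $$ (a, l) * U $$ (l, b)) = (U ^\<^sub>m Suc n) $$ (a, b)"
      using Suc.prems c by (intro pow_mat_Suc_index[symmetric])
    have "(\<Sum>l<N. (\<Sum>c<N. \<Sum>d<N. P c d * pow_deriv n a l c d U) * U $$ (l, b))
       = (\<Sum>c<N. \<Sum>d<N. P c d * (\<Sum>l<N. pow_deriv n a l c d U * U $$ (l, b)))"
      unfolding sum_distrib_right sum_distrib_left mult.assoc
      by (subst sum.swap, rule sum.cong[OF refl], subst sum.swap) (rule refl)
    moreover have "(\<Sum>l<N. (U ^\<^sub>m n) $$ (a, l) * (\<Sum>d<N. P l d * U $$ (d, b)))
       = (\<Sum>c<N. \<Sum>d<N. P c d * ((U ^\<^sub>m n) $$ (a, c) * U $$ (d, b)))"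
      by (simp add: sum_distrib_left mult_ac)
    ultimately have "(\<Sum>l<N. (\<Sum>c<N. \<Sum>d<N. P c d * pow_deriv n a l c d U) * U $$ (l, b))
        + (\<Sum>l<N. (U ^\<^sub>m n) $$ (a, l) * (\<Sum>d<N. P l d * U $$ (d, b)))
      = (\<Sum>c<N. \<Sum>d<N. P c d * pow_deriv (Suc n) a b c d U)"
      using Suc.prems by (simp add: pow_deriv_Suc[OF c] sum.distrib distrib_left)
    then show "(\<Sum>l<N. (\<i> * (\<Sum>c<N. \<Sum>d<N. P c d * pow_deriv n a l c d U)) * U $$ (l, b)
        + (U ^\<^sub>m n) $$ (a, l) * (\<i> * (\<Sum>d<N. P l d * U $$ (d, b))))
      = \<i> * (\<Sum>c<N. \<Sum>d<N. P c d * pow_deriv (Suc n) a b c d U)"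
      by (simp add: sum.distrib mult.assoc mult.left_commute[of _ \<i>] flip: sum_distrib_left distrib_left)
  qed
qed

text \<open>By cyclicity of the trace, each of the n positions of the matrix unit contributes the
  same entry of U^n.\<close>

lemma pow_deriv_trace:
  assumes U: "U \<in> carrier_mat N N" and "c < N" "d < N"
  shows "(\<Sum>a<N. pow_deriv n a a c d U) = of_nat n * (U ^\<^sub>m n) $$ (d, c)"
proof -
  have "(\<Sum>a<N. pow_deriv n a a c d U) = (\<Sum>k<n. \<Sum>a<N. (U ^\<^sub>m (n - k)) $$ (d, a) * (U ^\<^sub>m k) $$ (a, c))"
    unfolding pow_deriv_def by (subst sum.swap) (simp add: mult.commute)
  also have "\<dots> = (\<Sum>k<n. (U ^\<^sub>m (n - k) * U ^\<^sub>m k) $$ (d, c))"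
    using assms by (intro sum.cong refl mat_mult_index[symmetric]) auto
  also have "\<dots> = (\<Sum>k<n. (U ^\<^sub>m n) $$ (d, c))"
    by (intro sum.cong refl) (simp flip: pow_mat_add[OF U])
  finally show ?thesis by simp
qed

lemma first_order_power_trace:
  assumes P: "orthogonal_projection N P" and m: "m \<noteq> 0"
  shows "first_order (unitary_group N) (\<lambda>t U. power_trace N m (projection_rotation N P t * U)) (power_trace N m)
    (\<lambda>U. \<i> * (\<Sum>c<N. \<Sum>d<N. P c d * (of_int m * unitary_power_entry U m d c)))"
proof -
  have main: "first_order (unitary_group N) (\<lambda>t U. power_trace N (int n) (projection_rotation N P t * U))
      (power_trace N (int n)) (\<lambda>U. \<i> * (\<Sum>c<N. \<Sum>d<N. P c d * (of_nat n * (U ^\<^sub>m n) $$ (d, c))))" for n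
  proof -
    have "first_order (unitary_group N) (\<lambda>t U. \<Sum>a<N. ((projection_rotation N P t * U) ^\<^sub>m n) $$ (a, a))
       (\<lambda>U. \<Sum>a<N. (U ^\<^sub>m n) $$ (a, a)) (\<lambda>U. \<Sum>a<N. \<i> * (\<Sum>c<N. \<Sum>d<N. P c d * pow_deriv n a a c d U))"
      by (intro first_order_sum first_order_pow_entry P) auto
    then show ?thesis
    proof (rule first_order_cong)
      fix U assume U: "U \<in> unitary_group N"
      have "(\<Sum>a<N. \<Sum>c<N. \<Sum>d<N. P c d * pow_deriv n a a c d U)
         = (\<Sum>c<N. \<Sum>d<N. \<Sum>a<N. P c d * pow_deriv n a a c d U)"
        by (subst sum.swap, rule sum.cong[OF refl], subst sum.swap) (rule refl)
      also have "\<dots> = (\<Sum>c<N. \<Sum>d<N. P c d * (of_nat n * (U ^\<^sub>m n) $$ (d, c)))"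
        by (intro sum.cong refl) (simp add: pow_deriv_trace[OF unitary_group_carrier[OF U]] flip: sum_distrib_left)
      finally show "(\<Sum>a<N. \<i> * (\<Sum>c<N. \<Sum>d<N. P c d * pow_deriv n a a c d U))
         = \<i> * (\<Sum>c<N. \<Sum>d<N. P c d * (of_nat n * (U ^\<^sub>m n) $$ (d, c)))"
        by (simp flip: sum_distrib_left)
    qed (simp_all add: power_trace_def unitary_power_entry_def)
  qed
  show ?thesis
  proof (cases "m > 0")
    case True
    then show ?thesis using main[of "nat m"] by (simp add: unitary_power_entry_def)
  next
    case False
    then have neg: "m < 0" using m by simp
    have "first_order (unitary_group N) (\<lambda>t U. cnj (power_trace N (int (nat (- m))) (projection_rotation N P t * U)))
      (\<lambda>U. cnj (power_trace N (int (nat (- m))) U))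
      (\<lambda>U. cnj (\<i> * (\<Sum>c<N. \<Sum>d<N. P c d * (of_nat (nat (- m)) * (U ^\<^sub>m nat (- m)) $$ (d, c)))))"
      by (rule first_order_cnj[OF main])
    then show ?thesis
    proof (rule first_order_cong)
      have tr: "cnj (power_trace N (int (nat (- m))) U) = power_trace N m U" for U
        using power_trace_uminus[of "- m" N U] neg by simp
      then show "cnj (power_trace N (int (nat (- m))) (projection_rotation N P t * U))
          = power_trace N m (projection_rotation N P t * U)"
        "cnj (power_trace N (int (nat (- m))) U) = power_trace N m U" for t U by auto
      fix U
      \<comment> \<open>P is Hermitian, so conjugation swaps the indices of P; the conjugate of i
        supplies the sign that turns the factor - m into m.\<close>
      have "cnj (\<Sum>c<N. \<Sum>d<N. P c d * (of_nat (nat (- m)) * (U ^\<^sub>m nat (- m)) $$ (d, c)))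
         = (\<Sum>c<N. \<Sum>d<N. P d c * (- of_int m * unitary_power_entry U m c d))"
        unfolding cnj_sum using P neg
        by (intro sum.cong refl) (auto simp: orthogonal_projection_def unitary_power_entry_def)
      also have "\<dots> = (\<Sum>c<N. \<Sum>d<N. P c d * (- of_int m * unitary_power_entry U m d c))"
        by (rule sum.swap)
      finally show "cnj (\<i> * (\<Sum>c<N. \<Sum>d<N. P c d * (of_nat (nat (- m)) * (U ^\<^sub>m nat (- m)) $$ (d, c))))
         = \<i> * (\<Sum>c<N. \<Sum>d<N. P c d * (of_int m * unitary_power_entry U m d c))"
        by (simp add: sum_negf)
    qed
  qed
qed

lemma first_order_trace_monomial:
  assumes P: "orthogonal_projection N P" and M: "0 \<notin># M"
  shows "first_order (unitary_group N) (\<lambda>t U. trace_monomial N M (projection_rotation N P t * U)) (trace_monomial N M)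
    (\<lambda>U. \<i> * (\<Sum>c<N. \<Sum>d<N. P c d * (\<Sum>m\<in>#M. of_int m * unitary_power_entry U m d c * trace_monomial N (M - {#m#}) U)))"
  using M
proof (induction M)
  case empty
  then show ?case by (rule_tac first_order_cong[OF first_order_const[of _ 1]]) auto
next
  case (add m M)
  have "first_order (unitary_group N)
     (\<lambda>t U. power_trace N m (projection_rotation N P t * U) * trace_monomial N M (projection_rotation N P t * U))
     (\<lambda>U. power_trace N m U * trace_monomial N M U)
     (\<lambda>U. (\<i> * (\<Sum>c<N. \<Sum>d<N. P c d * (of_int m * unitary_power_entry U m d c))) * trace_monomial N M U
       + power_trace N m U * (\<i> * (\<Sum>c<N. \<Sum>d<N. P c d *
          (\<Sum>m\<in>#M. of_int m * unitary_power_entry U m d c * trace_monomial N (M - {#m#}) U))))"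
    using add by (intro first_order_mult first_order_power_trace P) auto
  then show ?case
  proof (rule first_order_cong)
    fix U
    have *: "(\<Sum>b\<in>#M. of_int b * unitary_power_entry U b d c * trace_monomial N (add_mset m M - {#b#}) U)
       = power_trace N m U * (\<Sum>b\<in>#M. of_int b * unitary_power_entry U b d c * trace_monomial N (M - {#b#}) U)" for c d
      unfolding sum_mset_distrib_left
    proof (intro arg_cong[of _ _ sum_mset] image_mset_cong)
      fix b assume "b \<in># M"
      then have "add_mset m M - {#b#} = add_mset m (M - {#b#})" by simp
      then show "of_int b * unitary_power_entry U b d c * trace_monomial N (add_mset m M - {#b#}) U
        = power_trace N m U * (of_int b * unitary_power_entry U b d c * trace_monomial N (M - {#b#}) U)"
        by simp
    qed
    define S where "S c d = (\<Sum>b\<in>#M. of_int b * unitary_power_entry U b d c * trace_monomial N (M - {#b#}) U)" for c d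
    have body: "(\<Sum>b\<in>#add_mset m M. of_int b * unitary_power_entry U b d c * trace_monomial N (add_mset m M - {#b#}) U)
      = of_int m * unitary_power_entry U m d c * trace_monomial N M U + power_trace N m U * S c d" for c d
      by (simp add: * S_def)
    show "(\<i> * (\<Sum>c<N. \<Sum>d<N. P c d * (of_int m * unitary_power_entry U m d c))) * trace_monomial N M U
       + power_trace N m U * (\<i> * (\<Sum>c<N. \<Sum>d<N. P c d *
          (\<Sum>m\<in>#M. of_int m * unitary_power_entry U m d c * trace_monomial N (M - {#m#}) U)))
      = \<i> * (\<Sum>c<N. \<Sum>d<N. P c d * (\<Sum>b\<in>#add_mset m M. of_int b * unitary_power_entry U b d c
          * trace_monomial N (add_mset m M - {#b#}) U))"
      unfolding body S_def[symmetric] by (simp add: distrib_left sum.distrib sum_distrib_left sum_distrib_right mult_ac)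
  qed auto
qed

section \<open>From projections to matrix units\<close>

lemma orthogonal_projection_rank_one:
  assumes s: "(\<Sum>k<N. v k * cnj (v k)) = s" "s \<noteq> 0"
  shows "orthogonal_projection N (\<lambda>i j. v i * cnj (v j) / s)"
proof -
  have "cnj s = s" unfolding s(1)[symmetric] by (simp add: mult.commute)
  moreover have "(\<Sum>k<N. (v i * cnj (v k) / s) * (v k * cnj (v j) / s)) = v i * cnj (v j) / s" for i j
  proof -
    have "(\<Sum>k<N. (v i * cnj (v k) / s) * (v k * cnj (v j) / s))
       = (\<Sum>k<N. v k * cnj (v k)) * (v i * cnj (v j) / (s * s))"
      unfolding sum_distrib_right by (intro sum.cong) (auto simp: field_simps)
    then show ?thesis using s by simp
  qed
  ultimately show ?thesis by (simp add: orthogonal_projection_def mult.commute)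
qed

text \<open>
  Invariance of the Haar measure gives information along orthogonal projections only; the rank one
  projections span all matrices over the complex numbers.
\<close>
lemma projection_polarization:
  fixes X :: "nat \<Rightarrow> nat \<Rightarrow> complex"
  assumes X: "\<And>P. orthogonal_projection N P \<Longrightarrow> (\<Sum>i<N. \<Sum>j<N. P i j * X i j) = 0"
    and c: "c < N" and d: "d < N"
  shows "X c d = 0"
proof -
  have rank1: "(\<Sum>i<N. v i * (\<Sum>j<N. cnj (v j) * X i j)) = 0"
    if "(\<Sum>k<N. v k * cnj (v k)) \<noteq> 0" for v
    using X[OF orthogonal_projection_rank_one[OF refl that]] that
    by (simp add: sum_distrib_left mult.assoc flip: sum_divide_distrib)
  have diag: "X c c = 0" if "c < N" for c
  proof -
    show ?thesis using rank1[of "\<lambda>k. if k = c then 1 else 0"] that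
      by (simp add: mult_delta_left if_distrib[of cnj] cong: if_cong)
  qed
  show ?thesis
  proof (cases "c = d")
    case True
    then show ?thesis using diag[OF c] by simp
  next
    case False
    \<comment> \<open>The test vector is e_c + w e_d with |w| = 1, and the diagonal entries are
      already known to vanish. The choices w = 1 and w = i separate X c d from X d c.\<close>
    have pair: "cnj \<omega> * X c d + \<omega> * X d c = 0" if \<omega>: "\<omega> * cnj \<omega> = 1" for \<omega>
    proof -
      define v where "v k = (if k = c then 1 else 0) + (if k = d then \<omega> else 0)" for k
      have v: "(\<Sum>i<N. v i * g i) = g c + \<omega> * g d" for g :: "nat \<Rightarrow> complex"
        using c d by (simp add: v_def distrib_right sum.distrib mult_delta_left cong: if_cong)
      have v': "(\<Sum>i<N. cnj (v i) * g i) = g c + cnj \<omega> * g d" for g :: "nat \<Rightarrow> complex"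
        using c d by (simp add: v_def distrib_right sum.distrib if_distrib[of cnj] mult_delta_left cong: if_cong)
      have "(\<Sum>k<N. v k * cnj (v k)) = 2"
        unfolding v using False \<omega> by (simp add: v_def)
      then have "(\<Sum>i<N. v i * (\<Sum>j<N. cnj (v j) * X i j)) = 0" by (intro rank1) simp
      then show ?thesis using \<omega> diag[OF c] diag[OF d]
        unfolding v v' by (simp add: algebra_simps)
    qed
    from pair[of 1] pair[of \<i>] have "X c d + X d c = 0" "\<i> * (X d c - X c d) = 0"
      by (auto simp: algebra_simps)
    then show ?thesis by (simp add: add_eq_0_iff)
  qed
qed

section \<open>Differentiating the invariance of Haar measure\<close>

lemma haar_prob_simps:
  assumes "haar_prob N M"
  shows "prob_space M" "sets M = sets (unitary_borel N)" "space M = unitary_group N"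
    "measurable M (borel :: complex measure) = borel_measurable (unitary_borel N)"
  using assms sets_eq_imp_space_eq[of M "unitary_borel N"] measurable_cong_sets[of M "unitary_borel N" borel borel]
  by (auto simp: haar_prob_def sets_unitary_borel_space)

lemma haar_integrable_bounded:
  fixes g :: "complex mat \<Rightarrow> complex"
  assumes "haar_prob N M" "g \<in> borel_measurable (unitary_borel N)" "\<And>U. U \<in> unitary_group N \<Longrightarrow> norm (g U) \<le> B"
  shows "integrable M g"
proof -
  interpret prob_space M using haar_prob_simps(1)[OF assms(1)] .
  show ?thesis using assms haar_prob_simps[OF assms(1)]
    by (intro integrable_const_bound[of _ B]) (auto intro!: AE_I2)
qed

text \<open>By invariance h and its translate have the same mean, so the expansion leaves t * |E d|
  <= C * t^2 for every t in [0, 1], and this forces E d = 0.\<close>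

lemma haar_directional_derivative:
  assumes M: "haar_prob N M" and P: "orthogonal_projection N P"
    and fo: "first_order (unitary_group N) (\<lambda>t U. h (projection_rotation N P t * U)) h d"
    and meas: "h \<in> borel_measurable (unitary_borel N)" "d \<in> borel_measurable (unitary_borel N)"
  shows "(LINT U|M. d U) = 0"
proof -
  interpret prob_space M using haar_prob_simps(1)[OF M] .
  obtain C where C: "C \<ge> 0" "\<And>t U. t \<in> {0..1} \<Longrightarrow> U \<in> unitary_group N \<Longrightarrow>
      norm (h (projection_rotation N P t * U) - h U - of_real t * d U) \<le> C * t\<^sup>2 \<and> norm (h U) \<le> C \<and> norm (d U) \<le> C"
    using fo unfolding first_order_def by metis
  have ih: "integrable M h" and id: "integrable M d"
    using C(2)[of 0] by (auto intro!: haar_integrable_bounded[OF M, of _ C] meas)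
  have small: "t * norm (LINT U|M. d U) \<le> C * t\<^sup>2" if t: "t \<in> {0..1}" for t
  proof -
    note V = projection_rotation_unitary[OF P, of t]
    have ihV: "integrable M (\<lambda>U. h (projection_rotation N P t * U))"
      using C(2)[of 0] unitary_mult[OF V] measurable_compose[OF measurable_left_mult[OF V] meas(1)]
      by (intro haar_integrable_bounded[OF M, of _ C]) auto
    have "(LINT U|M. h (projection_rotation N P t * U) - h U - of_real t * d U) = - (of_real t * (LINT U|M. d U))"
      using ihV ih id haar_integral_left_mult[OF M V meas(1)] by simp
    moreover have "norm (LINT U|M. h (projection_rotation N P t * U) - h U - of_real t * d U) \<le> (LINT U|M. C * t\<^sup>2)"
      using C(2)[OF t] ihV ih id haar_prob_simps(3)[OF M]
      by (intro order.trans[OF integral_norm_bound integral_mono]) auto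
    ultimately show ?thesis using t by (simp add: norm_mult prob_space)
  qed
  have "norm (LINT U|M. d U) \<le> 0"
  proof (rule ccontr)
    assume "\<not> ?thesis"
    then have pos: "norm (LINT U|M. d U) > 0" by simp
    \<comment> \<open>Small enough that C * t is at most half of the norm; C + 1 in place of C
      avoids a division by 0.\<close>
    define t where "t = min 1 (norm (LINT U|M. d U) / (2 * (C + 1)))"
    have t: "0 < t" "t \<le> 1" using pos C(1) by (auto simp: t_def)
    have "t * norm (LINT U|M. d U) \<le> t * (C * t)" using small[of t] t by (simp add: power2_eq_square mult_ac)
    then have "norm (LINT U|M. d U) \<le> C * t" using t by simp
    also have "\<dots> \<le> (C + 1) * (norm (LINT U|M. d U) / (2 * (C + 1)))"
      using C(1) t by (intro mult_mono) (auto simp: t_def)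
    also have "\<dots> = norm (LINT U|M. d U) / 2" using C(1) by (simp add: field_simps)
    finally show False using pos by simp
  qed
  then show ?thesis by simp
qed

definition trace_moment :: "nat \<Rightarrow> complex mat measure \<Rightarrow> int multiset \<Rightarrow> complex" where
  "trace_moment N M Q = (LINT U|M. trace_monomial N Q U)"

lemma trace_monomial_bound: "U \<in> unitary_group N \<Longrightarrow> norm (trace_monomial N Q U) \<le> real N ^ size Q"
  by (induction Q) (auto simp: norm_mult intro!: mult_mono power_trace_bound)

lemma integrable_trace_monomial: "haar_prob N M \<Longrightarrow> integrable M (trace_monomial N Q)"
  by (rule haar_integrable_bounded[OF _ measurable_trace_monomial trace_monomial_bound])

lemma integral_sum_mset:
  fixes f :: "'b \<Rightarrow> 'a \<Rightarrow> complex"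
  assumes "\<And>m. m \<in># Q \<Longrightarrow> integrable M (f m)"
  shows "integrable M (\<lambda>U. \<Sum>m\<in>#Q. f m U) \<and> (LINT U|M. (\<Sum>m\<in>#Q. f m U)) = (\<Sum>m\<in>#Q. (LINT U|M. f m U))"
  using assms by (induction Q) auto

lemma double_sum_product_rule:
  fixes P f S :: "nat \<Rightarrow> nat \<Rightarrow> complex"
  shows "(i * (\<Sum>c<N. \<Sum>d<N. P c d * f c d)) * t + u * (i * (\<Sum>c<N. \<Sum>d<N. P c d * S c d))
    = i * (\<Sum>c<N. \<Sum>d<N. P c d * (f c d * t + u * S c d))"
  by (simp add: distrib_left sum.distrib sum_distrib_left sum_distrib_right mult_ac)

lemma integral_double_sum:
  fixes g :: "nat \<Rightarrow> nat \<Rightarrow> 'a \<Rightarrow> complex"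
  assumes "\<And>c d. c < N \<Longrightarrow> d < N \<Longrightarrow> integrable M (g c d)"
  shows "(LINT U|M. (\<Sum>c<N. \<Sum>d<N. g c d U)) = (\<Sum>c<N. \<Sum>d<N. (LINT U|M. g c d U))"
proof -
  have "(LINT U|M. (\<Sum>c<N. \<Sum>d<N. g c d U)) = (\<Sum>c<N. (LINT U|M. (\<Sum>d<N. g c d U)))"
    using assms by (intro Bochner_Integration.integral_sum Bochner_Integration.integrable_sum) auto
  also have "\<dots> = (\<Sum>c<N. \<Sum>d<N. (LINT U|M. g c d U))"
    using assms by (intro sum.cong refl Bochner_Integration.integral_sum) auto
  finally show ?thesis .
qed

text \<open>
  The derivative of \<open>(U ^ n) (a, b) * trace_monomial N Q U\<close> along the matrix unit \<open>E a b\<close> has mean \<open>0\<close>;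
  the equation is the sum over all \<open>a\<close> and \<open>b\<close>.
\<close>
lemma haar_loop_equation:
  assumes M: "haar_prob N M" and n: "n > 0" and Q: "0 \<notin># Q"
  shows "of_nat N * trace_moment N M (add_mset n Q)
     + (\<Sum>k=1..n-1. trace_moment N M (add_mset k (add_mset (n - k) Q)))
     + (\<Sum>a\<in>#Q. of_int a * trace_moment N M (add_mset (n + a) (Q - {#a#}))) = 0"
proof -
  define q where "q = nat n"
  have q: "int q = n" "q > 0" using n by (auto simp: q_def)
  \<comment> \<open>Up to the factor i, the derivative of (U^q) (a, b) *
    \<open>trace_monomial N Q U\<close> along E c d. The direction is kept independent of a and b
    because polarization needs all directions at once; the case c = a, d = b is taken
    afterwards.\<close>
  define X where "X a b c d U = pow_deriv q a b c d U * trace_monomial N Q U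
      + (U ^\<^sub>m q) $$ (a, b) * (\<Sum>m\<in>#Q. of_int m * unitary_power_entry U m d c * trace_monomial N (Q - {#m#}) U)"
    for a b c d and U :: "complex mat"
  have meas_mset: "(\<lambda>U. \<Sum>m\<in>#R. of_int m * unitary_power_entry U m d c * trace_monomial N (S m) U) \<in> borel_measurable (unitary_borel N)"
    if "c < N" "d < N" for c d R S
    using that by (induction R)
      (auto intro!: borel_measurable_add borel_measurable_times measurable_unitary_power_entry measurable_trace_monomial)
  have meas_X: "X a b c d \<in> borel_measurable (unitary_borel N)" if "a < N" "b < N" "c < N" "d < N" for a b c d
    unfolding X_def[abs_def] pow_deriv_def using that
    by (intro borel_measurable_add borel_measurable_times borel_measurable_sum measurable_pow_entry
        measurable_trace_monomial meas_mset)
  have bound_entry: "norm ((U ^\<^sub>m k) $$ (i, j)) \<le> 1" if "U \<in> unitary_group N" "i < N" "j < N" for U k i j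
    using unitary_entry_bound[OF unitary_pow[OF that(1)] that(2,3)] .
  have int_X: "integrable M (X a b c d)" if "a < N" "b < N" "c < N" "d < N" for a b c d
  proof -
    have le: "norm (u * w) \<le> B" if "norm u \<le> 1" "norm w \<le> B" for u w :: complex and B
      using mult_mono[OF that] by (simp add: norm_mult)
    have "integrable M (\<lambda>U. (U ^\<^sub>m k) $$ (a, c) * (U ^\<^sub>m (q - k)) $$ (d, b) * trace_monomial N Q U)" for k
    proof (rule haar_integrable_bounded[OF M])
      fix U assume U: "U \<in> unitary_group N"
      show "norm ((U ^\<^sub>m k) $$ (a, c) * (U ^\<^sub>m (q - k)) $$ (d, b) * trace_monomial N Q U) \<le> real N ^ size Q"
        unfolding mult.assoc using that U by (intro le bound_entry trace_monomial_bound)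
    qed (use that in \<open>intro borel_measurable_times measurable_pow_entry measurable_trace_monomial\<close>)
    moreover have "integrable M (\<lambda>U. (U ^\<^sub>m q) $$ (a, b) * (of_int m * unitary_power_entry U m d c * trace_monomial N (Q - {#m#}) U))" for m
    proof (rule haar_integrable_bounded[OF M])
      fix U assume U: "U \<in> unitary_group N"
      have "norm ((U ^\<^sub>m q) $$ (a, b) * (unitary_power_entry U m d c * (of_int m * trace_monomial N (Q - {#m#}) U)))
          \<le> \<bar>of_int m\<bar> * real N ^ size (Q - {#m#})"
        using that U trace_monomial_bound[OF U, of "Q - {#m#}"]
        by (intro le[OF bound_entry le[OF unitary_power_entry_bound]]) (simp_all add: norm_mult mult_left_mono)
      then show "norm ((U ^\<^sub>m q) $$ (a, b) * (of_int m * unitary_power_entry U m d c * trace_monomial N (Q - {#m#}) U))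
          \<le> \<bar>of_int m\<bar> * real N ^ size (Q - {#m#})" by (simp only: mult_ac)
    qed (use that in \<open>intro borel_measurable_times borel_measurable_const measurable_pow_entry
        measurable_unitary_power_entry measurable_trace_monomial\<close>)
    ultimately show ?thesis
      unfolding X_def pow_deriv_def sum_distrib_right sum_mset_distrib_left
      by (intro Bochner_Integration.integrable_add Bochner_Integration.integrable_sum integral_sum_mset[THEN conjunct1]) auto
  qed
  have X0: "(LINT U|M. X a b c d U) = 0" if ab: "a < N" "b < N" and cd: "c < N" "d < N" for a b c d
  proof (rule projection_polarization[OF _ cd])
    fix P assume P: "orthogonal_projection N P"
    have "first_order (unitary_group N)
       (\<lambda>t U. ((projection_rotation N P t * U) ^\<^sub>m q) $$ (a, b) * trace_monomial N Q (projection_rotation N P t * U))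
       (\<lambda>U. (U ^\<^sub>m q) $$ (a, b) * trace_monomial N Q U)
       (\<lambda>U. (\<i> * (\<Sum>c<N. \<Sum>d<N. P c d * pow_deriv q a b c d U)) * trace_monomial N Q U
          + (U ^\<^sub>m q) $$ (a, b) * (\<i> * (\<Sum>c<N. \<Sum>d<N. P c d *
             (\<Sum>m\<in>#Q. of_int m * unitary_power_entry U m d c * trace_monomial N (Q - {#m#}) U))))"
      by (intro first_order_mult first_order_pow_entry first_order_trace_monomial P ab Q)
    moreover have "(\<lambda>U. (\<i> * (\<Sum>c<N. \<Sum>d<N. P c d * pow_deriv q a b c d U)) * trace_monomial N Q U
          + (U ^\<^sub>m q) $$ (a, b) * (\<i> * (\<Sum>c<N. \<Sum>d<N. P c d *
             (\<Sum>m\<in>#Q. of_int m * unitary_power_entry U m d c * trace_monomial N (Q - {#m#}) U))))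
        = (\<lambda>U. \<i> * (\<Sum>c<N. \<Sum>d<N. P c d * X a b c d U))"
      unfolding X_def double_sum_product_rule ..
    ultimately have "(LINT U|M. \<i> * (\<Sum>c<N. \<Sum>d<N. P c d * X a b c d U)) = 0"
      using ab meas_X
      by (intro haar_directional_derivative[OF M P])
        (auto intro!: borel_measurable_times borel_measurable_sum measurable_pow_entry measurable_trace_monomial)
    moreover have "(LINT U|M. (\<Sum>c<N. \<Sum>d<N. P c d * X a b c d U)) = (\<Sum>c<N. \<Sum>d<N. P c d * (LINT U|M. X a b c d U))"
      using int_X[OF ab] by (subst integral_double_sum) auto
    ultimately show "(\<Sum>c<N. \<Sum>d<N. P c d * (LINT U|M. X a b c d U)) = 0" by simp
  qed
  have "0 = (\<Sum>a<N. \<Sum>b<N. (LINT U|M. X a b a b U))" using X0 by simp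
  also have "\<dots> = (LINT U|M. (\<Sum>a<N. \<Sum>b<N. X a b a b U))"
    using int_X by (subst integral_double_sum) auto
  also have "\<dots> = (LINT U|M. (\<Sum>k<q. trace_monomial N (add_mset (int k) (add_mset (n - int k) Q)) U)
      + (\<Sum>m\<in>#Q. of_int m * trace_monomial N (add_mset (n + m) (Q - {#m#})) U))"
  proof (intro Bochner_Integration.integral_cong refl)
    fix U assume "U \<in> space M"
    then have U: "U \<in> unitary_group N" by (simp add: haar_prob_simps(3)[OF M])
    \<comment> \<open>In the direction E a b both factors of each term become diagonal entries, so
      the double sum is a product of two traces.\<close>
    have "(\<Sum>a<N. \<Sum>b<N. pow_deriv q a b a b U) = (\<Sum>k<q. power_trace N (int k) U * power_trace N (n - int k) U)"
    proof -
      have "(\<Sum>a<N. \<Sum>b<N. pow_deriv q a b a b U)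
        = (\<Sum>k<q. \<Sum>a<N. \<Sum>b<N. (U ^\<^sub>m k) $$ (a, a) * (U ^\<^sub>m (q - k)) $$ (b, b))"
        unfolding pow_deriv_def by (subst (2) sum.swap, subst sum.swap) (rule refl)
      also have "\<dots> = (\<Sum>k<q. power_trace N (int k) U * power_trace N (n - int k) U)"
      proof (intro sum.cong refl)
        fix k assume "k \<in> {..<q}"
        then have "int k \<le> n" "q - k = nat (n - int k)" using q(1) by auto
        then show "(\<Sum>a<N. \<Sum>b<N. (U ^\<^sub>m k) $$ (a, a) * (U ^\<^sub>m (q - k)) $$ (b, b))
          = power_trace N (int k) U * power_trace N (n - int k) U"
          by (simp add: power_trace_def unitary_power_entry_def sum_product)
      qed
      finally show ?thesis .
    qed
    \<comment> \<open>Here the entries form the trace of U^n * U^m, so m is fused with n. The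
      induction runs over R only; g stands for the monomials taken from the full multiset Q.\<close>
    moreover have "(\<Sum>a<N. \<Sum>b<N. (U ^\<^sub>m q) $$ (a, b) * (\<Sum>m\<in>#R. of_int m * unitary_power_entry U m b a * g m))
       = (\<Sum>m\<in>#R. of_int m * (power_trace N (n + m) U * g m))" for R g
    proof (induction R)
      case (add m R)
      have "(\<Sum>a<N. \<Sum>b<N. (U ^\<^sub>m q) $$ (a, b) * unitary_power_entry U m b a) = power_trace N (n + m) U"
        unfolding power_trace_def
        using sum_unitary_power_entry[OF U, of _ _ n m] n by (intro sum.cong refl) (simp add: unitary_power_entry_def q_def)
      then have "(\<Sum>a<N. \<Sum>b<N. (U ^\<^sub>m q) $$ (a, b) * (of_int m * unitary_power_entry U m b a * g m))
        = of_int m * (power_trace N (n + m) U * g m)"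
        by (simp add: mult_ac flip: sum_distrib_left)
      with add show ?case by (simp add: distrib_left sum.distrib)
    qed simp
    ultimately show "(\<Sum>a<N. \<Sum>b<N. X a b a b U) = (\<Sum>k<q. trace_monomial N (add_mset (int k) (add_mset (n - int k) Q)) U)
      + (\<Sum>m\<in>#Q. of_int m * trace_monomial N (add_mset (n + m) (Q - {#m#})) U)"
      unfolding X_def sum.distrib sum_distrib_right[symmetric]
      by (simp only: sum_distrib_right trace_monomial_add mult.assoc)
  qed
  also have "\<dots> = (\<Sum>k<q. trace_moment N M (add_mset (int k) (add_mset (n - int k) Q)))
     + (\<Sum>m\<in>#Q. of_int m * trace_moment N M (add_mset (n + m) (Q - {#m#})))"
    using integral_sum_mset[of Q M "\<lambda>m U. of_int m * trace_monomial N (add_mset (n + m) (Q - {#m#})) U"]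
      integrable_trace_monomial[OF M] unfolding trace_moment_def
    by (subst Bochner_Integration.integral_add) (auto simp del: trace_monomial_add)
  \<comment> \<open>The term k = 0 contains the trace of the identity and becomes the leading term
    with coefficient N.\<close>
  also have "(\<Sum>k<q. trace_moment N M (add_mset (int k) (add_mset (n - int k) Q)))
     = trace_moment N M (add_mset 0 (add_mset n Q)) + (\<Sum>k\<in>{1..<q}. trace_moment N M (add_mset (int k) (add_mset (n - int k) Q)))"
    using q(2) by (simp add: lessThan_atLeast0 sum.atLeast_Suc_lessThan)
  also have "(\<Sum>k\<in>{1..<q}. trace_moment N M (add_mset (int k) (add_mset (n - int k) Q)))
     = (\<Sum>k=1..n-1. trace_moment N M (add_mset k (add_mset (n - k) Q)))"
    by (rule sum.reindex_bij_witness[of _ nat int]) (auto simp: q_def)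
  also have "trace_moment N M (add_mset 0 (add_mset n Q)) = of_nat N * trace_moment N M (add_mset n Q)"
  proof -
    have "trace_moment N M (add_mset 0 (add_mset n Q)) = (LINT U|M. of_nat N * trace_monomial N (add_mset n Q) U)"
      unfolding trace_moment_def
      by (intro Bochner_Integration.integral_cong) (auto simp: haar_prob_simps(3)[OF M] power_trace_0)
    then show ?thesis by (simp add: trace_moment_def)
  qed
  finally show ?thesis by simp
qed

section \<open>Scalar rotations and the vanishing of unbalanced moments\<close>

lemma smult_smult_mat: "a \<cdot>\<^sub>m (b \<cdot>\<^sub>m A) = (a * b :: 'a :: ring) \<cdot>\<^sub>m A"
  by (intro eq_matI) (auto simp: mult.assoc)

lemma scalar_rotation_unitary: "cis \<alpha> \<cdot>\<^sub>m 1\<^sub>m N \<in> unitary_group N"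
proof -
  have c: "cis \<alpha> \<cdot>\<^sub>m (1\<^sub>m N :: complex mat) \<in> carrier_mat N N" by simp
  have "mat_adjoint (cis \<alpha> \<cdot>\<^sub>m 1\<^sub>m N) = cis (- \<alpha>) \<cdot>\<^sub>m (1\<^sub>m N :: complex mat)"
    using mat_adjoint_carrier[OF c] by (intro eq_matI) (auto simp: mat_adjoint_index[OF c] cis_cnj)
  moreover have "(cis (- \<alpha>) \<cdot>\<^sub>m 1\<^sub>m N) * (cis \<alpha> \<cdot>\<^sub>m 1\<^sub>m N) = (1\<^sub>m N :: complex mat)"
    by (simp add: mult_smult_distrib[where nr = N and n = N and nc = N] mult_smult_assoc_mat[where nr = N and n = N and nc = N]
        smult_smult_mat cis_mult) (intro eq_matI, auto)
  ultimately show ?thesis using c by (simp add: unitary_group_def)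
qed

lemma power_trace_rotation:
  assumes U: "U \<in> unitary_group N"
  shows "power_trace N m ((cis \<alpha> \<cdot>\<^sub>m 1\<^sub>m N) * U) = cis (\<alpha> * of_int m) * power_trace N m U"
proof -
  note c = unitary_group_carrier[OF U]
  have VU: "(cis \<alpha> \<cdot>\<^sub>m 1\<^sub>m N) * U = cis \<alpha> \<cdot>\<^sub>m U"
    using c by (simp add: mult_smult_assoc_mat[where nr = N and n = N and nc = N])
  have pow: "((cis \<alpha> \<cdot>\<^sub>m U) ^\<^sub>m k) = cis (\<alpha> * real k) \<cdot>\<^sub>m (U ^\<^sub>m k)" for k
  proof (induction k)
    case 0
    then show ?case using c by (intro eq_matI) auto
  next
    case (Suc k)
    then show ?case using c
      by (simp add: mult_smult_distrib[where nr = N and n = N and nc = N] mult_smult_assoc_mat[where nr = N and n = N and nc = N]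
        smult_smult_mat cis_mult algebra_simps)
  qed
  have "unitary_power_entry (cis \<alpha> \<cdot>\<^sub>m U) m i i = cis (\<alpha> * of_int m) * unitary_power_entry U m i i" if "i < N" for i
  proof -
    have "(cis x \<cdot>\<^sub>m (U ^\<^sub>m k)) $$ (i, i) = cis x * (U ^\<^sub>m k) $$ (i, i)" for x k
      using that carrier_matD[OF c] by (intro index_smult_mat(1)) simp_all
    then show ?thesis unfolding unitary_power_entry_def pow by (auto simp: cis_cnj)
  qed
  then show ?thesis unfolding VU power_trace_def by (simp add: sum_distrib_left)
qed

lemma trace_monomial_rotation:
  assumes U: "U \<in> unitary_group N"
  shows "trace_monomial N Q ((cis \<alpha> \<cdot>\<^sub>m 1\<^sub>m N) * U) = cis (\<alpha> * of_int (\<Sum>\<^sub># Q)) * trace_monomial N Q U"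
  by (induction Q) (simp_all add: power_trace_rotation[OF U] distrib_left flip: cis_mult)

lemma trace_moment_unbalanced:
  assumes M: "haar_prob N M" and Q: "\<Sum>\<^sub># Q \<noteq> 0"
  shows "trace_moment N M Q = 0"
proof -
  \<comment> \<open>This rotation multiplies the monomial by cis pi = -1, so its mean equals its own
    negative.\<close>
  define \<alpha> where "\<alpha> = pi / of_int (\<Sum>\<^sub># Q)"
  have "trace_moment N M Q = (LINT U|M. trace_monomial N Q ((cis \<alpha> \<cdot>\<^sub>m 1\<^sub>m N) * U))"
    unfolding trace_moment_def
    by (rule haar_integral_left_mult[OF M scalar_rotation_unitary measurable_trace_monomial, symmetric])
  also have "\<dots> = (LINT U|M. cis (\<alpha> * of_int (\<Sum>\<^sub># Q)) * trace_monomial N Q U)"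
    by (intro Bochner_Integration.integral_cong) (auto simp: haar_prob_simps(3)[OF M] trace_monomial_rotation)
  also have "\<alpha> * of_int (\<Sum>\<^sub># Q) = pi"
    using Q unfolding \<alpha>_def by (metis divide_eq_eq of_int_eq_0_iff)
  also have "(LINT U|M. cis pi * trace_monomial N Q U) = - trace_moment N M Q"
    by (simp add: trace_moment_def)
  finally show ?thesis by simp
qed

lemma trace_moment_add_0:
  assumes M: "haar_prob N M"
  shows "trace_moment N M (add_mset 0 Q) = of_nat N * trace_moment N M Q"
proof -
  have "trace_moment N M (add_mset 0 Q) = (LINT U|M. of_nat N * trace_monomial N Q U)"
    unfolding trace_moment_def
    by (intro Bochner_Integration.integral_cong) (auto simp: haar_prob_simps(3)[OF M] power_trace_0)
  then show ?thesis by (simp add: trace_moment_def)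
qed

theorem trace_moment_eq_paired_moment:
  assumes M: "haar_prob N M" and Q: "0 \<notin># Q" "(\<Sum>a\<in>#Q. \<bar>a\<bar>) \<le> 2 * int N"
  shows "trace_moment N M Q = paired_moment Q"
proof (rule loop_equation_unique[OF _ _ _ _ Q])
  interpret prob_space M using haar_prob_simps(1)[OF M] .
  show "trace_moment N M {#} = 1" by (simp add: trace_moment_def prob_space)
qed (simp_all add: trace_moment_add_0[OF M] trace_moment_unbalanced[OF M] haar_loop_equation[OF M])

text \<open>Q is an accumulator: each induction step moves one factor of the power into the
  monomial.\<close>

lemma trace_polynomial_iterated:
  assumes M: "haar_prob N M"
  shows "integrable M (\<lambda>U. trace_monomial N Q U * (\<Sum>k\<in>I. a k * power_trace N k U) ^ j) \<and>
    (LINT U|M. trace_monomial N Q U * (\<Sum>k\<in>I. a k * power_trace N k U) ^ j)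
    = iterated_moment (trace_moment N M) I a j Q"
proof (induction j arbitrary: Q)
  case 0
  then show ?case using integrable_trace_monomial[OF M] by (simp add: trace_moment_def)
next
  case (Suc j)
  have *: "trace_monomial N Q U * (\<Sum>k\<in>I. a k * power_trace N k U) ^ Suc j
     = (\<Sum>k\<in>I. a k * (trace_monomial N (add_mset k Q) U * (\<Sum>k\<in>I. a k * power_trace N k U) ^ j))" for U
  proof -
    have "trace_monomial N Q U * (\<Sum>k\<in>I. a k * power_trace N k U) ^ Suc j
      = (\<Sum>k\<in>I. a k * power_trace N k U) * (trace_monomial N Q U * (\<Sum>k\<in>I. a k * power_trace N k U) ^ j)"
      by simp
    also have "\<dots> = (\<Sum>k\<in>I. a k * (trace_monomial N (add_mset k Q) U * (\<Sum>k\<in>I. a k * power_trace N k U) ^ j))"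
      unfolding sum_distrib_right by (intro sum.cong) auto
    finally show ?thesis .
  qed
  show ?case unfolding * using Suc.IH by (simp add: Bochner_Integration.integral_sum del: trace_monomial_add)
qed

theorem trace_polynomial_moments:
  assumes M: "haar_prob N M" and I: "finite I" "\<And>k. k \<in> I \<Longrightarrow> k \<noteq> 0 \<and> - k \<in> I"
    and B: "\<And>k. k \<in> I \<Longrightarrow> \<bar>k\<bar> * int m \<le> 2 * int N" and m: "m > 0"
  shows "(LINT U|M. (\<Sum>k\<in>I. a k * power_trace N k U) ^ m) =
    (if odd m then 0 else fact m / (2 ^ (m div 2) * fact (m div 2)) * (\<Sum>k\<in>I. of_int \<bar>k\<bar> * a k * a (- k)) ^ (m div 2))"
proof -
  \<comment> \<open>Indices are integers, so rounding 2N / m down excludes none of them, and m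
    indices of size at most R still have total at most 2N.\<close>
  define R where "R = 2 * int N div int m"
  have R: "\<bar>k\<bar> \<le> R" if "k \<in> I" for k
    using B[OF that] m by (simp add: R_def zdiv_mono1 flip: zle_iff_zadd) (metis B int_ops(1) nonzero_mult_div_cancel_right of_nat_0_less_iff order_less_irrefl that zdiv_mono1)
  have "int m * R \<le> 2 * int N"
    using m by (simp add: R_def mult.commute minus_mod_eq_mult_div[symmetric])
  then have "iterated_moment (trace_moment N M) I a m {#} = iterated_moment paired_moment I a m {#}"
    using trace_moment_eq_paired_moment[OF M] I(2) R
    by (intro iterated_moment_cong[where R = "2 * int N" and B = R]) auto
  then have "(LINT U|M. (\<Sum>k\<in>I. a k * power_trace N k U) ^ m) = iterated_moment paired_moment I a m {#}"
    using trace_polynomial_iterated[OF M, of "{#}" a I m] by simp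
  moreover have "iterated_moment paired_moment I a m {#} = (if odd m then 0 else
     fact m / (2 ^ (m div 2) * fact (m div 2)) * (\<Sum>k\<in>I. of_int \<bar>k\<bar> * a k * a (- k)) ^ (m div 2))"
    using iterated_paired_moment_gaussian[OF I, of a "m div 2"]
    by (cases "odd m") (simp_all del: iterated_moment.simps)
  ultimately show ?thesis by simp
qed

section \<open>Eigenvalues\<close>

lemma upper_triangular_pow_diag:
  fixes B :: "'a :: comm_ring_1 mat"
  assumes B: "B \<in> carrier_mat N N" "upper_triangular B"
  shows "upper_triangular (B ^\<^sub>m k) \<and> (\<forall>i<N. (B ^\<^sub>m k) $$ (i, i) = B $$ (i, i) ^ k)"
proof (induction k)
  case 0
  then show ?case using B by auto
next
  case (Suc k)
  have c: "B ^\<^sub>m k \<in> carrier_mat N N" using B by simp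
  have z: "(B ^\<^sub>m k) $$ (i, l) * B $$ (l, j) = 0" if "i < N" "j < N" "l < N" "j < i \<or> (i = j \<and> l \<noteq> i)" for i j l
  proof (cases "l < i")
    case True
    then show ?thesis using Suc c that by (auto simp: upper_triangular_def)
  next
    case False
    then have "j < l" using that by auto
    then show ?thesis using B that by (auto simp: upper_triangular_def)
  qed
  have "upper_triangular (B ^\<^sub>m Suc k)"
  proof
    fix i j assume "i < dim_row (B ^\<^sub>m Suc k)" "j < i"
    then have ij: "i < N" "j < N" "j < i" using B by auto
    have "(B ^\<^sub>m k * B) $$ (i, j) = (\<Sum>l<N. (B ^\<^sub>m k) $$ (i, l) * B $$ (l, j))"
      using ij B c by (intro mat_mult_index) auto
    also have "\<dots> = 0" using ij z by (intro sum.neutral) auto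
    finally show "(B ^\<^sub>m Suc k) $$ (i, j) = 0" by simp
  qed
  moreover have "(B ^\<^sub>m Suc k) $$ (i, i) = B $$ (i, i) ^ Suc k" if i: "i < N" for i
  proof -
    have "(B ^\<^sub>m k * B) $$ (i, i) = (\<Sum>l<N. (B ^\<^sub>m k) $$ (i, l) * B $$ (l, i))"
      using i B c by (intro mat_mult_index) auto
    also have "\<dots> = (\<Sum>l<N. if l = i then (B ^\<^sub>m k) $$ (i, i) * B $$ (i, i) else 0)"
      using i z by (intro sum.cong) auto
    finally show ?thesis using i Suc by simp
  qed
  ultimately show ?case by blast
qed

lemma trace_mult_commute:
  fixes A B :: "'a :: comm_ring_1 mat"
  assumes "A \<in> carrier_mat N N" "B \<in> carrier_mat N N"
  shows "(\<Sum>i<N. (A * B) $$ (i, i)) = (\<Sum>i<N. (B * A) $$ (i, i))"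
proof -
  have "(\<Sum>i<N. (A * B) $$ (i, i)) = (\<Sum>i<N. \<Sum>k<N. A $$ (i, k) * B $$ (k, i))"
    using assms by (intro sum.cong refl mat_mult_index) auto
  also have "\<dots> = (\<Sum>k<N. \<Sum>i<N. B $$ (k, i) * A $$ (i, k))"
    by (subst sum.swap) (simp add: mult.commute)
  also have "\<dots> = (\<Sum>k<N. (B * A) $$ (k, k))"
    using assms by (intro sum.cong refl mat_mult_index[symmetric]) auto
  finally show ?thesis .
qed

text \<open>In a Schur decomposition U is similar to an upper triangular B whose diagonal lists the
  roots with multiplicity. The diagonal of B^k consists of their k-th powers, and the trace is
  invariant under similarity.\<close>

lemma sum_proots_char_poly_power:
  fixes U :: "complex mat"
  assumes U: "U \<in> carrier_mat N N"
  shows "(\<Sum>z\<in>#proots (char_poly U). z ^ k) = (\<Sum>i<N. (U ^\<^sub>m k) $$ (i, i))"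
proof -
  obtain es where es: "char_poly U = (\<Prod>e\<leftarrow>es. [:- e, 1:])" "length es = N"
    using char_poly_factorized[OF U] by blast
  obtain B P Q where "schur_decomposition U es = (B, P, Q)" by (cases "schur_decomposition U es")
  from schur_decomposition[OF U es(1) this]
  have wit: "similar_mat_wit U B P Q" and B: "upper_triangular B" "diag_mat B = es" by auto
  note w = similar_mat_witD2[OF U wit]
  have "proots (char_poly U) = mset es"
    unfolding es(1)
  proof (induction es)
    case (Cons e es)
    have "(\<Prod>e\<leftarrow>es. [:- e, 1:]) \<noteq> (0 :: complex poly)" by (auto simp: prod_list_zero_iff)
    then have "proots ([:- e, 1:] * (\<Prod>e\<leftarrow>es. [:- e, 1:])) = proots [:- e, 1:] + proots (\<Prod>e\<leftarrow>es. [:- e, 1:])"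
      by (intro proots_mult) auto
    then show ?case by (simp only: list.map prod_list.Cons proots_linear_factor Cons.IH) simp
  qed simp
  then have "(\<Sum>z\<in>#proots (char_poly U). z ^ k) = (\<Sum>e\<leftarrow>es. e ^ k)"
    by (simp add: sum_mset_sum_list flip: mset_map)
  also have "\<dots> = (\<Sum>i<N. B $$ (i, i) ^ k)"
    unfolding B(2)[symmetric] diag_mat_def using w(5)
    by (simp add: interv_sum_list_conv_sum_set_nat atLeast0LessThan)
  also have "\<dots> = (\<Sum>i<N. (B ^\<^sub>m k) $$ (i, i))"
    using upper_triangular_pow_diag[OF w(5) B(1)] by simp
  also have "\<dots> = (\<Sum>i<N. ((Q * P) * B ^\<^sub>m k) $$ (i, i))"
    using w left_mult_one_mat[OF pow_carrier_mat[OF w(5)]] by simp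
  also have "\<dots> = (\<Sum>i<N. (Q * (P * B ^\<^sub>m k)) $$ (i, i))"
    by (simp only: assoc_mult_mat[OF w(7) w(6) pow_carrier_mat[OF w(5)]])
  also have "\<dots> = (\<Sum>i<N. (P * B ^\<^sub>m k * Q) $$ (i, i))"
    using w by (intro trace_mult_commute) auto
  also have "P * B ^\<^sub>m k * Q = U ^\<^sub>m k"
    using similar_mat_wit_pow_id[OF wit] by simp
  finally show ?thesis .
qed

lemma size_proots_char_poly: "U \<in> carrier_mat N N \<Longrightarrow> size (proots (char_poly U)) = N" for U :: "complex mat"
  using degree_monic_char_poly[of U N] by (simp add: size_proots_complex)

text \<open>For an eigenvector v, |z|^2 |v|^2 = |U v|^2 = |v|^2, and v is not 0.\<close>

lemma unitary_eigenvalue_norm: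
  assumes U: "U \<in> unitary_group N" and z: "z \<in># proots (char_poly U)"
  shows "norm z = 1"
proof -
  note c = unitary_group_carrier[OF U]
  have "char_poly U \<noteq> 0" using degree_monic_char_poly[OF c] by auto
  then have "eigenvalue U z" using z eigenvalue_root_char_poly[OF c] by simp
  then obtain v where v: "v \<in> carrier_vec N" "v \<noteq> 0\<^sub>v N" "U *\<^sub>v v = z \<cdot>\<^sub>v v"
    using c by (auto simp: eigenvalue_def eigenvector_def)
  have Uv: "(\<Sum>k<N. U $$ (i, k) * v $ k) = z * v $ i" if "i < N" for i
  proof -
    have "(U *\<^sub>v v) $ i = (\<Sum>k<N. U $$ (i, k) * v $ k)"
      using that c v(1) by (auto simp: scalar_prod_def atLeast0LessThan)
    then show ?thesis using v that by simp
  qed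
  have UU: "(\<Sum>i<N. cnj (U $$ (i, k)) * U $$ (i, l)) = (if k = l then 1 else 0)" if "k < N" "l < N" for k l
  proof -
    have "(mat_adjoint U * U) $$ (k, l) = (\<Sum>i<N. cnj (U $$ (i, k)) * U $$ (i, l))"
      using that c mat_adjoint_carrier[OF c] by (subst mat_mult_index[where N = N]) (auto simp: mat_adjoint_index)
    then show ?thesis using unitary_left_inverse[OF U] that by simp
  qed
  define s where "s = (\<Sum>i<N. (norm (v $ i))\<^sup>2)"
  have "complex_of_real ((norm z)\<^sup>2 * s) = (\<Sum>i<N. cnj (z * v $ i) * (z * v $ i))"
    unfolding s_def by (simp add: sum_distrib_left complex_norm_square mult_ac del: of_real_power)
  also have "\<dots> = (\<Sum>i<N. (\<Sum>k<N. cnj (U $$ (i, k)) * cnj (v $ k)) * (\<Sum>l<N. U $$ (i, l) * v $ l))"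
    using Uv by (intro sum.cong refl) (simp flip: complex_cnj_mult cnj_sum)
  also have "\<dots> = (\<Sum>i<N. \<Sum>k<N. \<Sum>l<N. cnj (v $ k) * v $ l * (cnj (U $$ (i, k)) * U $$ (i, l)))"
    unfolding sum_product by (intro sum.cong refl) (simp add: mult_ac)
  also have "\<dots> = (\<Sum>k<N. \<Sum>l<N. \<Sum>i<N. cnj (v $ k) * v $ l * (cnj (U $$ (i, k)) * U $$ (i, l)))"
    by (subst sum.swap, rule sum.cong[OF refl], subst sum.swap) (rule refl)
  also have "\<dots> = (\<Sum>k<N. \<Sum>l<N. if k = l then cnj (v $ k) * v $ l else 0)"
    by (intro sum.cong refl) (simp add: UU flip: sum_distrib_left)
  also have "\<dots> = complex_of_real s"
    unfolding s_def by (simp add: complex_norm_square mult.commute del: of_real_power)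
  finally have "(norm z)\<^sup>2 * s = s" by (simp only: of_real_eq_iff)
  moreover have "s \<noteq> 0"
  proof
    assume "s = 0"
    then have "\<forall>i<N. v $ i = 0" unfolding s_def by (subst (asm) sum_nonneg_eq_0_iff) auto
    then have "v = 0\<^sub>v N" using v(1) by (intro eq_vecI) auto
    then show False using v(2) by simp
  qed
  ultimately have "(norm z)\<^sup>2 = 1" by simp
  then show ?thesis by (simp add: power2_eq_1_iff) (smt (verit) norm_ge_zero)
qed

text \<open>On the unit circle the inverse is the conjugate, which matches the convention for
  negative powers in \<open>unitary_power_entry\<close>.\<close>

lemma sum_eigenvalues_power_int:
  assumes U: "U \<in> unitary_group N"
  shows "(\<Sum>z\<in>#proots (char_poly U). z powi k) = power_trace N k U"
proof (cases "0 \<le> k")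
  case True
  then show ?thesis using sum_proots_char_poly_power[OF unitary_group_carrier[OF U], of "nat k"]
    by (simp add: power_int_def power_trace_def unitary_power_entry_def)
next
  case False
  have "(\<Sum>z\<in>#proots (char_poly U). z powi k) = (\<Sum>z\<in>#proots (char_poly U). cnj (z ^ nat (- k)))"
  proof (intro arg_cong[of _ _ sum_mset] image_mset_cong)
    fix z assume "z \<in># proots (char_poly U)"
    then have "cnj z = inverse z"
      using unitary_eigenvalue_norm[OF U] by (simp add: divide_conv_cnj inverse_eq_divide)
    then show "z powi k = cnj (z ^ nat (- k))" using False by (simp add: power_int_def)
  qed
  also have "\<dots> = cnj (\<Sum>z\<in>#proots (char_poly U). z ^ nat (- k))"
  proof -
    have "(\<Sum>z\<in>#S. cnj (z ^ nat (- k))) = cnj (\<Sum>z\<in>#S. z ^ nat (- k))" for S by (induction S) auto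
    then show ?thesis by blast
  qed
  finally show ?thesis using False sum_proots_char_poly_power[OF unitary_group_carrier[OF U], of "nat (- k)"]
    by (simp add: power_trace_def unitary_power_entry_def)
qed

section \<open>Fourier analysis on the circle\<close>

text \<open>Normalized arc length on the unit circle, as a Borel measure on the whole plane, so that
  functions of eigenvalues need not be restricted to the circle.\<close>

definition circle_measure :: "complex measure" where
  "circle_measure = distr (density lborel (\<lambda>\<theta>. ennreal (indicator {-pi..pi} \<theta> / (2 * pi)))) borel cis"

lemma measurable_cis [measurable]: "cis \<in> borel_measurable borel"
  by (intro borel_measurable_continuous_onI continuous_intros)

lemma sets_circle_measure [simp, measurable_cong]: "sets circle_measure = sets borel"
  by (simp add: circle_measure_def)

lemma space_circle_measure [simp]: "space circle_measure = UNIV"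
  by (simp add: circle_measure_def)

lemma integral_circle_measure:
  fixes g :: "complex \<Rightarrow> complex"
  assumes [measurable]: "g \<in> borel_measurable borel"
  shows "(LINT z|circle_measure. g z) = (LINT \<theta>|lborel. indicator {-pi..pi} \<theta> *\<^sub>R g (cis \<theta>)) / (2 * pi)"
proof -
  have "(LINT z|circle_measure. g z) = (LINT \<theta>|lborel. (indicator {-pi..pi} \<theta> / (2 * pi)) *\<^sub>R g (cis \<theta>))"
    unfolding circle_measure_def by (simp add: integral_distr integral_density)
  also have "\<dots> = (LINT \<theta>|lborel. (indicator {-pi..pi} \<theta> *\<^sub>R g (cis \<theta>)) / (2 * pi))"
    by (simp add: scaleR_conv_of_real)
  finally show ?thesis by simp
qed

interpretation circle: prob_space circle_measure
proof
  have "emeasure circle_measure (space circle_measure)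
     = (\<integral>\<^sup>+ \<theta>. ennreal (1 / (2 * pi)) * indicator {-pi..pi} \<theta> \<partial>lborel)"
    by (simp add: circle_measure_def emeasure_distr emeasure_density)
      (intro nn_integral_cong, auto split: split_indicator)
  also have "\<dots> = ennreal (1 / (2 * pi)) * ennreal (2 * pi)"
    by (subst nn_integral_cmult_indicator) (auto simp: pi_ge_zero)
  also have "\<dots> = 1" by (subst ennreal_mult[symmetric]) auto
  finally show "emeasure circle_measure (space circle_measure) = 1" .
qed

lemma AE_circle_norm: "AE z in circle_measure. norm z = 1"
  unfolding circle_measure_def by (subst AE_distr_iff) auto

lemma integral_circle_power_int:
  "(LINT z|circle_measure. z powi k) = (if k = 0 then 1 else 0)"
proof (cases "k = 0")
  case True
  then show ?thesis by (simp add: circle.prob_space[simplified])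
next
  case False
  have m: "(\<lambda>z :: complex. z powi k) \<in> borel_measurable borel"
    by (cases "0 \<le> k") (simp_all add: power_int_def)
  have cis_powi: "cis \<theta> powi k = cis (of_int k * \<theta>)" for \<theta>
    by (rule cis_power_int)
  have "(LINT \<theta>|lborel. indicator {-pi..pi} \<theta> *\<^sub>R cis (of_int k * \<theta>))
     = cis (of_int k * pi) / (\<i> * of_int k) - cis (of_int k * (- pi)) / (\<i> * of_int k)"
  proof (rule integral_FTC_Icc)
    show "((\<lambda>\<theta>. cis (of_int k * \<theta>) / (\<i> * of_int k)) has_vector_derivative cis (of_int k * x)) (at x within {-pi..pi})" for x
      using False unfolding cis_conv_exp
      by (auto intro!: derivative_eq_intros has_vector_derivative_real_field simp: field_simps)
    show "continuous_on {-pi..pi} (\<lambda>\<theta>. cis (of_int k * \<theta>))" by (intro continuous_intros)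
  qed (use pi_ge_zero in linarith)
  also have "cis (of_int k * pi) = cis (of_int k * (- pi))"
    using sin_npi_int[of k] by (simp add: complex_eq_iff mult.commute)
  finally show ?thesis using False by (subst integral_circle_measure[OF m]) (simp add: cis_powi)
qed

section \<open>Laurent polynomials on the unit circle\<close>

inductive laurent :: "(complex \<Rightarrow> complex) \<Rightarrow> bool" where
  monomial: "laurent (\<lambda>z. c * z powi k)"
| add: "laurent g \<Longrightarrow> laurent h \<Longrightarrow> laurent (\<lambda>z. g z + h z)"

lemma laurent_measurable: "laurent g \<Longrightarrow> g \<in> borel_measurable borel"
proof (induction rule: laurent.induct)
  case (monomial c k)
  then show ?case by (cases "0 \<le> k") (simp_all add: power_int_def)
qed simp

text \<open>Equality is claimed on the circle only: at z = 0 the exponent law for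
  \<open>powi\<close> can fail.\<close>

lemma laurent_mult:
  assumes "laurent g" "laurent h"
  shows "\<exists>f. laurent f \<and> (\<forall>z. norm z = 1 \<longrightarrow> f z = g z * h z)"
  using assms(1)
proof (induction rule: laurent.induct)
  case (monomial c k)
  show ?case using assms(2)
  proof (induction rule: laurent.induct)
    case (monomial d l)
    show ?case
    proof (intro exI[of _ "\<lambda>z. (c * d) * z powi (k + l)"] conjI allI impI)
      fix z :: complex assume "norm z = 1"
      then have "z \<noteq> 0" by auto
      then show "c * d * z powi (k + l) = c * z powi k * (d * z powi l)" by (simp add: power_int_add)
    qed (rule laurent.monomial)
  next
    case (add g h)
    then obtain f f' where "laurent f" "laurent f'" "\<forall>z. norm z = 1 \<longrightarrow> f z = c * z powi k * g z"
      "\<forall>z. norm z = 1 \<longrightarrow> f' z = c * z powi k * h z" by blast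
    then show ?case by (intro exI[of _ "\<lambda>z. f z + f' z"]) (auto intro: laurent.add simp: distrib_left)
  qed
next
  case (add g g')
  then obtain f f' where "laurent f" "laurent f'" "\<forall>z. norm z = 1 \<longrightarrow> f z = g z * h z"
    "\<forall>z. norm z = 1 \<longrightarrow> f' z = g' z * h z" by blast
  then show ?case by (intro exI[of _ "\<lambda>z. f z + f' z"]) (auto intro: laurent.add simp: distrib_right)
qed

lemma real_polynomial_laurent:
  "real_polynomial_function p \<Longrightarrow> \<exists>g. laurent g \<and> (\<forall>z. norm z = 1 \<longrightarrow> g z = of_real (p z))"
proof (induction rule: real_polynomial_function.induct)
  case (linear p)
  \<comment> \<open>On the circle Re z = (z + 1/z) / 2 and Im z = (z - 1/z) / (2 i); inserting these
    into p z = Re z * p 1 + Im z * p i gives the two coefficients below.\<close>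
  define a b where "a = complex_of_real (p 1)" and "b = complex_of_real (p \<i>)"
  have eq: "(a / 2 - \<i> * b / 2) * z powi 1 + (a / 2 + \<i> * b / 2) * z powi (- 1) = of_real (p z)" if "norm z = 1" for z
  proof -
    interpret bounded_linear p by fact
    have "z = Re z *\<^sub>R 1 + Im z *\<^sub>R \<i>" by (simp add: complex_eq_iff)
    then have "p z = Re z * p 1 + Im z * p \<i>" by (metis add scale real_scaleR_def)
    moreover have inv: "inverse z = cnj z" using that by (simp add: divide_conv_cnj inverse_eq_divide)
    moreover from inv have "z powi (- 1) = cnj z" by (simp add: power_int_def)
    moreover have "z powi 1 = z" by simp
    ultimately show ?thesis by (simp add: a_def b_def complex_eq_iff algebra_simps del: power_int_1_right power_int_minus1_right)
  qed
  then show ?case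
    using laurent.add[OF laurent.monomial[of "a / 2 - \<i> * b / 2" 1] laurent.monomial[of "a / 2 + \<i> * b / 2" "- 1"]]
    by blast
next
  case (const c)
  show ?case using laurent.monomial[of "of_real c" 0] by auto
next
  case (add p q)
  then obtain f g where "laurent f" "laurent g" "\<forall>z. norm z = 1 \<longrightarrow> f z = of_real (p z)" "\<forall>z. norm z = 1 \<longrightarrow> g z = of_real (q z)"
    by blast
  then show ?case by (intro exI[of _ "\<lambda>z. f z + g z"]) (auto intro: laurent.add)
next
  case (mult p q)
  then obtain f g where "laurent f" "laurent g" "\<forall>z. norm z = 1 \<longrightarrow> f z = of_real (p z)" "\<forall>z. norm z = 1 \<longrightarrow> g z = of_real (q z)"
    by blast
  then show ?case using laurent_mult[of f g] by auto
qed

text \<open>Stone-Weierstrass for polynomials in the two real coordinates, which restrict to Laurent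
  polynomials on the circle.\<close>

lemma laurent_approximation:
  fixes \<phi> :: "complex \<Rightarrow> real"
  assumes "continuous_on UNIV \<phi>" "e > 0"
  obtains g where "laurent g" "\<And>z. norm z = 1 \<Longrightarrow> norm (of_real (\<phi> z) - g z) < e"
proof -
  obtain p where p: "real_polynomial_function p" "\<And>z. z \<in> sphere 0 1 \<Longrightarrow> \<bar>\<phi> z - p z\<bar> < e"
    using Stone_Weierstrass_real_polynomial_function[of "sphere 0 1 :: complex set" \<phi> e]
      continuous_on_subset[OF assms(1)] assms(2) by auto
  obtain g where g: "laurent g" "\<And>z. norm z = 1 \<Longrightarrow> g z = of_real (p z)"
    using real_polynomial_laurent[OF p(1)] by blast
  have "norm (of_real (\<phi> z) - g z) < e" if "norm z = 1" for z
    using p(2)[of z] that g(2)[OF that] by (simp flip: of_real_diff)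
  with g(1) that show ?thesis by blast
qed

lemma laurent_bounded: "laurent g \<Longrightarrow> \<exists>B. \<forall>z. norm z = 1 \<longrightarrow> norm (g z) \<le> B"
proof (induction rule: laurent.induct)
  case (monomial c k)
  show ?case by (intro exI[of _ "norm c"]) (auto simp: norm_mult norm_power_int)
next
  case (add g h)
  then obtain B B' where "\<forall>z. norm z = 1 \<longrightarrow> norm (g z) \<le> B" "\<forall>z. norm z = 1 \<longrightarrow> norm (h z) \<le> B'" by blast
  then show ?case by (intro exI[of _ "B + B'"]) (auto intro: norm_triangle_mono)
qed

lemma circle_integrable_bounded:
  fixes g :: "complex \<Rightarrow> 'b :: {banach, second_countable_topology}"
  assumes "g \<in> borel_measurable borel" "\<And>z. norm z = 1 \<Longrightarrow> norm (g z) \<le> B"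
  shows "integrable circle_measure g"
  using assms AE_circle_norm by (intro circle.integrable_const_bound[of _ B]) auto

lemma laurent_integrable: "laurent g \<Longrightarrow> integrable circle_measure g"
  using laurent_bounded[of g] laurent_measurable[of g] circle_integrable_bounded by blast

text \<open>The mean eigenvalue measure is N times arc length. It suffices to test monomials: for k
  not 0 the moment is unbalanced and vanishes, as does the circle integral.\<close>

lemma laurent_eigenvalue_sum:
  assumes M: "haar_prob N M"
  shows "laurent g \<Longrightarrow> integrable M (\<lambda>U. \<Sum>z\<in>#proots (char_poly U). g z) \<and>
    (LINT U|M. (\<Sum>z\<in>#proots (char_poly U). g z)) = of_nat N * (LINT z|circle_measure. g z)"
proof (induction rule: laurent.induct)
  case (monomial c k)
  have eq: "(\<Sum>z\<in>#proots (char_poly U). c * z powi k) = c * trace_monomial N {#k#} U" if "U \<in> space M" for U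
    using that sum_eigenvalues_power_int[of U N k]
    by (simp add: haar_prob_simps(3)[OF M] flip: sum_mset_distrib_left)
  have "integrable M (\<lambda>U. \<Sum>z\<in>#proots (char_poly U). c * z powi k)"
    using integrable_mult_right[OF integrable_trace_monomial[OF M], of c "{#k#}"]
    by (simp only: Bochner_Integration.integrable_cong[OF refl eq])
  moreover have "(LINT U|M. (\<Sum>z\<in>#proots (char_poly U). c * z powi k)) = c * trace_moment N M {#k#}"
    unfolding trace_moment_def
    by (subst Bochner_Integration.integral_cong[OF refl eq]) (auto simp del: trace_monomial_add)
  moreover have "trace_moment N M {#k#} = (if k = 0 then of_nat N else 0)"
  proof (cases "k = 0")
    case True
    interpret prob_space M using haar_prob_simps(1)[OF M] .
    show ?thesis using True trace_moment_add_0[OF M, of "{#}"] by (simp add: trace_moment_def prob_space)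
  qed (simp add: trace_moment_unbalanced[OF M])
  ultimately show ?case by (simp add: integral_circle_power_int)
next
  case (add g h)
  then show ?case
    by (simp add: sum_mset.distrib laurent_integrable distrib_left)
qed

lemma norm_sum_eigenvalues_le:
  assumes U: "U \<in> unitary_group N" and "\<And>z. norm z = 1 \<Longrightarrow> norm (g z :: complex) \<le> e"
  shows "norm (\<Sum>z\<in>#proots (char_poly U). g z) \<le> real N * e"
proof -
  have "norm (\<Sum>z\<in>#S. g z) \<le> real (size S) * e" if "\<And>z. z \<in># S \<Longrightarrow> norm z = 1" for S
    using that
  proof (induction S)
    case (add z S)
    then have "norm (g z + (\<Sum>z\<in>#S. g z)) \<le> e + real (size S) * e"
      using assms(2) by (intro norm_triangle_mono) auto
    then show ?case by (simp add: algebra_simps)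
  qed simp
  from this[of "proots (char_poly U)"] show ?thesis
    using unitary_eigenvalue_norm[OF U] size_proots_char_poly[OF unitary_group_carrier[OF U]] by simp
qed

text \<open>Uniform approximation by Laurent polynomials yields the mean. The same limit yields
  measurability, since for a Laurent polynomial the sum over the spectrum is a combination of power
  traces.\<close>

lemma continuous_eigenvalue_sum:
  fixes \<phi> :: "complex \<Rightarrow> real"
  assumes M: "haar_prob N M" and \<phi>: "continuous_on UNIV \<phi>"
  shows "integrable M (\<lambda>U. \<Sum>z\<in>#proots (char_poly U). complex_of_real (\<phi> z))" (is "integrable M ?S")
    and "(LINT U|M. (\<Sum>z\<in>#proots (char_poly U). complex_of_real (\<phi> z)))
      = of_nat N * (LINT z|circle_measure. complex_of_real (\<phi> z))"
proof -
  interpret prob_space M using haar_prob_simps(1)[OF M] .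
  have \<phi>m: "(\<lambda>z. complex_of_real (\<phi> z)) \<in> borel_measurable borel"
    using \<phi> by (intro borel_measurable_continuous_onI continuous_intros)
  obtain B where B: "\<And>z. norm z = 1 \<Longrightarrow> norm (\<phi> z) \<le> B"
  proof -
    have "compact (\<phi> ` sphere 0 1)" using \<phi> by (intro compact_continuous_image continuous_on_subset[OF \<phi>]) auto
    then show ?thesis using that compact_imp_bounded bounded_iff by (metis imageI mem_sphere_0)
  qed
  have \<phi>i: "integrable circle_measure (\<lambda>z. complex_of_real (\<phi> z))"
    using B by (intro circle_integrable_bounded[OF \<phi>m, of B]) auto
  have "\<forall>n. \<exists>g. laurent g \<and> (\<forall>z. norm z = 1 \<longrightarrow> norm (of_real (\<phi> z) - g z) < 1 / real (Suc n))"
    using laurent_approximation[OF \<phi>] by (metis of_nat_0_less_iff zero_less_Suc zero_less_divide_1_iff)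
  then obtain g where g: "\<And>n. laurent (g n)"
    "\<And>n z. norm z = 1 \<Longrightarrow> norm (of_real (\<phi> z) - g n z) < 1 / real (Suc n)" by metis
  have diff: "norm (?S U - (\<Sum>z\<in>#proots (char_poly U). g n z)) \<le> real N * (1 / real (Suc n))" if "U \<in> space M" for U n
  proof -
    have "norm (\<Sum>z\<in>#proots (char_poly U). of_real (\<phi> z) - g n z) \<le> real N * (1 / real (Suc n))"
      using that g(2) by (intro norm_sum_eigenvalues_le) (auto simp: haar_prob_simps(3)[OF M] intro: less_imp_le)
    then show ?thesis by (simp only: sum_mset_subtract)
  qed
  have lim0: "(\<lambda>n. real N * (1 / real (Suc n))) \<longlonglongrightarrow> 0"
    using tendsto_mult_right[OF LIMSEQ_Suc[OF lim_1_over_n], of "real N"] by simp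
  have meas: "?S \<in> borel_measurable M"
  proof (rule borel_measurable_LIMSEQ_metric)
    show "(\<lambda>U. \<Sum>z\<in>#proots (char_poly U). g n z) \<in> borel_measurable M" for n
      using laurent_eigenvalue_sum[OF M g(1)] by (auto dest: borel_measurable_integrable)
    fix U assume U: "U \<in> space M"
    have "(\<lambda>n. ?S U - (\<Sum>z\<in>#proots (char_poly U). g n z)) \<longlonglongrightarrow> 0"
      by (rule Lim_null_comparison[OF always_eventually lim0]) (use diff[OF U] in auto)
    then show "(\<lambda>n. \<Sum>z\<in>#proots (char_poly U). g n z) \<longlonglongrightarrow> ?S U"
      using tendsto_diff[OF tendsto_const[of "?S U"]] by fastforce
  qed
  show int: "integrable M ?S"
    using B meas by (intro integrable_const_bound[of _ "real N * B"] AE_I2 norm_sum_eigenvalues_le)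
      (auto simp: haar_prob_simps(3)[OF M])
  \<comment> \<open>Replacing the function by \<open>g n\<close> costs N / (n + 1) on the Haar side
    and as much on the circle side, where the integral carries the factor N.\<close>
  have "norm ((LINT U|M. ?S U) - of_nat N * (LINT z|circle_measure. complex_of_real (\<phi> z)))
     \<le> real N * (1 / real (Suc n)) + real N * (1 / real (Suc n))" for n
  proof -
    note L = laurent_eigenvalue_sum[OF M g(1)[of n]]
    note Li = laurent_integrable[OF g(1)[of n]]
    have "norm (LINT U|M. ?S U - (\<Sum>z\<in>#proots (char_poly U). g n z)) \<le> (LINT U|M. real N * (1 / real (Suc n)))"
      using int L diff by (intro order.trans[OF integral_norm_bound integral_mono]) auto
    moreover have "norm (LINT z|circle_measure. g n z - of_real (\<phi> z)) \<le> (LINT z|circle_measure. 1 / real (Suc n))"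
      using Li \<phi>i AE_circle_norm g(2)
      by (intro order.trans[OF integral_norm_bound integral_mono_AE]) (auto simp: norm_minus_commute intro: less_imp_le)
    ultimately have "norm ((LINT U|M. ?S U) - (LINT U|M. (\<Sum>z\<in>#proots (char_poly U). g n z))) \<le> real N * (1 / real (Suc n))"
      "norm (of_nat N * ((LINT z|circle_measure. g n z) - (LINT z|circle_measure. complex_of_real (\<phi> z)))) \<le> real N * (1 / real (Suc n))"
      using int L Li \<phi>i mult_left_mono[of _ _ "real N"]
      by (auto simp: prob_space circle.prob_space[simplified] norm_mult divide_inverse simp del: of_nat_Suc)
    then show ?thesis using L norm_triangle_mono by (fastforce simp: algebra_simps)
  qed
  moreover have "(\<lambda>n. real N * (1 / real (Suc n)) + real N * (1 / real (Suc n))) \<longlonglongrightarrow> 0"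
    using tendsto_add[OF lim0 lim0] by simp
  ultimately have "norm ((LINT U|M. ?S U) - of_nat N * (LINT z|circle_measure. complex_of_real (\<phi> z))) \<le> 0"
    by (intro LIMSEQ_le_const) auto
  then show "(LINT U|M. ?S U) = of_nat N * (LINT z|circle_measure. complex_of_real (\<phi> z))" by simp
qed

text \<open>
  The indicator of an open set is an increasing limit of continuous functions, for which the eigenvalue
  sums are measurable and have the right mean; measurability of eigenvalues themselves is not needed.
\<close>
lemma eigenvalue_in_open_set:
  assumes M: "haar_prob N M" and O: "open S" and small: "measure circle_measure S \<le> e"
  shows "{U \<in> space M. \<exists>z\<in>#proots (char_poly U). z \<in> S} \<in> sets M \<and>
    measure M {U \<in> space M. \<exists>z\<in>#proots (char_poly U). z \<in> S} \<le> real N * e"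
\<comment> \<open>By convention \<open>infdist\<close> to the empty set is 0, so the cut-off
  functions of the other case would vanish for S = UNIV.\<close>
proof (cases "S = UNIV")
  case True
  interpret prob_space M using haar_prob_simps(1)[OF M] .
  have ex: "\<exists>z. z \<in># proots (char_poly U)" if "U \<in> unitary_group N" "N > 0" for U
    using size_proots_char_poly[OF unitary_group_carrier[OF that(1)]] that(2)
    by (cases "proots (char_poly U)") auto
  have "{U \<in> space M. \<exists>z\<in>#proots (char_poly U). z \<in> S} = (if N = 0 then {} else space M)"
    using size_proots_char_poly[OF unitary_group_carrier, of _ N] True
    using ex by (auto simp: haar_prob_simps(3)[OF M])
  moreover have "e \<ge> 1" using small True circle.prob_space by simp
  ultimately show ?thesis using mult_mono[of 1 "real N" 1 e] by (auto simp: prob_space)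
next
  case False
  interpret prob_space M using haar_prob_simps(1)[OF M] .
  define \<phi> where "\<phi> n z = min 1 (real n * infdist z (- S))" for n :: nat and z
  define X where "X n U = (\<Sum>z\<in>#proots (char_poly U). \<phi> n z)" for n U
  have cont: "continuous_on UNIV (\<phi> n)" for n unfolding \<phi>_def by (intro continuous_intros)
  have \<phi>01: "0 \<le> \<phi> n z" "\<phi> n z \<le> indicator S z" for n z
    using infdist_nonneg[of z "- S"] by (auto simp: \<phi>_def indicator_def)
  have \<phi>1: "\<exists>n0. \<forall>n\<ge>n0. \<phi> n z = 1" if "z \<in> S" for z
  proof -
    have "infdist z (- S) > 0"
      using in_closed_iff_infdist_zero[of "- S" z] O False that infdist_nonneg[of z "- S"] by (auto simp: closed_def less_le)
    obtain n0 :: nat where "1 / infdist z (- S) < n0" using reals_Archimedean2 by blast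
    have "1 \<le> real n * infdist z (- S)" if "n \<ge> n0" for n
      proof -
      have "1 \<le> real n0 * infdist z (- S)" using \<open>infdist z (- S) > 0\<close> \<open>1 / infdist z (- S) < n0\<close> by (simp add: divide_less_eq)
      also have "\<dots> \<le> real n * infdist z (- S)" using that by (intro mult_right_mono infdist_nonneg) auto
      finally show ?thesis .
    qed
    then have "\<forall>n\<ge>n0. \<phi> n z = 1" by (auto simp: \<phi>_def min_def)
    then show ?thesis by blast
  qed
  have X_of_real: "complex_of_real (X n U) = (\<Sum>z\<in>#proots (char_poly U). complex_of_real (\<phi> n z))" for n U
  proof -
    have "complex_of_real (\<Sum>z\<in>#R. \<phi> n z) = (\<Sum>z\<in>#R. complex_of_real (\<phi> n z))" for R
      by (induction R) auto
    then show ?thesis by (simp add: X_def)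
  qed
  have int: "integrable M (X n)" for n
    using continuous_eigenvalue_sum(1)[OF M cont[of n]] unfolding X_of_real[symmetric] by (simp only: complex_of_real_integrable_eq)
  have "complex_of_real (LINT U|M. X n U) = complex_of_real (real N * (LINT z|circle_measure. \<phi> n z))" for n
    using continuous_eigenvalue_sum(2)[OF M cont[of n]] unfolding X_of_real[symmetric] by simp
  then have X_int: "(LINT U|M. X n U) = real N * (LINT z|circle_measure. \<phi> n z)" for n by (simp only: of_real_eq_iff)
  have X_le: "(LINT U|M. X n U) \<le> real N * e" for n
  proof -
    have "(LINT z|circle_measure. \<phi> n z) \<le> (LINT z|circle_measure. indicator S z)"
    proof (rule integral_mono)
      have [measurable]: "\<phi> n \<in> borel_measurable borel" "S \<in> sets borel"
        using borel_measurable_continuous_onI[OF cont[of n]] borel_open[OF O] by auto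
      have le1: "\<phi> n z \<le> 1" for z by (simp add: \<phi>_def)
      show "integrable circle_measure (\<phi> n)"
        using \<phi>01(1) le1 by (intro circle_integrable_bounded[of _ 1]) auto
      show "integrable circle_measure (indicator S :: complex \<Rightarrow> real)"
        by (intro circle_integrable_bounded[of _ 1]) (auto simp: indicator_def)
    qed (rule \<phi>01)
    also have "\<dots> \<le> e" using small O by simp
    finally show ?thesis unfolding X_int by (intro mult_left_mono) auto
  qed
  \<comment> \<open>If some eigenvalue lies in S, then X n U >= 1 for large n; if none does, X n U =
    0 for all n. So the event is the increasing union of the A n, each bounded by Markov's
    inequality.\<close>
  define A where "A n = {U \<in> space M. 1 \<le> X n U}" for n
  have A_sets: "A n \<in> sets M" for n unfolding A_def using borel_measurable_integrable[OF int[of n]] by measurable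
  have A_le: "measure M (A n) \<le> real N * e" for n
  proof -
    have "measure M (A n) \<le> (LINT U|M. X n U) / 1"
      unfolding A_def
    proof (rule integral_Markov_inequality_measure)
      have "0 \<le> (\<Sum>z\<in>#R. \<phi> n z)" for R using \<phi>01(1) by (induction R) auto
      then show "AE U in M. 0 \<le> X n U" unfolding X_def by auto
    qed ((rule int sets.empty_sets)+, simp)
    then show ?thesis using X_le[of n] by simp
  qed
  have X_ge: "X n U \<ge> \<phi> n z" if zin: "z \<in># proots (char_poly U)" for n U z
  proof -
    obtain R where R: "proots (char_poly U) = add_mset z R" using zin by (metis insert_DiffM)
    have "0 \<le> (\<Sum>z\<in>#Q. \<phi> n z)" for Q using \<phi>01(1) by (induction Q) auto
    from this[of R] show ?thesis by (simp add: X_def R)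
  qed
  have inc: "incseq A"
  proof (rule incseq_SucI, rule subsetI)
    fix n U assume "U \<in> A n"
    have "\<phi> n z \<le> \<phi> (Suc n) z" for z
      unfolding \<phi>_def using infdist_nonneg[of z "- S"] by (intro min.mono) (auto intro!: mult_right_mono)
    then have "(\<Sum>z\<in>#R. \<phi> n z) \<le> (\<Sum>z\<in>#R. \<phi> (Suc n) z)" for R by (induction R) (auto intro: add_mono)
    then have "X n U \<le> X (Suc n) U" unfolding X_def by blast
    with \<open>U \<in> A n\<close> show "U \<in> A (Suc n)" by (auto simp: A_def)
  qed
  have eq: "{U \<in> space M. \<exists>z\<in>#proots (char_poly U). z \<in> S} = (\<Union>n. A n)"
  proof (intro equalityI subsetI)
    fix U assume "U \<in> {U \<in> space M. \<exists>z\<in>#proots (char_poly U). z \<in> S}"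
    then obtain z where z: "U \<in> space M" "z \<in># proots (char_poly U)" "z \<in> S" by blast
    obtain n where "\<phi> n z = 1" using \<phi>1[OF z(3)] by blast
    with z show "U \<in> (\<Union>n. A n)" using X_ge[of z U n] by (auto simp: A_def)
  next
    fix U assume "U \<in> (\<Union>n. A n)"
    then obtain n where U: "U \<in> space M" "1 \<le> X n U" by (auto simp: A_def)
    have "\<exists>z\<in>#proots (char_poly U). z \<in> S"
    proof (rule ccontr)
      assume "\<not> ?thesis"
      then have "\<forall>z\<in>#proots (char_poly U). \<phi> n z = 0"
        using \<phi>01 by (metis indicator_simps(2) order_antisym_conv)
      then have "X n U = 0" unfolding X_def by (intro sum_mset.neutral) auto
      with U(2) show False by simp
    qed
    with U(1) show "U \<in> {U \<in> space M. \<exists>z\<in>#proots (char_poly U). z \<in> S}" by blast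
  qed
  have "(\<lambda>n. measure M (A n)) \<longlonglongrightarrow> measure M (\<Union>n. A n)"
    using A_sets inc by (intro finite_Lim_measure_incseq) auto
  then have "measure M (\<Union>n. A n) \<le> real N * e"
    using A_le by (intro LIMSEQ_le_const2) auto
  then show ?thesis unfolding eq using A_sets by auto
qed

text \<open>Outer regularity encloses A in open sets of arbitrarily small measure. Working with
  these gives measurable events, and their intersection is the exceptional null set.\<close>

lemma eigenvalues_avoid_null_set:
  assumes M: "haar_prob N M" and A: "A \<in> null_sets circle_measure"
  shows "\<exists>Z\<in>null_sets M. \<forall>U\<in>space M - Z. \<forall>z\<in>#proots (char_poly U). z \<notin> A"
proof -
  interpret prob_space M using haar_prob_simps(1)[OF M] .
  have "\<exists>S. A \<subseteq> S \<and> open S \<and> measure circle_measure S \<le> 1 / real (Suc n)" for n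
  proof -
    have "(INF S \<in> {S. A \<subseteq> S \<and> open S}. emeasure circle_measure S) = 0"
      using outer_regular[of circle_measure A] circle.emeasure_space_1 null_setsD1[OF A] null_setsD2[OF A] by auto
    then have "(INF S \<in> {S. A \<subseteq> S \<and> open S}. emeasure circle_measure S) < ennreal (1 / real (Suc n))" by simp
    then obtain S where "A \<subseteq> S" "open S" "emeasure circle_measure S < ennreal (1 / real (Suc n))"
      unfolding INF_less_iff by blast
    then show ?thesis by (auto simp: circle.emeasure_eq_measure ennreal_less_iff intro!: exI[of _ S])
  qed
  then obtain S where S: "\<And>n. A \<subseteq> S n" "\<And>n. open (S n)" "\<And>n. measure circle_measure (S n) \<le> 1 / real (Suc n)"
    by metis
  define B where "B n = {U \<in> space M. \<exists>z\<in>#proots (char_poly U). z \<in> S n}" for n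
  have B: "B n \<in> sets M" "measure M (B n) \<le> real N * (1 / real (Suc n))" for n
    using eigenvalue_in_open_set[OF M S(2) S(3), of n, folded B_def] by (rule conjunct1, rule conjunct2)
  have sets: "(\<Inter>n. B n) \<in> sets M" using B(1) by auto
  have "measure M (\<Inter>n. B n) \<le> real N * (1 / real (Suc n))" for n
    by (rule order.trans[OF finite_measure_mono[OF _ B(1)] B(2)]) blast
  moreover have "(\<lambda>n. real N * (1 / real (Suc n))) \<longlonglongrightarrow> 0"
    using tendsto_mult_right[OF LIMSEQ_Suc[OF lim_1_over_n], of "real N"] by simp
  ultimately have "measure M (\<Inter>n. B n) \<le> 0" by (intro LIMSEQ_le_const) auto
  then have "(\<Inter>n. B n) \<in> null_sets M"
    using sets by (auto simp: null_sets_def emeasure_eq_measure ennreal_eq_0_iff)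
  moreover have "\<forall>U\<in>space M - (\<Inter>n. B n). \<forall>z\<in>#proots (char_poly U). z \<notin> A"
    using S(1) unfolding B_def by blast
  ultimately show ?thesis by blast
qed

text \<open>D is orthogonal to Laurent polynomials, hence by uniform approximation to continuous
  functions, hence by dominated convergence to indicators of closed sets. A Dynkin argument extends
  this to Borel sets, so D has zero integral over each of them.\<close>

lemma circle_fourier_uniqueness:
  fixes D :: "complex \<Rightarrow> complex"
  assumes D: "integrable circle_measure D" and coeff: "\<And>k. (LINT z|circle_measure. D z * z powi k) = 0"
  shows "AE z in circle_measure. D z = 0"
proof (rule circle.density_zero[OF D])
  have Dm: "D \<in> borel_measurable borel" using borel_measurable_integrable[OF D] by (simp cong: measurable_cong_sets)
  have int_mult: "integrable circle_measure (\<lambda>z. D z * g z)"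
    if g: "g \<in> borel_measurable borel" "\<And>z. norm z = 1 \<Longrightarrow> norm (g z) \<le> B" for g B
  proof (rule Bochner_Integration.integrable_bound)
    show "integrable circle_measure (\<lambda>z. B * norm (D z))" using D by simp
    show "AE z in circle_measure. norm (D z * g z) \<le> norm (B * norm (D z))"
      using AE_circle_norm
    proof eventually_elim
      case (elim z)
      have "norm (D z) * norm (g z) \<le> norm (D z) * \<bar>B\<bar>" using g(2)[OF elim] by (intro mult_left_mono) auto
      then show ?case by (simp add: norm_mult abs_mult mult.commute)
    qed
  qed (use Dm g in simp)
  have laurent0: "(LINT z|circle_measure. D z * g z) = 0" if "laurent g" for g
    using that
  proof (induction rule: laurent.induct)
    case (monomial c k)
    have "(LINT z|circle_measure. D z * (c * z powi k)) = c * (LINT z|circle_measure. D z * z powi k)"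
      by (simp add: mult.left_commute)
    then show ?case by (simp add: coeff)
  next
    case (add g h)
    have "integrable circle_measure (\<lambda>z. D z * f z)" if "laurent f" for f
      using laurent_bounded[OF that] laurent_measurable[OF that] int_mult by blast
    with add show ?case by (simp add: distrib_left)
  qed
  have cont0: "(LINT z|circle_measure. D z * of_real (\<phi> z)) = 0" if \<phi>: "continuous_on UNIV \<phi>" "\<And>z. \<bar>\<phi> z\<bar> \<le> 1" for \<phi> :: "complex \<Rightarrow> real"
  proof -
    have \<phi>m: "(\<lambda>z. complex_of_real (\<phi> z)) \<in> borel_measurable borel"
      using \<phi>(1) by (intro borel_measurable_continuous_onI continuous_intros)
    have i: "integrable circle_measure (\<lambda>z. D z * of_real (\<phi> z))"
      using \<phi>(2) by (intro int_mult[OF \<phi>m, of 1]) auto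
    have "norm (LINT z|circle_measure. D z * of_real (\<phi> z)) \<le> (LINT z|circle_measure. norm (D z)) * e" if e: "e > 0" for e
    proof -
      obtain g where g: "laurent g" "\<And>z. norm z = 1 \<Longrightarrow> norm (of_real (\<phi> z) - g z) < e"
        using laurent_approximation[OF \<phi>(1) e] by blast
      have ig: "integrable circle_measure (\<lambda>z. D z * g z)"
        using laurent_bounded[OF g(1)] laurent_measurable[OF g(1)] int_mult by blast
      have "(LINT z|circle_measure. D z * of_real (\<phi> z)) = (LINT z|circle_measure. D z * of_real (\<phi> z) - D z * g z)"
        using i ig laurent0[OF g(1)] by simp
      also have "norm \<dots> \<le> (LINT z|circle_measure. norm (D z) * e)"
      proof (rule order.trans[OF integral_norm_bound integral_mono_AE])
        show "AE z in circle_measure. norm (D z * of_real (\<phi> z) - D z * g z) \<le> norm (D z) * e"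
          using AE_circle_norm
        proof eventually_elim
          case (elim z)
          then show ?case using g(2)[OF elim]
            by (simp add: norm_mult mult_left_mono flip: right_diff_distrib)
        qed
      qed (use i ig D in auto)
      finally show ?thesis by simp
    qed
    note le = this
    have "norm (LINT z|circle_measure. D z * of_real (\<phi> z)) \<le> 0"
    proof (rule field_le_epsilon)
      fix e :: real assume e: "e > 0"
      define c where "c = (LINT z|circle_measure. norm (D z))"
      have c: "c \<ge> 0" by (simp add: c_def)
      have "c * (e / (c + 1)) \<le> e" using c e by (simp add: divide_simps mult_left_mono)
      then show "norm (LINT z|circle_measure. D z * of_real (\<phi> z)) \<le> 0 + e"
        using le[of "e / (c + 1)"] c e unfolding c_def[symmetric] by simp
    qed
    then show ?thesis by simp
  qed
  have closed0: "set_lebesgue_integral circle_measure K D = 0" if K: "closed K" for K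
  \<comment> \<open>With \<open>infdist\<close> to the empty set equal to 0, the functions of the
    other case would be constantly 1.\<close>
  proof (cases "K = {}")
    case True
    then show ?thesis by (simp add: set_lebesgue_integral_def)
  next
    case False
    define \<phi> where "\<phi> n z = max 0 (1 - real n * infdist z K)" for n :: nat and z
    have "(\<lambda>n. LINT z|circle_measure. D z * of_real (\<phi> n z)) \<longlonglongrightarrow> (LINT z|circle_measure. D z * of_real (indicator K z))"
    proof (rule integral_dominated_convergence)
      have cont: "continuous_on UNIV (\<phi> n)" for n unfolding \<phi>_def by (intro continuous_intros)
      show "(\<lambda>z. D z * of_real (\<phi> n z)) \<in> borel_measurable circle_measure" for n
      proof -
        have "(\<lambda>z. complex_of_real (\<phi> n z)) \<in> borel_measurable borel"
          using cont[of n] by (intro borel_measurable_continuous_onI continuous_intros)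
        then show ?thesis using Dm by simp
      qed
      show "(\<lambda>z. D z * of_real (indicator K z)) \<in> borel_measurable circle_measure"
      proof -
        have [measurable]: "K \<in> sets borel" using K by (rule borel_closed)
        note Dm [measurable]
        show ?thesis by measurable
      qed
      show "integrable circle_measure (\<lambda>z. norm (D z))" using D by simp
      have "\<bar>\<phi> n z\<bar> \<le> 1" for n z using infdist_nonneg[of z K] by (auto simp: \<phi>_def)
      then show "AE z in circle_measure. norm (D z * of_real (\<phi> n z)) \<le> norm (D z)" for n
        by (auto simp: norm_mult mult_left_le)
      have "(\<lambda>n. \<phi> n z) \<longlonglongrightarrow> indicator K z" for z
      proof (cases "z \<in> K")
        case True
        then show ?thesis by (simp add: \<phi>_def)
      next
        case nz: False
        have "infdist z K > 0"
          using in_closed_iff_infdist_zero[OF K False, of z] nz infdist_nonneg[of z K] by (auto simp: less_le)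
        obtain n0 :: nat where "1 / infdist z K < n0" using reals_Archimedean2 by blast
        have "1 \<le> real n * infdist z K" if "n \<ge> n0" for n
          proof -
      have "1 \<le> real n0 * infdist z K" using \<open>infdist z K > 0\<close> \<open>1 / infdist z K < n0\<close> by (simp add: divide_less_eq)
      also have "\<dots> \<le> real n * infdist z K" using that by (intro mult_right_mono infdist_nonneg) auto
      finally show ?thesis .
    qed
        then have "eventually (\<lambda>n. \<phi> n z = 0) sequentially"
          by (intro eventually_sequentiallyI[of n0]) (auto simp: \<phi>_def)
        then show ?thesis using nz by (simp add: tendsto_eventually)
      qed
      then show "AE z in circle_measure. (\<lambda>n. D z * of_real (\<phi> n z)) \<longlonglongrightarrow> D z * of_real (indicator K z)"
        by (intro AE_I2 tendsto_mult tendsto_const tendsto_of_real)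
    qed
    moreover have "(LINT z|circle_measure. D z * of_real (\<phi> n z)) = 0" for n
      using infdist_nonneg[of _ K] unfolding \<phi>_def by (intro cont0 continuous_intros) (auto simp: abs_le_iff)
    ultimately have "(LINT z|circle_measure. D z * of_real (indicator K z)) = 0"
      by (simp add: LIMSEQ_const_iff)
    then show ?thesis by (simp add: set_lebesgue_integral_def scaleR_conv_of_real mult.commute)
  qed
  have closed_stable: "Int_stable (Collect closed :: complex set set)" "Collect closed \<subseteq> Pow (UNIV :: complex set)"
    by (auto simp: Int_stable_def)
  fix A assume "A \<in> sets circle_measure"
  then have "A \<in> sigma_sets UNIV (Collect closed)"
    by (simp add: borel_eq_closed)
  then show "set_lebesgue_integral circle_measure A D = 0"
  proof (induction A rule: sigma_sets_induct_disjoint[OF closed_stable, consumes 1, case_names basic empty compl union])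
    case (compl A)
    then have A: "A \<in> sets borel" by (simp add: borel_eq_closed)
    have si: "set_integrable circle_measure B D" if "B \<in> sets borel" for B
      using D that unfolding set_integrable_def by (intro integrable_mult_indicator) auto
    have "set_lebesgue_integral circle_measure (A \<union> (UNIV - A)) D
       = set_lebesgue_integral circle_measure A D + set_lebesgue_integral circle_measure (UNIV - A) D"
      using A si by (intro set_integral_Un) auto
    moreover have "set_lebesgue_integral circle_measure UNIV D = 0" using closed0[of UNIV] by simp
    ultimately show ?case using compl by simp
  next
    case (union A)
    then have A: "A i \<in> sets borel" for i by (auto simp: borel_eq_closed)
    have "set_integrable circle_measure (\<Union>i. A i) D"
      using D A unfolding set_integrable_def by (intro integrable_mult_indicator) auto
    then have "set_lebesgue_integral circle_measure (\<Union>i. A i) D = (\<Sum>i. set_lebesgue_integral circle_measure (A i) D)"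
      using A union(1) by (intro lebesgue_integral_countable_add) (auto simp: disjoint_family_on_def)
    then show ?case using union by simp
  next
    case (basic A)
    then show ?case using closed0 by simp
  qed (simp add: set_lebesgue_integral_def)
qed

section \<open>Poisson summation\<close>

text \<open>The enumeration \<^term>\<open>int_decode\<close> of the integers turns the sums over \<open>\<int>\<close> into series.\<close>

lemma infsum_int_eq_suminf:
  fixes f :: "int \<Rightarrow> real"
  assumes "summable (\<lambda>n. \<bar>f (int_decode n)\<bar>)"
  shows "(\<Sum>\<^sub>\<infinity>j. f j) = (\<Sum>n. f (int_decode n))"
proof -
  have s: "summable (\<lambda>n. norm (f (int_decode n)))" using assms by simp
  have "((\<lambda>n. f (int_decode n)) has_sum (\<Sum>n. f (int_decode n))) UNIV"
    by (rule norm_summable_imp_has_sum[OF s summable_sums[OF summable_norm_cancel[OF s]]])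
  then have "(\<Sum>\<^sub>\<infinity>n. f (int_decode n)) = (\<Sum>n. f (int_decode n))" by (rule infsumI)
  moreover have "(\<Sum>\<^sub>\<infinity>n. f (int_decode n)) = (\<Sum>\<^sub>\<infinity>j. f j)"
    by (rule infsum_reindex_bij_betw[OF bij_int_decode])
  ultimately show ?thesis by simp
qed

text \<open>The enumeration alternates between nonnegative and negative integers and reaches j no
  later than at index 2 |j|. This turns decay in j into decay in n.\<close>

lemma int_decode_abs_ge: "real n + 1 \<le> 2 * (real_of_int \<bar>int_decode n\<bar> + 1)"
proof -
  have "int_encode j + 1 \<le> 2 * (nat \<bar>j\<bar> + 1)" for j
    by (auto simp: int_encode_def sum_encode_def)
  from this[of "int_decode n"] have "n + 1 \<le> 2 * (nat \<bar>int_decode n\<bar> + 1)" by simp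
  then have "real (n + 1) \<le> real (2 * (nat \<bar>int_decode n\<bar> + 1))" by (simp only: of_nat_le_iff)
  then show ?thesis by simp
qed

text \<open>The translates of (-pi, pi] by multiples of 2 pi tile the line. The piece of h on the
  n-th tile is \<open>v n\<close>, and \<open>u n\<close> is the same piece moved back to the base
  cell; the majorant c permits exchanging sum and integral.\<close>

lemma unfold_integral:
  fixes h :: "real \<Rightarrow> complex"
  assumes [measurable]: "h \<in> borel_measurable borel"
    and c: "summable c" "\<And>n \<theta>. \<theta> \<in> {-pi<..pi} \<Longrightarrow> norm (h (\<theta> + 2 * pi * of_int (int_decode n))) \<le> c n"
  shows "integrable lborel h"
    and "(LINT \<theta>|lborel. indicator {-pi<..pi} \<theta> *\<^sub>R (\<Sum>n. h (\<theta> + 2 * pi * of_int (int_decode n)))) = (LINT x|lborel. h x)"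
proof -
  define u where "u n \<theta> = indicator {-pi<..pi} \<theta> *\<^sub>R h (\<theta> + 2 * pi * of_int (int_decode n))" for n and \<theta> :: real
  define v where "v n x = indicator {-pi<..pi} (x - 2 * pi * of_int (int_decode n)) *\<^sub>R h x" for n and x :: real
  have [measurable]: "u n \<in> borel_measurable borel" "v n \<in> borel_measurable borel" for n
    unfolding u_def v_def by measurable
  have uv: "v n (2 * pi * of_int (int_decode n) + 1 * \<theta>) = u n \<theta>" for n \<theta>
    by (simp add: u_def v_def add.commute)
  have cell: "integrable lborel (\<lambda>\<theta>. indicator {-pi<..pi} \<theta> *\<^sub>R (c n :: real))" for n
    by (intro integrable_scaleR_left integrable_real_indicator) auto
  have u_le: "norm (u n \<theta>) \<le> indicator {-pi<..pi} \<theta> *\<^sub>R c n" for n \<theta>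
    using c(2)[of \<theta> n] by (auto simp: u_def indicator_def)
  have u_int: "integrable lborel (u n)" for n
    by (rule Bochner_Integration.integrable_bound[OF cell[of n]]) (use u_le in \<open>auto intro!: AE_I2 order.trans[OF _ abs_ge_self]\<close>)
  have v_int: "integrable lborel (v n)" for n
    using lborel_integrable_real_affine_iff[of 1 "v n" "2 * pi * of_int (int_decode n)"] u_int[of n] unfolding uv by simp
  have int_uv: "(LINT x|lborel. v n x) = (LINT \<theta>|lborel. u n \<theta>)" for n
    using lborel_integral_real_affine[of 1 "v n" "2 * pi * of_int (int_decode n)"] unfolding uv by simp
  have norm_uv: "(LINT x|lborel. norm (v n x)) = (LINT \<theta>|lborel. norm (u n \<theta>))" for n
    using lborel_integral_real_affine[of 1 "\<lambda>x. norm (v n x)" "2 * pi * of_int (int_decode n)"] unfolding uv by simp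
  have norm_le: "(LINT \<theta>|lborel. norm (u n \<theta>)) \<le> 2 * pi * c n" for n
  proof -
    have "(LINT \<theta>|lborel. norm (u n \<theta>)) \<le> (LINT \<theta>|lborel. indicator {-pi<..pi} \<theta> *\<^sub>R c n)"
      using u_int cell u_le by (intro integral_mono) auto
    then show ?thesis by simp
  qed
  have sum_norm: "summable (\<lambda>n. LINT \<theta>|lborel. norm (u n \<theta>))"
    by (rule summable_comparison_test[OF _ summable_mult[OF c(1), of "2 * pi"]]) (use norm_le in auto)
  have u_summable: "summable (\<lambda>n. norm (u n \<theta>))" for \<theta>
    by (rule summable_comparison_test[OF _ summable_mult[OF c(1), of "indicator {-pi<..pi} \<theta>"]]) (use u_le in auto)
  have v_single: "\<exists>n0. v n0 x = h x \<and> (\<forall>n. n \<noteq> n0 \<longrightarrow> v n x = 0)" for x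
  proof -
    \<comment> \<open>The tile containing x. As the cells are open on the left and closed on the
      right, it is unique and given by a ceiling.\<close>
    define j where "j = \<lceil>(x - pi) / (2 * pi)\<rceil>"
    have mem: "x - 2 * pi * of_int i \<in> {-pi<..pi} \<longleftrightarrow> i = j" for i
    proof -
      have "x - 2 * pi * of_int i \<in> {-pi<..pi} \<longleftrightarrow> of_int i - 1 < (x - pi) / (2 * pi) \<and> (x - pi) / (2 * pi) \<le> of_int i"
        by (auto simp: field_simps)
      also have "\<dots> \<longleftrightarrow> i = j" unfolding j_def by (auto simp: ceiling_unique) (linarith+)?
      finally show ?thesis .
    qed
    have "v (int_encode j) x = h x" using mem[of j] by (simp add: v_def)
    moreover have "v n x = 0" if "n \<noteq> int_encode j" for n
      using mem[of "int_decode n"] that by (auto simp: v_def indicator_def)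
    ultimately show ?thesis by blast
  qed
  have v_sums: "(\<lambda>n. v n x) sums h x" "summable (\<lambda>n. norm (v n x))" for x
  proof -
    obtain n0 where n0: "v n0 x = h x" "\<And>n. n \<noteq> n0 \<Longrightarrow> v n x = 0" using v_single by blast
    have "(\<lambda>n. v n x) = (\<lambda>n. if n = n0 then h x else 0)" using n0 by auto
    then show "(\<lambda>n. v n x) sums h x" using sums_single[of n0 "\<lambda>_. h x"] by simp
    have "(\<lambda>n. norm (v n x)) = (\<lambda>n. if n = n0 then norm (h x) else 0)" using n0 by auto
    then show "summable (\<lambda>n. norm (v n x))" using sums_single[of n0 "\<lambda>_. norm (h x)"] by (simp add: sums_iff)
  qed
  have h_eq: "h = (\<lambda>x. \<Sum>n. v n x)" using v_sums(1) by (auto simp: sums_iff)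
  show "integrable lborel h"
    unfolding h_eq using v_int v_sums(2) sum_norm by (intro integrable_suminf) (auto simp: norm_uv)
  have "(LINT x|lborel. h x) = (\<Sum>n. LINT x|lborel. v n x)"
    unfolding h_eq using v_int v_sums(2) sum_norm by (intro integral_suminf) (auto simp: norm_uv)
  also have "\<dots> = (\<Sum>n. LINT \<theta>|lborel. u n \<theta>)" by (simp add: int_uv)
  also have "\<dots> = (LINT \<theta>|lborel. (\<Sum>n. u n \<theta>))"
    using u_int u_summable sum_norm by (intro integral_suminf[symmetric]) auto
  also have "\<dots> = (LINT \<theta>|lborel. indicator {-pi<..pi} \<theta> *\<^sub>R (\<Sum>n. h (\<theta> + 2 * pi * of_int (int_decode n))))"
    by (intro Bochner_Integration.integral_cong) (auto simp: u_def indicator_def)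
  finally show "(LINT \<theta>|lborel. indicator {-pi<..pi} \<theta> *\<^sub>R (\<Sum>n. h (\<theta> + 2 * pi * of_int (int_decode n)))) = (LINT x|lborel. h x)"
    by simp
qed

definition polynomial_decay :: "(real \<Rightarrow> real) \<Rightarrow> real \<Rightarrow> real \<Rightarrow> bool" where
  "polynomial_decay g A \<epsilon> \<longleftrightarrow> (\<forall>x. \<bar>g x\<bar> \<le> A * (1 + \<bar>x\<bar>) powr (- (1 + \<epsilon>)))"

text \<open>For such an angle and N >= 1 the argument x of g has |x| >= |j| - 1/2 for j not 0, so 1
  + |x| >= (|j| + 1) / 2 >= (n + 1) / 4, which explains the power of 4. The bound is uniform in the
  angle and in N.\<close>

lemma decay_enumeration_bound:
  assumes g: "polynomial_decay g A \<epsilon>" and A: "A > 0" "\<epsilon> > 0" and N: "N \<ge> 1" and \<theta>: "\<theta> \<in> {-pi..pi}"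
  shows "\<bar>g (real N / (2 * pi) * (\<theta> + 2 * pi * of_int (int_decode n)))\<bar>
     \<le> A * 4 powr (1 + \<epsilon>) * real (Suc n) powr (- (1 + \<epsilon>))"
proof -
  define j where "j = int_decode n"
  define x where "x = real N / (2 * pi) * (\<theta> + 2 * pi * of_int j)"
  have "(real (Suc n)) / 4 \<le> (real_of_int \<bar>j\<bar> + 1) / 2" using int_decode_abs_ge[of n] by (simp add: j_def)
  also have "\<dots> \<le> 1 + \<bar>x\<bar>"
  proof (cases "j = 0")
    case False
    have "2 * pi * real_of_int \<bar>j\<bar> - pi \<le> \<bar>\<theta> + 2 * pi * of_int j\<bar>"
    proof -
      have "\<bar>2 * pi * of_int j\<bar> = 2 * pi * real_of_int \<bar>j\<bar>" by (simp add: abs_mult)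
      moreover have "\<bar>\<theta>\<bar> \<le> pi" using \<theta> by auto
      ultimately show ?thesis by linarith
    qed
    then have "(2 * pi * real_of_int \<bar>j\<bar> - pi) / (2 * pi) \<le> \<bar>\<theta> + 2 * pi * of_int j\<bar> / (2 * pi)"
      by (intro divide_right_mono) auto
    also have "(2 * pi * real_of_int \<bar>j\<bar> - pi) / (2 * pi) = real_of_int \<bar>j\<bar> - 1 / 2" by (simp add: field_simps)
    also have "\<bar>\<theta> + 2 * pi * of_int j\<bar> / (2 * pi) \<le> real N * (\<bar>\<theta> + 2 * pi * of_int j\<bar> / (2 * pi))"
      using mult_right_mono[of 1 "real N" "\<bar>\<theta> + 2 * pi * of_int j\<bar> / (2 * pi)"] N by simp
    also have "\<dots> = \<bar>x\<bar>" by (simp add: x_def abs_mult)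
    finally have "real_of_int \<bar>j\<bar> - 1 / 2 \<le> \<bar>x\<bar>" .
    moreover have "real_of_int \<bar>j\<bar> \<ge> 1" using False by linarith
    moreover have "(J + 1) / 2 \<le> 1 + y" if "J - 1 / 2 \<le> y" "1 \<le> J" for J y :: real
      using that by (simp add: field_simps)
    ultimately show ?thesis by blast
  qed simp
  finally have le: "real (Suc n) / 4 \<le> 1 + \<bar>x\<bar>" .
  have "\<bar>g x\<bar> \<le> A * (1 + \<bar>x\<bar>) powr (- (1 + \<epsilon>))" using g by (simp add: polynomial_decay_def)
  also have "\<dots> \<le> A * (real (Suc n) / 4) powr (- (1 + \<epsilon>))"
    using le A by (intro mult_left_mono powr_mono2') auto
  also have "\<dots> = A * 4 powr (1 + \<epsilon>) * real (Suc n) powr (- (1 + \<epsilon>))"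
  proof -
    have "(real (Suc n) / 4) powr (- s) = 4 powr s * real (Suc n) powr (- s)" for s
      by (simp add: powr_divide powr_minus divide_simps del: of_nat_Suc)
    then show ?thesis by (simp only: mult.assoc)
  qed
  finally show ?thesis by (simp add: x_def j_def)
qed

lemma summable_decay_bound:
  assumes "\<epsilon> > 0"
  shows "summable (\<lambda>n. B * real (Suc n) powr (- (1 + \<epsilon>)))"
proof -
  have "summable (\<lambda>n. real n powr (- (1 + \<epsilon>)))" using assms by (subst summable_real_powr_iff) auto
  then have "summable (\<lambda>n. real (Suc n) powr (- (1 + \<epsilon>)))" by (subst summable_Suc_iff)
  then show ?thesis by (rule summable_mult)
qed

section \<open>Fourier coefficients of the periodization\<close>

definition borel_fourier :: "(real \<Rightarrow> real) \<Rightarrow> real \<Rightarrow> complex" where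
  "borel_fourier g u = (LINT x|lborel. complex_of_real (g x) * exp (- 2 * complex_of_real pi * \<i> * of_real x * of_real u))"

definition enum_periodized :: "(real \<Rightarrow> real) \<Rightarrow> nat \<Rightarrow> real \<Rightarrow> real" where
  "enum_periodized g N \<theta> = (\<Sum>n. g (real N / (2 * pi) * (\<theta> + 2 * pi * of_int (int_decode n))))"

lemma norm_exp_imaginary: "norm (exp (- 2 * complex_of_real pi * \<i> * of_real x * of_real u)) = 1"
  by (simp add: norm_exp_eq_Re)

text \<open>Unfolding at N = 1 already proves integrability of the rescaled function; the scaling is
  then undone.\<close>

lemma decay_integrable:
  assumes [measurable]: "g \<in> borel_measurable borel" and g: "polynomial_decay g A \<epsilon>" and A: "A > 0" "\<epsilon> > 0"
  shows "integrable lborel g"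
proof -
  define q where "q = (2 * pi)"
  have q: "q > 0" by (simp add: q_def)
  have "integrable lborel (\<lambda>x. complex_of_real (g (1 / q * x)))"
    by (rule unfold_integral(1)[OF _ summable_decay_bound[OF A(2), of "A * 4 powr (1 + \<epsilon>)"]])
      (use decay_enumeration_bound[OF g A, of 1] in \<open>auto simp: q_def\<close>)
  then have "integrable lborel (\<lambda>x. g (0 + (1 / q) * x))" by (simp only: complex_of_real_integrable_eq add_0)
  then show ?thesis using lborel_integrable_real_affine_iff[of "1 / q" g 0] q by simp
qed

text \<open>Poisson summation at the level of coefficients: the character is 2 pi periodic, so it
  can be taken inside the sum and the integral unfolded; the substitution x -> (2 pi / N) x leaves
  the factor 1 / N.\<close>

lemma enum_periodized_coefficient:
  assumes [measurable]: "g \<in> borel_measurable borel" and g: "polynomial_decay g A \<epsilon>" and A: "A > 0" "\<epsilon> > 0" and N: "N \<ge> 1"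
  shows "(LINT \<theta>|lborel. indicator {-pi<..pi} \<theta> *\<^sub>R (complex_of_real (enum_periodized g N \<theta>) * cis (- (of_int k * \<theta>)))) / (2 * pi)
    = borel_fourier g (of_int k / real N) / real N"
proof -
  define h where "h x = complex_of_real (g (real N / (2 * pi) * x)) * cis (- (of_int k * x))" for x
  have hm: "h \<in> borel_measurable borel"
  proof -
    have "(\<lambda>x. g (real N / (2 * pi) * x)) \<in> borel_measurable borel"
      by (rule measurable_compose[OF _ assms(1)]) simp
    moreover have "(\<lambda>x. cis (- (of_int k * x))) \<in> borel_measurable borel"
      by (intro borel_measurable_continuous_onI continuous_intros)
    ultimately show ?thesis unfolding h_def by simp
  qed
  have cis_period: "cis (- (of_int k * (\<theta> + 2 * pi * of_int j))) = cis (- (of_int k * \<theta>))" for \<theta> and j :: int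
  proof -
    have "- (of_int k * (\<theta> + 2 * pi * of_int j)) = - (of_int k * \<theta>) + 2 * pi * of_int (- (k * j))" by (simp add: algebra_simps)
    then show ?thesis by (simp only: cis_mult[symmetric] cis_multiple_2pi[OF Ints_of_int]) simp
  qed
  have bound: "norm (h (\<theta> + 2 * pi * of_int (int_decode n))) \<le> A * 4 powr (1 + \<epsilon>) * real (Suc n) powr (- (1 + \<epsilon>))"
    if "\<theta> \<in> {-pi<..pi}" for n \<theta>
    using decay_enumeration_bound[OF g A N, of \<theta> n] that by (auto simp: h_def norm_mult)
  have series: "(\<Sum>n. h (\<theta> + 2 * pi * of_int (int_decode n))) = complex_of_real (enum_periodized g N \<theta>) * cis (- (of_int k * \<theta>))"
    if "\<theta> \<in> {-pi<..pi}" for \<theta>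
  proof -
    have "summable (\<lambda>n. norm (g (real N / (2 * pi) * (\<theta> + 2 * pi * of_int (int_decode n)))))"
      by (rule summable_comparison_test[OF _ summable_decay_bound[OF A(2), of "A * 4 powr (1 + \<epsilon>)"]])
        (use decay_enumeration_bound[OF g A N, of \<theta>] that in auto)
    then have s: "summable (\<lambda>n. g (real N / (2 * pi) * (\<theta> + 2 * pi * of_int (int_decode n))))"
      by (rule summable_norm_cancel)
    have "(\<Sum>n. h (\<theta> + 2 * pi * of_int (int_decode n)))
       = (\<Sum>n. complex_of_real (g (real N / (2 * pi) * (\<theta> + 2 * pi * of_int (int_decode n)))) * cis (- (of_int k * \<theta>)))"
      unfolding h_def cis_period by (rule refl)
    also have "\<dots> = (\<Sum>n. complex_of_real (g (real N / (2 * pi) * (\<theta> + 2 * pi * of_int (int_decode n))))) * cis (- (of_int k * \<theta>))"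
      by (rule suminf_mult2[symmetric]) (use s in \<open>simp only: summable_complex_of_real\<close>)
    also have "\<dots> = complex_of_real (enum_periodized g N \<theta>) * cis (- (of_int k * \<theta>))"
      unfolding enum_periodized_def using suminf_of_real[OF s, where 'a = complex] by simp
    finally show ?thesis .
  qed
  have "(LINT \<theta>|lborel. indicator {-pi<..pi} \<theta> *\<^sub>R (complex_of_real (enum_periodized g N \<theta>) * cis (- (of_int k * \<theta>))))
     = (LINT \<theta>|lborel. indicator {-pi<..pi} \<theta> *\<^sub>R (\<Sum>n. h (\<theta> + 2 * pi * of_int (int_decode n))))"
    by (intro Bochner_Integration.integral_cong) (auto simp: series indicator_def)
  also have "\<dots> = (LINT x|lborel. h x)"
    by (rule unfold_integral(2)[OF hm summable_decay_bound[OF A(2)] bound])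
  also have "\<dots> = \<bar>2 * pi / real N\<bar> *\<^sub>R (LINT x|lborel. h (0 + (2 * pi / real N) * x))"
    using N by (intro lborel_integral_real_affine) auto
  also have "(LINT x|lborel. h (0 + (2 * pi / real N) * x)) = borel_fourier g (of_int k / real N)"
    unfolding borel_fourier_def
  proof (intro Bochner_Integration.integral_cong refl)
    fix x :: real
    have "cis (- (of_int k * (2 * pi / real N * x))) = exp (- 2 * complex_of_real pi * \<i> * of_real x * of_real (of_int k / real N))"
      by (simp add: cis_conv_exp field_simps)
    then show "h (0 + (2 * pi / real N) * x) = complex_of_real (g x) * exp (- 2 * complex_of_real pi * \<i> * of_real x * of_real (of_int k / real N))"
      using N by (simp add: h_def)
  qed
  finally show ?thesis using N by (simp add: scaleR_conv_of_real)
qed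

text \<open>
  A Borel function that agrees with \<^const>\<open>Arg\<close> on the unit circle.
\<close>
definition circle_angle :: "complex \<Rightarrow> real" where
  "circle_angle z = (if z \<in> - \<real>\<^sub>\<le>\<^sub>0 then Arg z else pi)"

lemma measurable_circle_angle [measurable]: "circle_angle \<in> borel_measurable borel"
  unfolding circle_angle_def
  by (intro borel_measurable_continuous_on_if continuous_on_Arg continuous_intros) auto

text \<open>The only point of the circle on the cut is -1, where the argument is pi.\<close>

lemma circle_angle_eq_Arg: "norm z = 1 \<Longrightarrow> circle_angle z = Arg z"
  using Arg_cis[of pi] by (auto simp: circle_angle_def elim!: nonpos_Reals_cases)

lemma circle_angle_cis: "\<theta> \<in> {-pi<..pi} \<Longrightarrow> circle_angle (cis \<theta>) = \<theta>"
  by (simp add: circle_angle_eq_Arg Arg_cis)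

lemma AE_circle_angleI:
  assumes "AE \<theta> in lborel. Q \<theta>" and [measurable]: "Measurable.pred borel Q"
  shows "AE z in circle_measure. Q (circle_angle z)"
proof -
  \<comment> \<open>The endpoint -pi is discarded because its point -1 is assigned the angle
    pi.\<close>
  have "AE \<theta> in lborel. \<theta> \<noteq> - pi" by (rule AE_lborel_singleton)
  then have "AE \<theta> in lborel. \<theta> \<in> {-pi..pi} \<longrightarrow> Q (circle_angle (cis \<theta>))"
    using assms(1)
  proof eventually_elim
    case (elim \<theta>)
    then show ?case using circle_angle_cis[of \<theta>] by (auto simp: le_less)
  qed
  then have "AE \<theta> in lborel. 0 < ennreal (indicator {-pi..pi} \<theta> / (2 * pi)) \<longrightarrow> Q (circle_angle (cis \<theta>))"
  proof eventually_elim
    case (elim \<theta>)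
    then show ?case by (cases "\<theta> \<in> {-pi..pi}") simp_all
  qed
  then have "AE \<theta> in density lborel (\<lambda>\<theta>. ennreal (indicator {-pi..pi} \<theta> / (2 * pi))). Q (circle_angle (cis \<theta>))"
    by (subst AE_density) simp_all
  moreover have "{z \<in> space borel. Q (circle_angle z)} \<in> sets borel" by measurable
  ultimately show ?thesis unfolding circle_measure_def by (subst AE_distr_iff) simp_all
qed

lemma measurable_enum_periodized [measurable]:
  assumes "g \<in> borel_measurable borel"
  shows "enum_periodized g N \<in> borel_measurable borel"
  unfolding enum_periodized_def
  by (intro borel_measurable_suminf measurable_compose[OF _ assms]) simp

lemma enum_periodized_bound:
  assumes g: "polynomial_decay g A \<epsilon>" and A: "A > 0" "\<epsilon> > 0" and N: "N \<ge> 1" and \<theta>: "\<theta> \<in> {-pi..pi}"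
  shows "\<bar>enum_periodized g N \<theta>\<bar> \<le> (\<Sum>n. A * 4 powr (1 + \<epsilon>) * real (Suc n) powr (- (1 + \<epsilon>)))"
proof -
  note b = decay_enumeration_bound[OF g A N \<theta>]
  note s = summable_decay_bound[OF A(2), of "A * 4 powr (1 + \<epsilon>)"]
  have sn: "summable (\<lambda>n. norm (g (real N / (2 * pi) * (\<theta> + 2 * pi * of_int (int_decode n)))))"
    by (rule summable_comparison_test[OF _ s]) (use b in auto)
  have "norm (enum_periodized g N \<theta>) \<le> (\<Sum>n. norm (g (real N / (2 * pi) * (\<theta> + 2 * pi * of_int (int_decode n)))))"
    unfolding enum_periodized_def by (rule summable_norm[OF sn])
  also have "\<dots> \<le> (\<Sum>n. A * 4 powr (1 + \<epsilon>) * real (Suc n) powr (- (1 + \<epsilon>)))"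
    by (rule suminf_le[OF _ sn s]) (use b in auto)
  finally show ?thesis by simp
qed

text \<open>Both sides are integrable on the circle and have the same Fourier coefficients, since
  those outside the finite set K vanish.\<close>

lemma poisson_summation_circle:
  assumes gm [measurable]: "g \<in> borel_measurable borel" and g: "polynomial_decay g A \<epsilon>" and A: "A > 0" "\<epsilon> > 0" and N: "N \<ge> 1"
    and K: "finite K" "\<And>k. k \<notin> K \<Longrightarrow> borel_fourier g (of_int k / real N) = 0"
  shows "AE z in circle_measure. complex_of_real (enum_periodized g N (circle_angle z))
     = (\<Sum>k\<in>K. borel_fourier g (of_int k / real N) / real N * z powi k)"
proof -
  define P where "P z = complex_of_real (enum_periodized g N (circle_angle z))" for z
  define T where "T z = (\<Sum>k\<in>K. borel_fourier g (of_int k / real N) / real N * z powi k)" for z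
  have pm [measurable]: "(\<lambda>z :: complex. z powi k) \<in> borel_measurable borel" for k
    using laurent_measurable[OF laurent.monomial[of 1 k]] by simp
  have [measurable]: "P \<in> borel_measurable borel" "T \<in> borel_measurable borel" unfolding P_def T_def by measurable
  define B where "B = (\<Sum>n. A * 4 powr (1 + \<epsilon>) * real (Suc n) powr (- (1 + \<epsilon>)))"
  have PB: "norm (P z) \<le> B" if "norm z = 1" for z
  proof -
    have "circle_angle z \<in> {-pi..pi}" using Arg_bounded[of z] by (auto simp: circle_angle_eq_Arg[OF that])
    from enum_periodized_bound[OF g A N this] show ?thesis by (simp add: P_def B_def)
  qed
  have iP: "integrable circle_measure (\<lambda>z. P z * z powi k)" for k
    using PB by (intro circle_integrable_bounded[of _ B]) (auto simp: norm_mult norm_power_int)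
  have imon: "integrable circle_measure (\<lambda>z. c * z powi k)" for c k
    by (intro laurent_integrable laurent.monomial)
  have Tk: "T z * z powi k = (\<Sum>l\<in>K. borel_fourier g (of_int l / real N) / real N * z powi (l + k))" if "norm z = 1" for z k
  proof -
    have "z \<noteq> 0" using that by auto
    then show ?thesis by (simp add: T_def sum_distrib_right power_int_add mult.assoc)
  qed
  \<comment> \<open>Integration against z^k picks out the coefficient with index -k.\<close>
  have iT: "integrable circle_measure (\<lambda>z. T z * z powi k)
      \<and> (LINT z|circle_measure. T z * z powi k) = borel_fourier g (of_int (- k) / real N) / real N" for k
  proof -
    let ?S = "\<lambda>z. \<Sum>l\<in>K. borel_fourier g (of_int l / real N) / real N * z powi (l + k)"
    have AE: "AE z in circle_measure. T z * z powi k = ?S z" using AE_circle_norm by eventually_elim (rule Tk)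
    have iS: "integrable circle_measure ?S" by (intro Bochner_Integration.integrable_sum imon)
    have "integrable circle_measure (\<lambda>z. T z * z powi k) \<longleftrightarrow> integrable circle_measure ?S"
      using AE by (intro integrable_cong_AE) auto
    moreover have "(LINT z|circle_measure. T z * z powi k) = (LINT z|circle_measure. ?S z)"
      using AE by (intro integral_cong_AE) auto
    moreover have "(LINT z|circle_measure. ?S z) = (\<Sum>l\<in>K. (LINT z|circle_measure. borel_fourier g (of_int l / real N) / real N * z powi (l + k)))"
      by (intro Bochner_Integration.integral_sum imon)
    moreover have "\<dots> = (\<Sum>l\<in>K. if l = - k then borel_fourier g (of_int l / real N) / real N else 0)"
      by (intro sum.cong refl) (auto simp: integral_circle_power_int)
    moreover have "\<dots> = borel_fourier g (of_int (- k) / real N) / real N"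
      using K(1) K(2)[of "- k"] by (simp add: sum.delta)
    ultimately show ?thesis using iS by simp
  qed
  have Pk: "(LINT z|circle_measure. P z * z powi k) = borel_fourier g (of_int (- k) / real N) / real N" for k
  proof -
    have "(LINT z|circle_measure. P z * z powi k)
      = (LINT \<theta>|lborel. indicator {-pi..pi} \<theta> *\<^sub>R (P (cis \<theta>) * cis \<theta> powi k)) / (2 * pi)"
      by (intro integral_circle_measure) measurable
    also have "(LINT \<theta>|lborel. indicator {-pi..pi} \<theta> *\<^sub>R (P (cis \<theta>) * cis \<theta> powi k))
      = (LINT \<theta>|lborel. indicator {-pi<..pi} \<theta> *\<^sub>R (complex_of_real (enum_periodized g N \<theta>) * cis (- (of_int (- k) * \<theta>))))"
    proof (rule integral_cong_AE)
      have "AE \<theta> in lborel. \<theta> \<noteq> - pi" by (rule AE_lborel_singleton)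
      then show "AE \<theta> in lborel. indicator {-pi..pi} \<theta> *\<^sub>R (P (cis \<theta>) * cis \<theta> powi k)
        = indicator {-pi<..pi} \<theta> *\<^sub>R (complex_of_real (enum_periodized g N \<theta>) * cis (- (of_int (- k) * \<theta>)))"
      proof eventually_elim
        case (elim \<theta>)
        then show ?case by (auto simp: indicator_def P_def circle_angle_cis cis_power_int)
      qed
      have "(\<lambda>\<theta>. cis (- (of_int (- k) * \<theta>))) \<in> borel_measurable borel"
        by (intro borel_measurable_continuous_onI continuous_intros)
      then show "(\<lambda>\<theta>. indicator {-pi<..pi} \<theta> *\<^sub>R (complex_of_real (enum_periodized g N \<theta>) * cis (- (of_int (- k) * \<theta>))))
         \<in> borel_measurable lborel" by measurable
    qed measurable
    finally show ?thesis using enum_periodized_coefficient[OF gm g A N, of "- k"] by simp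
  qed
  have "AE z in circle_measure. P z - T z = 0"
  proof (rule circle_fourier_uniqueness)
    show "integrable circle_measure (\<lambda>z. P z - T z)"
      using iP[of 0] iT[of 0] by (intro Bochner_Integration.integrable_diff) simp_all
    show "(LINT z|circle_measure. (P z - T z) * z powi k) = 0" for k
      using iP[of k] iT[of k] Pk[of k] by (simp add: left_diff_distrib)
  qed
  then show ?thesis by (simp add: P_def T_def)
qed

text \<open>A Borel function equal to f almost everywhere may violate the bound on a null set.
  Setting it to 0 there restores the decay at every point, as the termwise majorants
  require.\<close>

lemma borel_version_with_decay:
  fixes f :: "real \<Rightarrow> real"
  assumes f: "f \<in> borel_measurable lebesgue" and decay: "\<And>x. \<bar>f x\<bar> < A * (1 + \<bar>x\<bar>) powr (- (1 + \<epsilon>))"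
  obtains g where "g \<in> borel_measurable borel" "polynomial_decay g A \<epsilon>" "AE x in lborel. f x = g x"
proof -
  obtain g0 where g0: "g0 \<in> borel_measurable lborel" "AE x in lborel. f x = g0 x"
    using completion_ex_borel_measurable_real[of f lborel] f by auto
  define g where "g x = (if \<bar>g0 x\<bar> < A * (1 + \<bar>x\<bar>) powr (- (1 + \<epsilon>)) then g0 x else 0)" for x
  have "0 < A * (1 + \<bar>x\<bar>) powr (- (1 + \<epsilon>))" for x using decay[of x] abs_ge_zero[of "f x"] by linarith
  then have "polynomial_decay g A \<epsilon>" by (auto simp: polynomial_decay_def g_def less_imp_le)
  moreover have "AE x in lborel. f x = g x" using g0(2)
  proof eventually_elim
    case (elim x)
    then show ?case using decay[of x] by (simp add: g_def)
  qed
  moreover have "g \<in> borel_measurable borel" unfolding g_def using g0(1) by measurable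
  ultimately show ?thesis using that by blast
qed

lemma fourier_eq_borel_fourier:
  assumes f: "f \<in> borel_measurable lebesgue" and [measurable]: "g \<in> borel_measurable borel" and fg: "AE x in lborel. f x = g x"
  shows "fourier f u = borel_fourier g u"
proof -
  have em: "(\<lambda>x. exp (- 2 * complex_of_real pi * \<i> * of_real x * of_real u)) \<in> borel_measurable borel"
    by (intro borel_measurable_continuous_onI continuous_intros)
  have gm: "(\<lambda>x. complex_of_real (g x) * exp (- 2 * complex_of_real pi * \<i> * of_real x * of_real u)) \<in> borel_measurable lborel"
    using em by simp
  have "fourier f u = (LINT x|lebesgue. complex_of_real (g x) * exp (- 2 * complex_of_real pi * \<i> * of_real x * of_real u))"
    unfolding fourier_def
  proof (rule integral_cong_AE)
    show "AE x in lebesgue. complex_of_real (f x) * exp (- 2 * complex_of_real pi * \<i> * of_real x * of_real u)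
       = complex_of_real (g x) * exp (- 2 * complex_of_real pi * \<i> * of_real x * of_real u)"
      using AE_completion[OF fg] by eventually_elim simp
    show "(\<lambda>x. complex_of_real (g x) * exp (- 2 * complex_of_real pi * \<i> * of_real x * of_real u)) \<in> borel_measurable lebesgue"
      using measurable_completion[OF gm] .
    have "(\<lambda>x. exp (- 2 * complex_of_real pi * \<i> * of_real x * of_real u)) \<in> borel_measurable lebesgue"
      using em by (intro measurable_completion) simp
    then show "(\<lambda>x. complex_of_real (f x) * exp (- 2 * complex_of_real pi * \<i> * of_real x * of_real u)) \<in> borel_measurable lebesgue"
      using f by simp
  qed
  also have "\<dots> = borel_fourier g u" unfolding borel_fourier_def by (rule integral_completion[OF gm])
  finally show ?thesis .
qed

text \<open>The periodization at an angle samples f along a countable progression. Outside a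
  countable union of affine images of the exceptional null set all samples of f and g agree, and
  absolute convergence is inherited from g.\<close>

lemma periodized_eq_enum_AE:
  assumes gm [measurable]: "g \<in> borel_measurable borel" and g: "polynomial_decay g A \<epsilon>" and A: "A > 0" "\<epsilon> > 0" and N: "N \<ge> 1"
    and fg: "AE x in lborel. f x = g x"
  shows "AE z in circle_measure. periodized f N (circle_angle z) = enum_periodized g N (circle_angle z)"
proof -
  obtain Z where Z0: "\<And>x. x \<in> space lborel - Z \<Longrightarrow> f x = g x" "Z \<in> null_sets lborel"
    by (rule AE_E3[OF fg]) blast
  have Z: "Z \<in> null_sets lborel" "\<And>x. x \<notin> Z \<Longrightarrow> f x = g x" using Z0 by auto
  have [measurable]: "Z \<in> sets borel" using Z(1) by auto
  define Q where "Q \<theta> \<longleftrightarrow> (\<forall>n. real N / (2 * pi) * (\<theta> + 2 * pi * of_int (int_decode n)) \<notin> Z)" for \<theta>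
  have "AE \<theta> in lborel. \<forall>n. real N / (2 * pi) * (\<theta> + 2 * pi * of_int (int_decode n)) \<notin> Z"
  proof (subst AE_all_countable, rule allI)
    fix n
    have "AE x in lborel. x \<notin> Z" using Z(1) by (rule AE_not_in)
    then have "AE \<theta> in lborel. (real N / (2 * pi) * (2 * pi * of_int (int_decode n))) + real N / (2 * pi) * \<theta> \<notin> Z"
      using N by (intro AE_borel_affine) auto
    then show "AE \<theta> in lborel. real N / (2 * pi) * (\<theta> + 2 * pi * of_int (int_decode n)) \<notin> Z"
      by (simp only: distrib_left add.commute)
  qed
  then have "AE \<theta> in lborel. Q \<theta>" by (simp add: Q_def)
  then have "AE z in circle_measure. Q (circle_angle z)"
    by (rule AE_circle_angleI) (unfold Q_def, measurable)
  then show ?thesis using AE_circle_norm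
  proof eventually_elim
    case (elim z)
    define \<theta> where "\<theta> = circle_angle z"
    have \<theta>: "\<theta> \<in> {-pi..pi}" using Arg_bounded[of z] by (auto simp: \<theta>_def circle_angle_eq_Arg[OF elim(2)])
    have eq: "f (real N / (2 * pi) * (\<theta> + 2 * pi * of_int (int_decode n))) = g (real N / (2 * pi) * (\<theta> + 2 * pi * of_int (int_decode n)))" for n
      using elim(1) by (intro Z(2)) (simp add: Q_def \<theta>_def)
    have "summable (\<lambda>n. \<bar>f (real N / (2 * pi) * (\<theta> + 2 * pi * of_int (int_decode n)))\<bar>)"
      unfolding eq by (rule summable_comparison_test[OF _ summable_decay_bound[OF A(2), of "A * 4 powr (1 + \<epsilon>)"]])
        (use decay_enumeration_bound[OF g A N \<theta>] in auto)
    then show ?case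
      unfolding \<theta>_def[symmetric] periodized_def enum_periodized_def by (subst infsum_int_eq_suminf) (simp_all only: eq)
  qed
qed

section \<open>The limit\<close>

lemma borel_fourier_integrable:
  assumes gm [measurable]: "g \<in> borel_measurable borel" and gi: "integrable lborel g"
  shows "integrable lborel (\<lambda>x. complex_of_real (g x) * exp (- 2 * complex_of_real pi * \<i> * of_real x * of_real u))"
proof (rule Bochner_Integration.integrable_bound[OF gi])
  have "(\<lambda>x. exp (- 2 * complex_of_real pi * \<i> * of_real x * of_real u)) \<in> borel_measurable borel"
    by (intro borel_measurable_continuous_onI continuous_intros)
  then show "(\<lambda>x. complex_of_real (g x) * exp (- 2 * complex_of_real pi * \<i> * of_real x * of_real u)) \<in> borel_measurable lborel"
    by simp
qed (simp add: norm_mult norm_exp_imaginary del: mult_minus_left)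

lemma continuous_borel_fourier:
  assumes gm [measurable]: "g \<in> borel_measurable borel" and gi: "integrable lborel g"
  shows "continuous_on UNIV (borel_fourier g)"
proof (rule continuous_at_imp_continuous_on, rule ballI)
  fix u :: real
  have "borel_fourier g \<midarrow>u\<rightarrow> borel_fourier g u"
    unfolding tendsto_at_iff_sequentially o_def
  proof (intro allI impI)
    fix X :: "nat \<Rightarrow> real" assume X: "X \<longlonglongrightarrow> u"
    show "(\<lambda>n. borel_fourier g (X n)) \<longlonglongrightarrow> borel_fourier g u"
      unfolding borel_fourier_def
    proof (rule integral_dominated_convergence)
      show "integrable lborel (\<lambda>x. \<bar>g x\<bar>)" using gi by simp
      show "AE x in lborel. norm (complex_of_real (g x) * exp (- 2 * complex_of_real pi * \<i> * of_real x * of_real (X n))) \<le> \<bar>g x\<bar>" for n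
        by (simp add: norm_mult norm_exp_imaginary del: mult_minus_left)
      show "AE x in lborel. (\<lambda>n. complex_of_real (g x) * exp (- 2 * complex_of_real pi * \<i> * of_real x * of_real (X n)))
          \<longlonglongrightarrow> complex_of_real (g x) * exp (- 2 * complex_of_real pi * \<i> * of_real x * of_real u)"
        using X by (intro AE_I2 tendsto_intros)
    qed (use borel_measurable_integrable[OF borel_fourier_integrable[OF gm gi]] in simp_all)
  qed
  then show "isCont (borel_fourier g) u" by (simp add: isCont_def)
qed

lemma borel_fourier_even:
  assumes [measurable]: "g \<in> borel_measurable borel" and "AE x in lborel. g (- x) = g x"
  shows "borel_fourier g (- u) = borel_fourier g u" "cnj (borel_fourier g u) = borel_fourier g u"
proof -
  have em: "(\<lambda>x. exp (- 2 * complex_of_real pi * \<i> * of_real x * of_real u)) \<in> borel_measurable borel" for u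
    by (intro borel_measurable_continuous_onI continuous_intros)
  have "borel_fourier g u = \<bar>- 1\<bar> *\<^sub>R (LINT x|lborel. complex_of_real (g (0 + (- 1) * x)) *
      exp (- 2 * complex_of_real pi * \<i> * of_real (0 + (- 1) * x) * of_real u))"
    unfolding borel_fourier_def by (rule lborel_integral_real_affine) simp
  also have "\<dots> = (LINT x|lborel. complex_of_real (g (- x)) * exp (- 2 * complex_of_real pi * \<i> * of_real x * of_real (- u)))"
    by simp
  also have "\<dots> = borel_fourier g (- u)"
    unfolding borel_fourier_def
  proof (rule integral_cong_AE)
    show "AE x in lborel. complex_of_real (g (- x)) * exp (- 2 * complex_of_real pi * \<i> * of_real x * of_real (- u))
      = complex_of_real (g x) * exp (- 2 * complex_of_real pi * \<i> * of_real x * of_real (- u))"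
      using assms(2) by eventually_elim simp
  qed (use em[of "- u"] in \<open>measurable\<close>)
  finally show e: "borel_fourier g (- u) = borel_fourier g u" by simp
  have "cnj (borel_fourier g u) = borel_fourier g (- u)"
    unfolding borel_fourier_def Bochner_Integration.integral_cnj[symmetric]
    by (intro Bochner_Integration.integral_cong) (simp_all add: exp_cnj)
  with e show "cnj (borel_fourier g u) = borel_fourier g u" by simp
qed

text \<open>The Riemann sum is the integral of the step function h (floor (N u) / N), to which
  dominated convergence applies. The index is shifted to \<open>Suc N\<close> to avoid N =
  0.\<close>

lemma riemann_sum_tendsto_integral:
  fixes h :: "real \<Rightarrow> complex"
  assumes h: "continuous_on UNIV h" and supp: "\<And>u. \<bar>u\<bar> > 1 \<Longrightarrow> h u = 0"
  shows "(\<lambda>N. (\<Sum>k\<in>{- int N..int N}. h (of_int k / real N)) / real N) \<longlonglongrightarrow> (LINT u|lborel. h u)"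
proof -
  have hm [measurable]: "h \<in> borel_measurable borel" by (rule borel_measurable_continuous_onI[OF h])
  define s where "s N u = h (of_int \<lfloor>real N * u\<rfloor> / real N)" for N :: nat and u
  have [measurable]: "s N \<in> borel_measurable borel" for N unfolding s_def by measurable
  obtain B where B: "\<And>u. norm (h u) \<le> B"
  proof -
    have "compact (h ` {-1..1})" by (intro compact_continuous_image continuous_on_subset[OF h]) auto
    then obtain B where B: "\<And>u. u \<in> {-1..1} \<Longrightarrow> norm (h u) \<le> B" by (metis compact_imp_bounded bounded_iff imageI)
    have "norm (h u) \<le> B" for u
    proof (cases "\<bar>u\<bar> > 1")
      case True
      have "0 \<le> B" using B[of 0] norm_ge_zero[of "h 0"] by (intro order.trans[of 0 "norm (h 0)" B]) auto
      with True show ?thesis by (simp add: supp)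
    next
      case False
      then show ?thesis by (intro B) auto
    qed
    then show ?thesis using that by blast
  qed
  have floor_close: "\<bar>of_int \<lfloor>real N * u\<rfloor> / real N - u\<bar> \<le> 1 / real N" if "N \<ge> 1" for N u
  proof -
    have "\<bar>of_int \<lfloor>real N * u\<rfloor> - real N * u\<bar> \<le> 1" by linarith
    then have "\<bar>of_int \<lfloor>real N * u\<rfloor> - real N * u\<bar> / real N \<le> 1 / real N" by (intro divide_right_mono) auto
    moreover have "of_int \<lfloor>real N * u\<rfloor> / real N - u = (of_int \<lfloor>real N * u\<rfloor> - real N * u) / real N"
      using that by (simp add: field_simps)
    ultimately show ?thesis by (simp add: abs_divide)
  qed
  have lim: "(\<lambda>N. LINT u|lborel. s (Suc N) u) \<longlonglongrightarrow> (LINT u|lborel. h u)"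
  proof (rule integral_dominated_convergence)
    \<comment> \<open>The grid point differs from u by at most 1 / \<open>Suc N\<close> <= 1, so for
      u outside [-2, 2] it lies outside [-1, 1], where h vanishes.\<close>
    show "integrable lborel (\<lambda>u. indicator {-2..2::real} u *\<^sub>R B)"
      by (intro integrable_scaleR_left integrable_real_indicator) auto
    show "AE u in lborel. norm (s (Suc N) u) \<le> indicator {-2..2} u *\<^sub>R B" for N
    proof (rule AE_I2)
      fix u
      show "norm (s (Suc N) u) \<le> indicator {-2..2} u *\<^sub>R B"
      proof (cases "u \<in> {-2..2}")
        case False
        have far: "\<bar>y\<bar> > 1" if "\<bar>y - u\<bar> \<le> t" "t \<le> 1" for y t
          using that False by (auto simp: abs_if split: if_splits)
        have "\<bar>of_int \<lfloor>real (Suc N) * u\<rfloor> / real (Suc N)\<bar> > 1"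
          by (rule far[OF floor_close[of "Suc N" u]]) simp_all
        then show ?thesis using False by (simp add: s_def supp del: of_nat_Suc)
      qed (use B in \<open>auto simp: s_def\<close>)
    qed
    show "AE u in lborel. (\<lambda>N. s (Suc N) u) \<longlonglongrightarrow> h u"
    proof (rule AE_I2)
      fix u
      have "(\<lambda>N. of_int \<lfloor>real (Suc N) * u\<rfloor> / real (Suc N) - u) \<longlonglongrightarrow> 0"
        by (rule Lim_null_comparison[OF always_eventually LIMSEQ_Suc[OF lim_1_over_n]])
          (use floor_close in \<open>auto simp del: of_nat_Suc\<close>)
      then have "(\<lambda>N. of_int \<lfloor>real (Suc N) * u\<rfloor> / real (Suc N)) \<longlonglongrightarrow> u" by (rule LIM_zero_cancel)
      moreover have "isCont h u" using h by (simp add: continuous_on_eq_continuous_at)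
      ultimately show "(\<lambda>N. s (Suc N) u) \<longlonglongrightarrow> h u" unfolding s_def by (rule isCont_tendsto_compose[rotated])
    qed
  qed simp_all
  have step: "(LINT u|lborel. s N u) = (\<Sum>k\<in>{- int N..int N}. h (of_int k / real N)) / real N" if N: "N \<ge> 1" for N
  proof -
    define C where "C k = {of_int k / real N..<(of_int k + 1) / real N}" for k
    have C: "u \<in> C k \<longleftrightarrow> \<lfloor>real N * u\<rfloor> = k" for u k
      using N by (auto simp: C_def floor_eq_iff field_simps)
    have "s N u = (\<Sum>k\<in>{- int N..int N}. indicator (C k) u *\<^sub>R h (of_int k / real N))" for u
    proof -
      have "(\<Sum>k\<in>{- int N..int N}. indicator (C k) u *\<^sub>R h (of_int k / real N))
        = (\<Sum>k\<in>{- int N..int N}. if k = \<lfloor>real N * u\<rfloor> then h (of_int k / real N) else 0)"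
        by (intro sum.cong refl) (auto simp: indicator_def C)
      also have "\<dots> = s N u"
      proof (cases "\<lfloor>real N * u\<rfloor> \<in> {- int N..int N}")
        case False
        then have "\<bar>\<lfloor>real N * u\<rfloor>\<bar> > int N" by auto
        then have "\<bar>real_of_int \<lfloor>real N * u\<rfloor>\<bar> > real N" by linarith
        then have "\<bar>real_of_int \<lfloor>real N * u\<rfloor> / real N\<bar> > 1" using N by (simp add: abs_divide)
        then show ?thesis using False by (simp add: s_def supp)
      qed (simp add: s_def)
      finally show ?thesis by simp
    qed
    then have "(LINT u|lborel. s N u) = (LINT u|lborel. (\<Sum>k\<in>{- int N..int N}. indicator (C k) u *\<^sub>R h (of_int k / real N)))"
      by simp
    also have "\<dots> = (\<Sum>k\<in>{- int N..int N}. (LINT u|lborel. indicator (C k) u *\<^sub>R h (of_int k / real N)))"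
      using N by (intro Bochner_Integration.integral_sum integrable_scaleR_left integrable_real_indicator)
        (auto simp: C_def emeasure_lborel_Ico divide_right_mono)
    also have "\<dots> = (\<Sum>k\<in>{- int N..int N}. h (of_int k / real N) / real N)"
    proof (intro sum.cong refl)
      fix k
      have "measure lborel (C k) = 1 / real N"
        unfolding C_def by (simp add: divide_right_mono diff_divide_distrib[symmetric])
      then show "(LINT u|lborel. indicator (C k) u *\<^sub>R h (of_int k / real N)) = h (of_int k / real N) / real N"
        by (simp add: scaleR_conv_of_real)
    qed
    finally show ?thesis by (simp add: sum_divide_distrib)
  qed
  have "(\<lambda>N. (\<Sum>k\<in>{- int (Suc N)..int (Suc N)}. h (of_int k / real (Suc N))) / real (Suc N)) \<longlonglongrightarrow> (LINT u|lborel. h u)"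
    using lim by (simp only: step[OF Suc_le_mono[THEN iffD2, OF le0, folded One_nat_def]])
  then show ?thesis by (rule LIMSEQ_imp_Suc)
qed

text \<open>X need not be measurable for M itself. Its preimages differ from measurable sets by
  subsets of a null set, so it is measurable for the completion.\<close>

lemma integral_completion_AE_eq:
  fixes T X :: "'a \<Rightarrow> complex"
  assumes T: "T \<in> borel_measurable M" and Z: "Z \<in> null_sets M" "\<And>x. x \<in> space M - Z \<Longrightarrow> X x = T x"
  shows "(LINT x|completion M. X x) = (LINT x|M. T x)"
proof -
  have "X \<in> borel_measurable (completion M)"
  proof (rule measurableI)
    fix S :: "complex set" assume "S \<in> sets borel"
    then have "T -` S \<inter> space M - Z \<in> sets M" using measurable_sets[OF T] Z(1) by auto
    moreover have "X -` S \<inter> space M = (T -` S \<inter> space M - Z) \<union> (X -` S \<inter> space M \<inter> Z)" using Z(2) by auto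
    ultimately show "X -` S \<inter> space (completion M) \<in> sets (completion M)"
      using sets_completionI[of "X -` S \<inter> space M" "T -` S \<inter> space M - Z" "X -` S \<inter> space M \<inter> Z" Z M] Z(1) by auto
  qed simp
  moreover have "AE x in completion M. X x = T x"
  proof (rule AE_completion)
    show "AE x in M. X x = T x" by (rule AE_I'[OF Z(1)]) (use Z(2) in auto)
  qed
  ultimately have "(LINT x|completion M. X x) = (LINT x|completion M. T x)"
    by (intro integral_cong_AE measurable_completion[OF T])
  also have "\<dots> = (LINT x|M. T x)" by (rule integral_completion[OF T])
  finally show ?thesis .
qed

text \<open>Poisson summation is evaluated at the eigenvalues, which almost surely avoid the
  exceptional null set. The term k = 0 is the coefficient divided by N times the trace N of the
  identity, that is, the centring constant.\<close>

lemma linear_statistic_eq_trace_polynomial: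
  assumes M: "haar_prob N M" and N: "N \<ge> 1" and A: "A > 0" "\<epsilon> > 0"
    and gm: "g \<in> borel_measurable borel" and g: "polynomial_decay g A \<epsilon>" and fg: "AE x in lborel. f x = g x"
    and K: "finite K" "0 \<in> K" "\<And>k. k \<notin> K \<Longrightarrow> borel_fourier g (of_int k / real N) = 0"
  shows "\<exists>Z\<in>null_sets M. \<forall>U\<in>space M - Z. complex_of_real (linear_statistic f N U) - borel_fourier g 0
     = (\<Sum>k\<in>K - {0}. borel_fourier g (of_int k / real N) / real N * power_trace N k U)"
proof -
  let ?a = "\<lambda>k. borel_fourier g (of_int k / real N) / real N"
  have "AE z in circle_measure. complex_of_real (enum_periodized g N (circle_angle z)) = (\<Sum>k\<in>K. ?a k * z powi k)"
    by (rule poisson_summation_circle[OF gm g A N K(1)]) (rule K(3))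
  then have "AE z in circle_measure. complex_of_real (periodized f N (circle_angle z)) = (\<Sum>k\<in>K. ?a k * z powi k)"
    using periodized_eq_enum_AE[OF gm g A N fg]
    by eventually_elim simp
  then obtain S where S: "S \<in> null_sets circle_measure"
    "\<And>z. z \<notin> S \<Longrightarrow> complex_of_real (periodized f N (circle_angle z)) = (\<Sum>k\<in>K. ?a k * z powi k)"
    by (elim AE_E3) auto
  obtain Z where Z: "Z \<in> null_sets M" "\<And>U z. U \<in> space M - Z \<Longrightarrow> z \<in># proots (char_poly U) \<Longrightarrow> z \<notin> S"
    using eigenvalues_avoid_null_set[OF M S(1)] by blast
  show ?thesis
  proof (intro bexI[OF _ Z(1)] ballI)
    fix U assume U: "U \<in> space M - Z"
    then have U': "U \<in> unitary_group N" by (simp add: haar_prob_simps(3)[OF M])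
    have of_real_sum: "complex_of_real (\<Sum>z\<in>#R. q z) = (\<Sum>z\<in>#R. complex_of_real (q z))" for R and q :: "complex \<Rightarrow> real"
      by (induction R) auto
    have "complex_of_real (linear_statistic f N U) = (\<Sum>z\<in>#proots (char_poly U). \<Sum>k\<in>K. ?a k * z powi k)"
      unfolding linear_statistic_def of_real_sum
    proof (intro arg_cong[of _ _ sum_mset] image_mset_cong)
      fix z assume z: "z \<in># proots (char_poly U)"
      show "complex_of_real (periodized f N (Arg z)) = (\<Sum>k\<in>K. ?a k * z powi k)"
        using S(2)[OF Z(2)[OF U z]] circle_angle_eq_Arg[OF unitary_eigenvalue_norm[OF U' z]] by simp
    qed
    also have "\<dots> = (\<Sum>k\<in>K. ?a k * (\<Sum>z\<in>#proots (char_poly U). z powi k))"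
    proof -
      have "(\<Sum>z\<in>#R. \<Sum>k\<in>K. ?a k * z powi k) = (\<Sum>k\<in>K. ?a k * (\<Sum>z\<in>#R. z powi k))" for R
        by (induction R) (auto simp: sum.distrib distrib_left)
      then show ?thesis .
    qed
    also have "\<dots> = (\<Sum>k\<in>K. ?a k * power_trace N k U)" by (simp add: sum_eigenvalues_power_int[OF U'])
    also have "\<dots> = borel_fourier g 0 + (\<Sum>k\<in>K - {0}. ?a k * power_trace N k U)"
      using K N by (simp add: sum.remove[of K 0] power_trace_0[OF U'])
    finally show "complex_of_real (linear_statistic f N U) - borel_fourier g 0 = (\<Sum>k\<in>K - {0}. ?a k * power_trace N k U)"
      by simp
  qed
qed

theorem linear_statistic_moment:
  fixes f :: "real \<Rightarrow> real"
  assumes M: "haar_prob N M" and N: "N \<ge> 1" and A: "A > 0" "\<epsilon> > 0"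
    and gm: "g \<in> borel_measurable borel" and g: "polynomial_decay g A \<epsilon>" and fg: "AE x in lborel. f x = g x"
    and m: "m \<ge> 2" and supp: "\<And>u. \<bar>u\<bar> > 2 / real m \<Longrightarrow> borel_fourier g u = 0"
    and even: "\<And>u. borel_fourier g (- u) = borel_fourier g u"
  shows "(LINT U|completion M. (complex_of_real (linear_statistic f N U) - borel_fourier g 0) ^ m) =
    (if odd m then 0 else fact m / (2 ^ (m div 2) * fact (m div 2)) *
      ((\<Sum>k\<in>{- int N..int N}. complex_of_real \<bar>of_int k / real N\<bar> * borel_fourier g (of_int k / real N) ^ 2) / real N) ^ (m div 2))"
proof -
  define R where "R = 2 * int N div int m"
  define a where "a k = borel_fourier g (of_int k / real N) / real N" for k
  have R: "k \<in> {- R..R} \<longleftrightarrow> \<bar>k\<bar> * int m \<le> 2 * int N" for k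
  proof -
    have "k \<in> {- R..R} \<longleftrightarrow> \<bar>k\<bar> \<le> R" by (auto simp: abs_le_iff)
    also have "\<dots> \<longleftrightarrow> \<bar>k\<bar> * int m \<le> 2 * int N"
    proof
      assume "\<bar>k\<bar> \<le> R"
      then have "\<bar>k\<bar> * int m \<le> R * int m" by (intro mult_right_mono) auto
      also have "\<dots> \<le> 2 * int N" using div_mult_mod_eq[of "2 * int N" "int m"] pos_mod_sign[of "int m" "2 * int N"] m
        unfolding R_def by linarith
      finally show "\<bar>k\<bar> * int m \<le> 2 * int N" .
    next
      assume "\<bar>k\<bar> * int m \<le> 2 * int N"
      then have "\<bar>k\<bar> * int m div int m \<le> R" unfolding R_def using m by (intro zdiv_mono1) auto
      then show "\<bar>k\<bar> \<le> R" using m by simp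
    qed
    finally show ?thesis .
  qed
  have outside: "borel_fourier g (of_int k / real N) = 0" if "k \<notin> {- R..R}" for k
  proof (rule supp)
    have "2 * int N < \<bar>k\<bar> * int m" using that unfolding R by (simp only: not_le)
    then have "real_of_int (2 * int N) < real_of_int (\<bar>k\<bar> * int m)" by (simp only: of_int_less_iff)
    then have "2 * real N < \<bar>of_int k\<bar> * real m" by simp
    then show "2 / real m < \<bar>of_int k / real N\<bar>" using m N by (simp add: abs_divide field_simps)
  qed
  have "R \<ge> 0" unfolding R_def using m by (simp add: pos_imp_zdiv_nonneg_iff)
  obtain Z where Z: "Z \<in> null_sets M" "\<And>U. U \<in> space M - Z \<Longrightarrow>
     complex_of_real (linear_statistic f N U) - borel_fourier g 0 = (\<Sum>k\<in>{- R..R} - {0}. a k * power_trace N k U)"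
    using linear_statistic_eq_trace_polynomial[OF M N A gm g fg, of "{- R..R}"] outside \<open>R \<ge> 0\<close>
    unfolding a_def by auto
  have "(LINT U|completion M. (complex_of_real (linear_statistic f N U) - borel_fourier g 0) ^ m)
     = (LINT U|M. (\<Sum>k\<in>{- R..R} - {0}. a k * power_trace N k U) ^ m)"
  proof (rule integral_completion_AE_eq[OF _ Z(1)])
    show "(\<lambda>U. (\<Sum>k\<in>{- R..R} - {0}. a k * power_trace N k U) ^ m) \<in> borel_measurable M"
      unfolding haar_prob_simps(4)[OF M]
      by (intro borel_measurable_power borel_measurable_sum borel_measurable_times borel_measurable_const measurable_power_trace)
  qed (simp only: Z(2))
  also have "\<dots> = (if odd m then 0 else fact m / (2 ^ (m div 2) * fact (m div 2)) *
      (\<Sum>k\<in>{- R..R} - {0}. of_int \<bar>k\<bar> * a k * a (- k)) ^ (m div 2))"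
  proof (rule trace_polynomial_moments[OF M])
    show "\<bar>k\<bar> * int m \<le> 2 * int N" if "k \<in> {- R..R} - {0}" for k
      using that unfolding R[symmetric] by blast
  qed (use m in auto)
  also have "(\<Sum>k\<in>{- R..R} - {0}. of_int \<bar>k\<bar> * a k * a (- k))
     = (\<Sum>k\<in>{- int N..int N}. complex_of_real \<bar>of_int k / real N\<bar> * borel_fourier g (of_int k / real N) ^ 2) / real N"
  proof -
    \<comment> \<open>This uses m >= 2 and allows the sum to be extended to the range from -N to
      N.\<close>
    have "R \<le> int N"
    proof -
      have "R * 2 \<le> R * int m" using m \<open>R \<ge> 0\<close> by (intro mult_left_mono) auto
      also have "\<dots> \<le> 2 * int N" using R[THEN iffD1, of R] \<open>R \<ge> 0\<close> by simp
      finally show ?thesis by simp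
    qed
    \<comment> \<open>The added terms vanish: k = 0 because of the factor |k|, the others because of
      the support.\<close>
    have "(\<Sum>k\<in>{- R..R} - {0}. of_int \<bar>k\<bar> * a k * a (- k)) = (\<Sum>k\<in>{- int N..int N}. of_int \<bar>k\<bar> * a k * a (- k))"
    proof (rule sum.mono_neutral_left)
      show "\<forall>k\<in>{- int N..int N} - ({- R..R} - {0}). of_int \<bar>k\<bar> * a k * a (- k) = 0"
      proof
        fix k assume "k \<in> {- int N..int N} - ({- R..R} - {0})"
        then have "k = 0 \<or> k \<notin> {- R..R}" by blast
        then show "of_int \<bar>k\<bar> * a k * a (- k) = 0" using outside[of k] by (auto simp only: a_def) simp_all
      qed
    qed (use \<open>R \<le> int N\<close> in auto)
    also have "\<dots> = (\<Sum>k\<in>{- int N..int N}. complex_of_real \<bar>of_int k / real N\<bar> * borel_fourier g (of_int k / real N) ^ 2 / real N)"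
    proof (intro sum.cong refl)
      fix k
      have "complex_of_int \<bar>k\<bar> = complex_of_real \<bar>of_int k\<bar>" by (metis of_int_abs of_real_of_int_eq)
      then show "of_int \<bar>k\<bar> * a k * a (- k)
        = complex_of_real \<bar>of_int k / real N\<bar> * borel_fourier g (of_int k / real N) ^ 2 / real N"
        by (simp add: a_def abs_divide power2_eq_square even)
    qed
    finally show ?thesis by (simp add: sum_divide_distrib)
  qed
  finally show ?thesis .
qed

theorem theorem6p5:
  fixes f :: "real \<Rightarrow> real" and \<epsilon> A \<sigma> :: real and m :: nat
    and \<mu> :: "nat \<Rightarrow> complex mat measure"
  assumes haar: "\<And>N. N \<ge> 1 \<Longrightarrow> haar_prob N (\<mu> N)"
    and meas: "f \<in> borel_measurable lebesgue"
    and even_f: "\<And>x. f (- x) = f x"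
    and "\<epsilon> > 0" and "A > 0"
    and decay: "\<And>x. \<bar>f x\<bar> < A * (1 + \<bar>x\<bar>) powr (- (1 + \<epsilon>))"
    and "m \<ge> 2"
    and supp: "closure {u. fourier f u \<noteq> 0} \<subseteq> {- 2 / real m .. 2 / real m}"
    and "\<sigma> \<ge> 0"
    and sigma: "complex_of_real (\<sigma> ^ 2) =
      (LINT u|lborel. complex_of_real (min \<bar>u\<bar> 1) * (fourier f u) ^ 2)"
  shows "(\<lambda>N. LINT U|completion (\<mu> N).
            (complex_of_real (linear_statistic f N U) - fourier f 0) ^ m)
         \<longlonglongrightarrow> (if odd m then 0
              else let k = m div 2 in
                complex_of_real (fact (2 * k) / (2 ^ k * fact k) * \<sigma> ^ m))"
proof -
  obtain g where g: "g \<in> borel_measurable borel" "polynomial_decay g A \<epsilon>" "AE x in lborel. f x = g x"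
    using borel_version_with_decay[OF meas decay] by blast
  have F: "fourier f u = borel_fourier g u" for u by (rule fourier_eq_borel_fourier[OF meas g(1,3)])
  have gi: "integrable lborel g" by (rule decay_integrable[OF g(1,2) \<open>A > 0\<close> \<open>\<epsilon> > 0\<close>])
  \<comment> \<open>The function g inherits the symmetry of f only where both x and -x avoid the
    exceptional set.\<close>
  have "AE x in lborel. g (- x) = g x"
  proof -
    obtain Z where Z: "\<And>x. x \<in> space lborel - Z \<Longrightarrow> f x = g x" "Z \<in> null_sets lborel"
      by (rule AE_E3[OF g(3)]) blast
    have "AE x in lborel. x \<notin> Z" using Z(2) by (rule AE_not_in)
    moreover from this have "AE x in lborel. 0 + (- 1) * x \<notin> Z"
      using Z(2) by (intro AE_borel_affine) auto
    ultimately show ?thesis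
    proof eventually_elim
      case (elim x)
      then show ?case using Z(1)[of x] Z(1)[of "- x"] even_f[of x] by simp
    qed
  qed
  then have even_F: "borel_fourier g (- u) = borel_fourier g u" for u by (rule borel_fourier_even[OF g(1)])
  have supp_F: "borel_fourier g u = 0" if "\<bar>u\<bar> > 2 / real m" for u
  proof (rule ccontr)
    assume "borel_fourier g u \<noteq> 0"
    then have "u \<in> closure {u. fourier f u \<noteq> 0}" by (intro subsetD[OF closure_subset]) (simp add: F)
    then show False using supp that by (auto simp: abs_if split: if_splits)
  qed
  define h where "h u = complex_of_real \<bar>u\<bar> * borel_fourier g u ^ 2" for u
  \<comment> \<open>Since m >= 2 the support lies in [-1, 1], where min |u| 1 = |u|; this identifies
    the limit of the Riemann sums with the given variance.\<close>
  have m1: "2 / real m \<le> 1" using \<open>m \<ge> 2\<close> by simp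
  have lim_h: "(\<lambda>N. (\<Sum>k\<in>{- int N..int N}. h (of_int k / real N)) / real N) \<longlonglongrightarrow> (LINT u|lborel. h u)"
  proof (rule riemann_sum_tendsto_integral)
    show "continuous_on UNIV h" unfolding h_def
      by (intro continuous_intros continuous_borel_fourier g gi)
  qed (use supp_F m1 in \<open>auto simp: h_def\<close>)
  have "(LINT u|lborel. h u) = complex_of_real (\<sigma> ^ 2)"
    unfolding sigma
  proof (intro Bochner_Integration.integral_cong refl)
    fix u
    show "h u = complex_of_real (min \<bar>u\<bar> 1) * fourier f u ^ 2"
      using supp_F[of u] m1 by (cases "\<bar>u\<bar> \<le> 1") (auto simp: h_def F min_def)
  qed
  note lim = lim_h[unfolded this]
  \<comment> \<open>For every N >= 1 the moment is an exact function of the Riemann sum, so the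
    limit only concerns that sum.\<close>
  have moment: "(LINT U|completion (\<mu> N). (complex_of_real (linear_statistic f N U) - fourier f 0) ^ m)
    = (if odd m then 0 else fact m / (2 ^ (m div 2) * fact (m div 2)) *
      ((\<Sum>k\<in>{- int N..int N}. h (of_int k / real N)) / real N) ^ (m div 2))" if N: "N \<ge> 1" for N
    unfolding F h_def
    by (rule linear_statistic_moment[OF haar[OF N] N \<open>A > 0\<close> \<open>\<epsilon> > 0\<close> g \<open>m \<ge> 2\<close> supp_F even_F])
  have "(\<lambda>N. if odd m then 0 else fact m / (2 ^ (m div 2) * fact (m div 2)) *
      ((\<Sum>k\<in>{- int N..int N}. h (of_int k / real N)) / real N) ^ (m div 2))
    \<longlonglongrightarrow> (if odd m then 0 else let k = m div 2 in complex_of_real (fact (2 * k) / (2 ^ k * fact k) * \<sigma> ^ m))"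
  proof (cases "odd m")
    case False
    then obtain k where k: "m = 2 * k" by blast
    have "(\<lambda>N. fact m / (2 ^ (m div 2) * fact (m div 2)) *
      ((\<Sum>k\<in>{- int N..int N}. h (of_int k / real N)) / real N) ^ (m div 2))
      \<longlonglongrightarrow> fact m / (2 ^ (m div 2) * fact (m div 2)) * complex_of_real (\<sigma> ^ 2) ^ (m div 2)"
      by (intro tendsto_intros lim)
    then show ?thesis by (simp add: k power_mult)
  qed simp
  then show ?thesis
  proof (rule Lim_transform_eventually)
    show "\<forall>\<^sub>F N in sequentially. (if odd m then 0 else fact m / (2 ^ (m div 2) * fact (m div 2)) *
      ((\<Sum>k\<in>{- int N..int N}. h (of_int k / real N)) / real N) ^ (m div 2))
      = (LINT U|completion (\<mu> N). (complex_of_real (linear_statistic f N U) - fourier f 0) ^ m)"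
      using eventually_ge_at_top[of 1] by eventually_elim (simp only: moment)
  qed
qed

end
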